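(* For every $n\ge3$: $\mathfrak a_k^\pi(n)=\mathfrak a_k(n)$ for $k\in\{7,16,20,22\}$; $\mathfrak a_0^\pi(n)\cong\mathfrak u(1)^{\oplus n(n-1)/2}$; $\mathfrak a_2^\pi(n)=\{g\in\mathfrak{so}(2^n): gZ^{\otimes n}=Z^{\otimes n}g\}\cong\mathfrak{so}(2^{n-1})^{\oplus2}$; $\mathfrak a_4^\pi(n)=\mathfrak a_7(n)$, which is $\cong\mathfrak{su}(2^{n-1})$ for $n$ odd and $\cong\mathfrak{su}(2^{n-2})^{\oplus4}$ for $n\ge4$ even; $\mathfrak a_6^\pi(n)=\mathfrak a_{20}(n)\cong\mathfrak a_{14}^\pi(n)\cong\mathfrak{su}(2^{n-1})^{\oplus2}$; $\mathfrak b_0^\pi(n)=\mathfrak b_0(n)\cong\mathfrak u(1)^{\oplus n}$; $\mathfrak b_1^\pi(n)\cong\mathfrak u(1)^{\oplus n(n+1)/2}$; $\mathfrak b_3^\pi(n)=\mathfrak b_3(n)\cong\mathfrak{su}(2)^{\oplus n}$.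
   Context: Pauli matrices $I,X,Y,Z$; a length-$n$ Pauli string is $A^1\otimes\cdots\otimes A^n$ with $A^j\in\{I,X,Y,Z\}$. For two-qubit strings $AB$ and $1\le i\ne j\le n$, $A_iB_j$ denotes the length-$n$ string with $A$ at position $i$, $B$ at position $j$, $I$ elsewhere. $\mathfrak{su}(N)$: traceless skew-Hermitian matrices; $\mathfrak{so}(N)$: real skew-symmetric matrices; $\mathfrak u(1)$ the one-dimensional real Lie algebra; $\mathfrak g^{\oplus m}$ a direct sum of $m$ commuting copies. For a set $S$ of Pauli strings, $\mathrm{Lie}\langle S\rangle$ is the smallest real Lie subalgebra of $\mathfrak u(2^n)$ containing $\{iP:P\in S\}$. For a set $G$ of two-qubit Pauli strings $AB\ne II$: open-chain algebra $G(n)=\mathrm{Lie}\langle A_jB_{j+1}: AB\in G, 1\le j\le n-1\rangle$; permutation-invariant algebra $G^\pi(n)=\mathrm{Lie}\langle A_iB_j: AB\in G,\ 1\le i\ne j\le n\rangle$. Generating sets: $\mathfrak a_0=\{XX\}$, $\mathfrak a_2=\{XY,YX\}$, $\mathfrak a_4=\{XX,YY\}$, $\mathfrak a_6=\{XX,YZ,ZY\}$, $\mathfrak a_7=\{XX,YY,ZZ\}$, $\mathfrak a_{14}=\{XX,YY,XY\}$, $\mathfrak a_{16}=\{XY,YX,YZ,ZY\}$, $\mathfrak a_{20}=\{XX,YY,ZZ,ZY\}$, $\mathfrak a_{22}=\{XX,XY,XZ,YX\}$, $\mathfrak b_0=\{XI,IX\}$, $\mathfrak b_1=\{XX,XI,IX\}$,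 $\mathfrak b_3=\{XI,YI,IX,IY\}$. *)

theory Defs
  imports "Jordan_Normal_Form.Matrix"
begin

datatype pauli = PI | PX | PY | PZ

text \<open>Entries of the single-qubit Pauli matrices, indexed by basis bits (False = |0>, True = |1>).\<close>
fun pentry :: "pauli \<Rightarrow> bool \<Rightarrow> bool \<Rightarrow> complex" where
  "pentry PI a b = (if a = b then 1 else 0)"
| "pentry PX a b = (if a \<noteq> b then 1 else 0)"
| "pentry PY a b = (if a = b then 0 else if a then \<i> else - \<i>)"
| "pentry PZ a b = (if a = b then (if a then -1 else 1) else 0)"

definition qbit :: "nat \<Rightarrow> nat \<Rightarrow> bool" where
  "qbit a j = odd (a div 2 ^ j)"

definition pstr :: "nat \<Rightarrow> (nat \<Rightarrow> pauli) \<Rightarrow> complex mat" where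
  "pstr n s = mat (2 ^ n) (2 ^ n) (\<lambda>(a, b). \<Prod>j<n. pentry (s j) (qbit a j) (qbit b j))"

definition ps2 :: "nat \<Rightarrow> pauli \<Rightarrow> pauli \<Rightarrow> nat \<Rightarrow> nat \<Rightarrow> complex mat" where
  "ps2 n A B i j = pstr n (\<lambda>k. if k = i then A else if k = j then B else PI)"

definition comm :: "complex mat \<Rightarrow> complex mat \<Rightarrow> complex mat" where
  "comm x y = x * y - y * x"

inductive_set lie_closure :: "nat \<Rightarrow> complex mat set \<Rightarrow> complex mat set"
  for N :: nat and S :: "complex mat set" where
  gen: "x \<in> S \<Longrightarrow> x \<in> lie_closure N S"
| zero: "0\<^sub>m N N \<in> lie_closure N S"
| add: "x \<in> lie_closure N S \<Longrightarrow> y \<in> lie_closure N S \<Longrightarrow> x + y \<in> lie_closure N S"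
| smult: "x \<in> lie_closure N S \<Longrightarrow> complex_of_real r \<cdot>\<^sub>m x \<in> lie_closure N S"
| bracket: "x \<in> lie_closure N S \<Longrightarrow> y \<in> lie_closure N S \<Longrightarrow> comm x y \<in> lie_closure N S"

definition Lie :: "nat \<Rightarrow> complex mat set \<Rightarrow> complex mat set" where
  "Lie n S = lie_closure (2 ^ n) ((\<lambda>P. \<i> \<cdot>\<^sub>m P) ` S)"

definition chain_alg :: "(pauli \<times> pauli) set \<Rightarrow> nat \<Rightarrow> complex mat set" where
  "chain_alg G n = Lie n {ps2 n A B j (j + 1) | A B j. (A, B) \<in> G \<and> j + 1 < n}"

definition perm_alg :: "(pauli \<times> pauli) set \<Rightarrow> nat \<Rightarrow> complex mat set" where
  "perm_alg G n = Lie n {ps2 n A B i j | A B i j. (A, B) \<in> G \<and> i < n \<and> j < n \<and> i \<noteq> j}"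

definition "a0 = {(PX, PX)}"
definition "a2 = {(PX, PY), (PY, PX)}"
definition "a4 = {(PX, PX), (PY, PY)}"
definition "a6 = {(PX, PX), (PY, PZ), (PZ, PY)}"
definition "a7 = {(PX, PX), (PY, PY), (PZ, PZ)}"
definition "a14 = {(PX, PX), (PY, PY), (PX, PY)}"
definition "a16 = {(PX, PY), (PY, PX), (PY, PZ), (PZ, PY)}"
definition "a20 = {(PX, PX), (PY, PY), (PZ, PZ), (PZ, PY)}"
definition "a22 = {(PX, PX), (PX, PY), (PX, PZ), (PY, PX)}"
definition "b0 = {(PX, PI), (PI, PX)}"
definition "b1 = {(PX, PX), (PX, PI), (PI, PX)}"
definition "b3 = {(PX, PI), (PY, PI), (PI, PX), (PI, PY)}"

definition su :: "nat \<Rightarrow> complex mat set" where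
  "su N = {M \<in> carrier_mat N N. (\<forall>i<N. \<forall>j<N. M $$ (i, j) = - cnj (M $$ (j, i)))
                                \<and> (\<Sum>i<N. M $$ (i, i)) = 0}"

definition so :: "nat \<Rightarrow> complex mat set" where
  "so N = {M \<in> carrier_mat N N. \<forall>i<N. \<forall>j<N. M $$ (i, j) \<in> \<real> \<and> M $$ (i, j) = - M $$ (j, i)}"

definition u1 :: "complex mat set" where
  "u1 = {M \<in> carrier_mat 1 1. Re (M $$ (0, 0)) = 0}"

text \<open>Direct sum of m commuting copies of L (a Lie algebra of N x N matrices), realised as block-diagonal matrices.\<close>
definition dsum :: "nat \<Rightarrow> nat \<Rightarrow> complex mat set \<Rightarrow> complex mat set" where
  "dsum m N L = {M \<in> carrier_mat (m * N) (m * N).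
      (\<forall>i<m * N. \<forall>j<m * N. i div N \<noteq> j div N \<longrightarrow> M $$ (i, j) = 0)
    \<and> (\<forall>k<m. mat N N (\<lambda>(a, b). M $$ (k * N + a, k * N + b)) \<in> L)}"

definition lie_iso :: "complex mat set \<Rightarrow> complex mat set \<Rightarrow> bool" (infix "\<cong>\<^sub>L" 50) where
  "L1 \<cong>\<^sub>L L2 \<longleftrightarrow> (\<exists>f. bij_betw f L1 L2
      \<and> (\<forall>x\<in>L1. \<forall>y\<in>L1. f (x + y) = f x + f y)
      \<and> (\<forall>r::real. \<forall>x\<in>L1. f (complex_of_real r \<cdot>\<^sub>m x) = complex_of_real r \<cdot>\<^sub>m f x)
      \<and> (\<forall>x\<in>L1. \<forall>y\<in>L1. f (comm x y) = comm (f x) (f y)))"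

end

theory Submission
  imports Defs "Jordan_Normal_Form.Determinant" "HOL-Library.FuncSet"
begin

text \<open>Two Pauli strings commute or anticommute, and the commutator of anticommuting strings is, up to a
  real factor, their product. So a Lie algebra generated by strings is the real span of the closure of
  the generators under products of anticommuting pairs. Equalities between algebras only require that
  the generators of one lie in the closure of the other. To describe an algebra completely, it is
  compared with the skew-Hermitian matrices M that commute with the strings Q commuting with all
  generators and satisfy tr (Q M) = 0: the Pauli expansion of such an M involves only the remaining
  strings, and these are reached from the generators by induction on the number of non-identity letters.
  Diagonalising the strings Q simultaneously turns M into a block-diagonal matrix, which yields the
  isomorphism types; when X...X and Z...Z anticommute (n odd), the even-parity block determines M.\<close>

section \<open>Products of Pauli matrices\<close>

text \<open>The trace condition reflects that each Q commutes with the whole algebra: if x and y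
  commute with Q then tr (Q [x, y]) = 0, so brackets never acquire a component along Q. The obstacle
  in the induction on weight is a string whose nontrivial letters all agree: no product with one
  equal pair AA shortens it, and an identity position has to be borrowed for a detour of three
  moves. Constant strings offer no such detour; for XX, YY, ZZ they are exactly the strings removed
  by the trace condition.

  Not every algebra is such a commutant. For {XY, YX} transposition imposes a further parity, an odd
  number of Y's. For single-site X and Y only the identity string commutes with all generators, and
  an abelian algebra has its own generators among the Q. These algebras are assembled from commuting
  images of su(2) or u(1), with independence read off from single entries or from traces. Finally,
  {XX, YY, ZZ, ZY} is centralised by X...X but {XX, YY, XY} by Z...Z; a rotation of the letters
  matches the two.\<close>

fun pm :: "pauli \<Rightarrow> pauli \<Rightarrow> pauli" where
  "pm PI B = B"
| "pm A PI = A"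
| "pm PX PX = PI" | "pm PX PY = PZ" | "pm PX PZ = PY"
| "pm PY PX = PZ" | "pm PY PY = PI" | "pm PY PZ = PX"
| "pm PZ PX = PY" | "pm PZ PY = PX" | "pm PZ PZ = PI"

text \<open>The matrix product of A and B is \<open>ph A B\<close> times \<open>pm A B\<close>. With
  the phase split off, letters form the Klein four-group under \<open>pm\<close>, and all closure
  arguments take place there.\<close>

fun ph :: "pauli \<Rightarrow> pauli \<Rightarrow> complex" where
  "ph PX PY = \<i>" | "ph PY PZ = \<i>" | "ph PZ PX = \<i>"
| "ph PY PX = - \<i>" | "ph PZ PY = - \<i>" | "ph PX PZ = - \<i>"
| "ph _ _ = 1"

definition ac :: "pauli \<Rightarrow> pauli \<Rightarrow> bool" where
  "ac A B \<longleftrightarrow> A \<noteq> PI \<and> B \<noteq> PI \<and> A \<noteq> B"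

definition sg :: "pauli \<Rightarrow> pauli \<Rightarrow> complex" where
  "sg A B = (if ac A B then -1 else 1)"

text \<open>Strings anticommute iff an odd number of positions do. The parity is kept as a complex
  product of signs, so that it multiplies directly with the phases and splits by product
  lemmas.\<close>

definition acomm :: "nat \<Rightarrow> (nat \<Rightarrow> pauli) \<Rightarrow> (nat \<Rightarrow> pauli) \<Rightarrow> bool" where
  "acomm n s t \<longleftrightarrow> (\<Prod>j<n. sg (s j) (t j)) = -1"

lemma pm_cancel [simp]: "pm (pm A B) B = A"
  by (cases A; cases B) auto

lemma pm_self [simp]: "pm A A = PI"
  by (cases A) auto

lemma pm_eq_PI_iff: "pm A B = PI \<longleftrightarrow> A = B"
  by (cases A; cases B) auto

lemma pm_PI_right [simp]: "pm A PI = A"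
  by (cases A) auto

lemma ph_self [simp]: "ph A A = 1"
  by (cases A) auto

lemma ph_swap: "ph A B = sg A B * ph B A"
  by (cases A; cases B) (auto simp: sg_def ac_def)

lemma ph_nonzero: "ph A B \<noteq> 0"
  by (cases A; cases B) auto

lemma ph_square: "ph A B * ph A B = sg A B"
  by (cases A; cases B) (auto simp: sg_def ac_def)

lemma pentry_mult:
  "(\<Sum>c\<in>UNIV. pentry A a c * pentry B c b) = ph A B * pentry (pm A B) a b"
  by (cases A; cases B; cases a; cases b) (auto simp: UNIV_bool)

lemma cnj_pentry: "cnj (pentry A a b) = pentry A b a"
  by (cases A) auto

lemma prod_cnj: "cnj (\<Prod>j<(n::nat). f j) = (\<Prod>j<n. cnj (f j))"
  by (induction n) auto

lemma prod_sg_cases: "(\<Prod>j<(n::nat). sg (s j) (t j)) \<in> {1, -1}"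
  by (induction n) (auto simp: sg_def)

lemma not_acomm_iff: "\<not> acomm n s t \<longleftrightarrow> (\<Prod>j<n. sg (s j) (t j)) = 1"
  using prod_sg_cases[of s t n] by (auto simp: acomm_def)

section \<open>Bits of basis indices\<close>

lemma power_two_split: "j < n \<Longrightarrow> (2::nat) ^ n = 2 ^ j * (2 * 2 ^ (n - j - 1))"
  unfolding power_Suc[symmetric] power_add[symmetric] by simp

lemma qbit_add_high:
  assumes "c < 2 ^ n"
  shows "qbit (c + 2 ^ n) j = (if j < n then qbit c j else j = n)"
proof -
  consider "j < n" | "j = n" | "j > n" by linarith
  then show ?thesis
  proof cases
    case 1
    then have "(2::nat) ^ n = 2 ^ j * (2 * 2 ^ (n - j - 1))"
      by (rule power_two_split)
    then have "(c + 2 ^ n) div 2 ^ j = c div 2 ^ j + 2 * 2 ^ (n - j - 1)"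
      by simp
    then show ?thesis using 1 by (simp add: qbit_def)
  next
    case 2
    then show ?thesis using assms by (simp add: qbit_def)
  next
    case 3
    then have "(2::nat) ^ Suc n \<le> 2 ^ j"
      by (intro power_increasing) auto
    then have "c + 2 ^ n < 2 ^ j" using assms by simp
    then show ?thesis using 3 by (simp add: qbit_def)
  qed
qed

lemma qbit_high: "c < 2 ^ n \<Longrightarrow> n \<le> j \<Longrightarrow> \<not> qbit c j"
  by (simp add: qbit_def div_less[OF order_less_le_trans[OF _ power_increasing]])

lemma lessThan_double: "{..<2 * (m::nat)} = {..<m} \<union> (\<lambda>c. c + m) ` {..<m}"
proof -
  have *: "x \<in> (\<lambda>c. c + m) ` {..<m}" if "m \<le> x" "x < 2 * m" for x
    using that by (intro image_eqI[of _ _ "x - m"]) auto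
  have "x \<in> {..<2 * m} \<longleftrightarrow> x \<in> {..<m} \<union> (\<lambda>c. c + m) ` {..<m}" for x
    using *[of x] by (cases "x < m") auto
  then show ?thesis by blast
qed

lemma sum_lessThan_double:
  "(\<Sum>c<2 * (m::nat). f c) = (\<Sum>c<m. f c) + (\<Sum>c<m. f (c + m))"
  for f :: "nat \<Rightarrow> 'a::comm_monoid_add"
proof -
  have "(\<Sum>c<2 * m. f c) = (\<Sum>c<m. f c) + sum f ((\<lambda>c. c + m) ` {..<m})"
    unfolding lessThan_double by (intro sum.union_disjoint) auto
  also have "sum f ((\<lambda>c. c + m) ` {..<m}) = (\<Sum>c<m. f (c + m))"
    by (subst sum.reindex) (auto simp: inj_on_def)
  finally show ?thesis .
qed

text \<open>Distributivity: an index below 2^n is a choice of n bits. The induction splits off the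
  top bit, which separates the lower from the upper half of the range. Products and traces of tensor
  products thereby reduce to 2 x 2 computations.\<close>

lemma sum_prod_bits:
  fixes h :: "nat \<Rightarrow> bool \<Rightarrow> complex"
  shows "(\<Sum>c<2 ^ n. \<Prod>j<n. h j (qbit c j)) = (\<Prod>j<n. \<Sum>x\<in>UNIV. h j x)"
proof (induction n)
  case 0
  show ?case by simp
next
  case (Suc n)
  have 1: "(\<Prod>j<Suc n. h j (qbit c j)) = (\<Prod>j<n. h j (qbit c j)) * h n False" if "c < 2 ^ n" for c
    using qbit_high[OF that, of n] by simp
  have 2: "(\<Prod>j<Suc n. h j (qbit (c + 2 ^ n) j)) = (\<Prod>j<n. h j (qbit c j)) * h n True" if "c < 2 ^ n" for c
    using that by (simp add: qbit_add_high)
  have "(\<Sum>c<2 ^ Suc n. \<Prod>j<Suc n. h j (qbit c j)) =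
     (\<Sum>c<2 ^ n. (\<Prod>j<n. h j (qbit c j)) * h n False) + (\<Sum>c<2 ^ n. (\<Prod>j<n. h j (qbit c j)) * h n True)"
    unfolding power_Suc sum_lessThan_double using 1 2 by (intro arg_cong2[of _ _ _ _ "(+)"] sum.cong) auto
  also have "\<dots> = (\<Sum>c<2 ^ n. \<Prod>j<n. h j (qbit c j)) * (\<Sum>x\<in>UNIV. h n x)"
    by (simp add: UNIV_bool distrib_left add.commute flip: sum_distrib_right)
  finally show ?case using Suc by simp
qed

lemma bits_eqI:
  assumes "a < 2 ^ n" "b < 2 ^ n" "\<And>j. j < n \<Longrightarrow> qbit a j = qbit b j"
  shows "a = b"
  using assms
proof (induction n arbitrary: a b)
  case 0
  then show ?case by simp
next
  case (Suc n)
  have *: "qbit (a mod 2 ^ n) j = qbit a j" if "j < n" for a j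
  proof (cases "a div 2 ^ n = 0")
    case True
    then show ?thesis by (metis add_0 mult_0_right mult_div_mod_eq)
  next
    case False
    have "(2::nat) ^ n = 2 ^ j * (2 * 2 ^ (n - j - 1))"
      using that by (rule power_two_split)
    then have "a div 2 ^ j = (a mod 2 ^ n + 2 ^ j * (2 * 2 ^ (n - j - 1) * (a div 2 ^ n))) div 2 ^ j"
      by (metis mod_mult_div_eq mult.assoc)
    also have "\<dots> = a mod 2 ^ n div 2 ^ j + 2 * 2 ^ (n - j - 1) * (a div 2 ^ n)"
      by simp
    finally show ?thesis by (simp add: qbit_def)
  qed
  have lo: "a mod 2 ^ n = b mod 2 ^ n"
    using Suc by (intro Suc.IH) (auto simp: *)
  have "a div 2 ^ n < 2" "b div 2 ^ n < 2"
    using Suc.prems by (auto simp: less_mult_imp_div_less)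
  moreover have "odd (a div 2 ^ n) = odd (b div 2 ^ n)"
    using Suc.prems(3)[of n] by (simp add: qbit_def)
  ultimately have "a div 2 ^ n = b div 2 ^ n"
    by (auto dest!: less_2_cases)
  with lo show ?case by (metis mult_div_mod_eq)
qed

lemma bits_eq_iff:
  "a < 2 ^ n \<Longrightarrow> b < 2 ^ n \<Longrightarrow> a = b \<longleftrightarrow> (\<forall>j<n. qbit a j = qbit b j)"
  using bits_eqI by blast

lemma prod_indicator:
  "(\<Prod>j<(n::nat). if P j then (x::complex) else 0) = (if \<forall>j<n. P j then x ^ n else 0)"
  by (induction n) (auto simp: less_Suc_eq)

section \<open>Tensor products of two-by-two matrices\<close>

text \<open>The Kronecker product of an arbitrary 2 x 2 matrix at each site. Besides Pauli strings
  it covers single-site embeddings and the tensor power of a rotation.\<close>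

definition tens :: "nat \<Rightarrow> (nat \<Rightarrow> bool \<Rightarrow> bool \<Rightarrow> complex) \<Rightarrow> complex mat" where
  "tens n F = mat (2 ^ n) (2 ^ n) (\<lambda>(a, b). \<Prod>j<n. F j (qbit a j) (qbit b j))"

lemma tens_carrier [simp]: "tens n F \<in> carrier_mat (2 ^ n) (2 ^ n)"
  by (simp add: tens_def)

lemma pstr_tens: "pstr n s = tens n (\<lambda>j. pentry (s j))"
  by (simp add: pstr_def tens_def)

lemma pstr_carrier [simp]: "pstr n s \<in> carrier_mat (2 ^ n) (2 ^ n)"
  by (simp add: pstr_def)

lemma pstr_dim [simp]: "dim_row (pstr n s) = 2 ^ n" "dim_col (pstr n s) = 2 ^ n"
  by (simp_all add: pstr_def)

lemma tens_cong: "(\<And>j a b. j < n \<Longrightarrow> F j a b = G j a b) \<Longrightarrow> tens n F = tens n G"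
  by (auto simp: tens_def intro!: eq_matI prod.cong)

lemma pstr_cong: "(\<And>j. j < n \<Longrightarrow> s j = t j) \<Longrightarrow> pstr n s = pstr n t"
  unfolding pstr_tens by (intro tens_cong) auto

lemma mult_mat_index:
  assumes "A \<in> carrier_mat N K" "B \<in> carrier_mat K M" "i < N" "j < M"
  shows "(A * B) $$ (i, j) = (\<Sum>k<K. A $$ (i, k) * B $$ (k, j))"
  using assms by (auto simp: scalar_prod_def lessThan_atLeast0 intro!: sum.cong)

lemma tens_mult: "tens n F * tens n G = tens n (\<lambda>j a b. \<Sum>c\<in>UNIV. F j a c * G j c b)"
proof (rule eq_matI)
  fix a b
  assume ab: "a < dim_row (tens n (\<lambda>j a b. \<Sum>c\<in>UNIV. F j a c * G j c b))"
    "b < dim_col (tens n (\<lambda>j a b. \<Sum>c\<in>UNIV. F j a c * G j c b))"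
  then have ab: "a < 2 ^ n" "b < 2 ^ n" by (auto simp: tens_def)
  have "(tens n F * tens n G) $$ (a, b) = (\<Sum>c<2 ^ n. tens n F $$ (a, c) * tens n G $$ (c, b))"
    using ab by (intro mult_mat_index) auto
  also have "\<dots> = (\<Sum>c<2 ^ n. \<Prod>j<n. F j (qbit a j) (qbit c j) * G j (qbit c j) (qbit b j))"
    using ab by (intro sum.cong) (auto simp: tens_def prod.distrib)
  also have "\<dots> = (\<Prod>j<n. \<Sum>c\<in>UNIV. F j (qbit a j) c * G j c (qbit b j))"
    by (rule sum_prod_bits)
  finally show "(tens n F * tens n G) $$ (a, b) = tens n (\<lambda>j a b. \<Sum>c\<in>UNIV. F j a c * G j c b) $$ (a, b)"
    using ab by (simp add: tens_def)
qed (auto simp: tens_def)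

lemma tens_one: "tens n (\<lambda>j a b. if a = b then 1 else 0) = 1\<^sub>m (2 ^ n)"
  by (rule eq_matI) (auto simp: tens_def prod_indicator bits_eq_iff)

lemma pstr_PI: "pstr n (\<lambda>_. PI) = 1\<^sub>m (2 ^ n)"
  unfolding pstr_tens tens_one[symmetric] by (intro tens_cong) auto

lemma tens_scale: "tens n (\<lambda>j a b. c j * F j a b) = (\<Prod>j<n. c j) \<cdot>\<^sub>m tens n F"
  by (rule eq_matI) (auto simp: tens_def prod.distrib)

definition phs :: "nat \<Rightarrow> (nat \<Rightarrow> pauli) \<Rightarrow> (nat \<Rightarrow> pauli) \<Rightarrow> complex" where
  "phs n s t = (\<Prod>j<n. ph (s j) (t j))"

lemma pstr_mult: "pstr n s * pstr n t = phs n s t \<cdot>\<^sub>m pstr n (\<lambda>j. pm (s j) (t j))"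
  unfolding pstr_tens tens_mult phs_def by (simp add: pentry_mult tens_scale)

lemma phs_nonzero: "phs n s t \<noteq> 0"
  by (simp add: phs_def ph_nonzero)

lemma phs_swap: "phs n s t = (if acomm n s t then -1 else 1) * phs n t s"
proof -
  have "phs n s t = (\<Prod>j<n. sg (s j) (t j)) * phs n t s"
    unfolding phs_def prod.distrib[symmetric] by (intro prod.cong refl ph_swap)
  then show ?thesis
    using not_acomm_iff[of n s t] by (auto simp: acomm_def)
qed

text \<open>The square of the phase is the product of the signs, here -1, so the phase is \<i> or
  -\<i>. This is why the bracket of \<i>P and \<i>Q is a real multiple of \<i> times a
  string.\<close>

lemma phs_anticommuting:
  assumes "acomm n s t"
  obtains e :: real where "e \<noteq> 0" "phs n s t = \<i> * of_real e"
proof -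
  have "phs n s t * phs n s t = (\<Prod>j<n. sg (s j) (t j))"
    by (simp add: phs_def ph_square flip: prod.distrib)
  then have "(phs n s t)\<^sup>2 = \<i>\<^sup>2"
    using assms by (simp add: acomm_def power2_eq_square)
  then have "phs n s t = \<i> * of_real 1 \<or> phs n s t = \<i> * of_real (-1)"
    unfolding power2_eq_iff by simp
  then show thesis using that by (metis one_neq_zero neg_equal_0_iff_equal)
qed

lemma pm_commute: "pm A B = pm B A"
  by (cases A; cases B) auto

lemma pstr_commute:
  "pstr n s * pstr n t = (if acomm n s t then -1 else 1) \<cdot>\<^sub>m (pstr n t * pstr n s)"
  unfolding pstr_mult pm_commute[of "t _"] by (subst phs_swap) (auto intro!: eq_matI)

lemma pstr_square: "pstr n s * pstr n s = 1\<^sub>m (2 ^ n)"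
  by (auto simp: pstr_mult phs_def pstr_PI intro!: eq_matI)

section \<open>Strings generated by two-site products\<close>

definition two :: "pauli \<Rightarrow> pauli \<Rightarrow> nat \<Rightarrow> nat \<Rightarrow> nat \<Rightarrow> pauli" where
  "two A B i j = (\<lambda>k. if k = i then A else if k = j then B else PI)"

lemma prod_two_points:
  fixes f :: "nat \<Rightarrow> complex"
  assumes "i < n" "j < n" "i \<noteq> j"
  shows "(\<Prod>k<n. f k) = f i * f j * (\<Prod>k\<in>{..<n} - {i, j}. f k)"
proof -
  have "(\<Prod>k<n. f k) = f i * prod f ({..<n} - {i})"
    using assms by (intro prod.remove) auto
  also have "prod f ({..<n} - {i}) = f j * prod f ({..<n} - {i} - {j})"
    using assms by (intro prod.remove) auto
  also have "{..<n} - {i} - {j} = {..<n} - {i, j}" by blast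
  finally show ?thesis by (simp add: mult.assoc)
qed

lemma prod_update_two:
  fixes h :: "pauli \<Rightarrow> complex" and s :: "nat \<Rightarrow> pauli"
  assumes "i < n" "j < n" "i \<noteq> j" "h x * h y = h (s i) * h (s j)"
  shows "(\<Prod>k<n. h ((s(i := x, j := y)) k)) = (\<Prod>k<n. h (s k))"
proof -
  have "(\<Prod>k\<in>{..<n} - {i, j}. h ((s(i := x, j := y)) k)) = (\<Prod>k\<in>{..<n} - {i, j}. h (s k))"
    by (intro prod.cong) auto
  then show ?thesis
    unfolding prod_two_points[OF assms(1-3)] using assms by simp
qed

lemma sg_pm: "sg (pm A B) D = sg A D * sg B D"
  by (cases A; cases B; cases D) (auto simp: sg_def ac_def)

lemma sg_square [simp]: "sg A B * sg A B = 1" "sg A B * (sg A B * x) = x"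
  by (auto simp: sg_def)

lemma sg_PI [simp]: "sg PI A = 1" "sg A PI = 1"
  by (auto simp: sg_def ac_def)

lemma acomm_two:
  assumes "i < n" "j < n" "i \<noteq> j"
  shows "acomm n s (two A B i j) \<longleftrightarrow> ac (s i) A \<noteq> ac (s j) B"
proof -
  have "(\<Prod>k\<in>{..<n} - {i, j}. sg (s k) (two A B i j k)) = 1"
    by (intro prod.neutral) (auto simp: two_def sg_def ac_def)
  then show ?thesis
    unfolding acomm_def prod_two_points[OF assms] using assms
    by (simp add: two_def sg_def)
qed

section \<open>Sets of strings closed under anticommuting products\<close>

definition weight :: "nat \<Rightarrow> (nat \<Rightarrow> pauli) \<Rightarrow> nat" where
  "weight n s = card {k. k < n \<and> s k \<noteq> PI}"

lemma weight_update_less: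
  assumes "i < n" "s i \<noteq> PI" "s' i = PI" "\<And>k. k < n \<Longrightarrow> s' k \<noteq> PI \<Longrightarrow> s k \<noteq> PI"
  shows "weight n s' < weight n s"
  unfolding weight_def using assms by (intro psubset_card_mono) auto

text \<open>Real factors are absorbed by the Lie algebra, so only letters have to be tracked.
  \<open>cong\<close> makes membership depend on the first \<open>n\<close> letters alone.\<close>

locale pauli_closed =
  fixes n :: nat and C :: "(nat \<Rightarrow> pauli) set"
  assumes cong: "s \<in> C \<Longrightarrow> (\<And>j. j < n \<Longrightarrow> s j = t j) \<Longrightarrow> t \<in> C"
    and mult: "s \<in> C \<Longrightarrow> t \<in> C \<Longrightarrow> acomm n s t \<Longrightarrow> (\<lambda>j. pm (s j) (t j)) \<in> C"
begin

lemma move: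
  assumes "s \<in> C" "two A B i j \<in> C" "i < n" "j < n" "i \<noteq> j" "ac (s i) A \<noteq> ac (s j) B"
    and "\<And>k. t k = (s(i := pm (s i) A, j := pm (s j) B)) k"
  shows "t \<in> C"
proof -
  have "(\<lambda>k. pm (s k) (two A B i j k)) \<in> C"
    using assms by (intro mult) (auto simp: acomm_two)
  moreover have "(\<lambda>k. pm (s k) (two A B i j k)) = t"
    using assms(5,7) by (auto simp: two_def fun_eq_iff)
  ultimately show ?thesis by simp
qed

text \<open>Multiplying by the same two-site string twice restores the letters, and anticommutation
  with it is unaffected by the first multiplication. Hence reaching a shortened string suffices,
  which is the form that an induction on weight uses.\<close>

lemma move_back:
  assumes "s(i := pm (s i) A, j := pm (s j) B) \<in> C" "two A B i j \<in> C"
    "i < n" "j < n" "i \<noteq> j" "ac (s i) A \<noteq> ac (s j) B"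
  shows "s \<in> C"
proof (rule move[OF assms(1-5)])
  have "ac (pm D E) E = ac D E" for D E
    by (cases D; cases E) (auto simp: ac_def)
  then show "ac ((s(i := pm (s i) A, j := pm (s j) B)) i) A \<noteq> ac ((s(i := pm (s i) A, j := pm (s j) B)) j) B"
    using assms by simp
qed (use assms in auto)

lemma move_back_to:
  assumes "s(i := c, j := d) \<in> C" "two A B i j \<in> C" "i < n" "j < n" "i \<noteq> j"
    "c = pm (s i) A" "d = pm (s j) B" "ac (s i) A \<noteq> ac (s j) B"
  shows "s \<in> C"
  by (rule move_back[OF assms(1)[unfolded assms(6,7)] assms(2-5,8)])

lemma two_swap: "i \<noteq> j \<Longrightarrow> two A B i j \<in> C \<Longrightarrow> two B A j i \<in> C"
  by (rule cong[of "two A B i j"]) (auto simp: two_def)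

text \<open>Multiplication by a two-site string turns two positions carrying different letters into any
  other pair of letters with the same product.  Hence the product of all letters in the Klein
  four-group is the only invariant of a nonconstant string.\<close>

lemma nonconstant_in_closure:
  assumes pairs: "\<And>A i j. i < n \<Longrightarrow> j < n \<Longrightarrow> i \<noteq> j \<Longrightarrow> A \<noteq> PI \<Longrightarrow> two A A i j \<in> C"
    and "\<And>A. (\<Prod>k<n. sg (s k) A) = 1"
    and "\<And>A. \<exists>k<n. s k \<noteq> A"
  shows "s \<in> C"
  using assms(2,3)
proof (induction "weight n s" arbitrary: s rule: less_induct)
  case less
  show ?case
  proof (cases "\<exists>i j. i < n \<and> j < n \<and> i \<noteq> j \<and> s i \<noteq> PI \<and> s j \<noteq> PI \<and> s i \<noteq> s j")
    case True
    then obtain i j where ij: "i < n" "j < n" "i \<noteq> j" "s i \<noteq> PI" "s j \<noteq> PI" "s i \<noteq> s j"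
      by blast
    \<comment> \<open>Site \<open>i\<close> is erased, while site \<open>j\<close> keeps a
      nontrivial letter because the two letters differ; the new string is therefore again
      nonconstant.\<close>
    let ?t = "s(i := pm (s i) (s i), j := pm (s j) (s i))"
    have "weight n ?t < weight n s"
      using ij by (intro weight_update_less[of i]) (auto split: if_splits)
    moreover have "(\<Prod>k<n. sg (?t k) A) = 1" for A
      using ij less.prems(1)[of A]
      by (subst prod_update_two[where h = "\<lambda>x. sg x A"]) (auto simp: sg_pm)
    moreover have "\<exists>k<n. ?t k \<noteq> A" for A
      using ij by (metis fun_upd_apply pm_self pm_eq_PI_iff)
    ultimately have "?t \<in> C" by (rule less.hyps)
    then show ?thesis
      by (rule move_back) (use ij pairs in \<open>auto simp: ac_def\<close>)
  next
    case False
    obtain i where i: "i < n" "s i \<noteq> PI" using less.prems(2) by blast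
    define P where "P = s i"
    have P: "s k \<in> {PI, P}" if "k < n" for k using False i that by (auto simp: P_def)
    obtain l where l: "l < n" "s l \<noteq> P" using less.prems(2) by blast
    then have sl: "s l = PI" using P by auto
    have sP: "s i = P" "P \<noteq> PI" using i by (auto simp: P_def)
    obtain Q where Q: "Q \<noteq> PI" "Q \<noteq> P"
      by (cases "P = PX") (auto intro: that[of PX] that[of PY])
    \<comment> \<open>A lone P would have sign -1 against a letter \<open>Q\<close> anticommuting
      with P, contradicting the invariant.\<close>
    have "\<exists>j<n. j \<noteq> i \<and> s j = P"
    proof (rule ccontr)
      assume "\<not> ?thesis"
      then have "s k = PI" if "k < n" "k \<noteq> i" for k using P that by auto
      then have "(\<Prod>k\<in>{..<n} - {i}. sg (s k) Q) = 1"
        by (intro prod.neutral) (auto simp: sg_def ac_def)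
      then have "(\<Prod>k<n. sg (s k) Q) = sg P Q"
        using i sP by (subst prod.remove[of _ i]) auto
      then show False using less.prems(1)[of Q] Q sP by (simp add: sg_def ac_def)
    qed
    then obtain j where j: "j < n" "j \<noteq> i" "s j = P" by blast
    show ?thesis
    proof (cases "\<exists>k<n. k \<noteq> i \<and> k \<noteq> j \<and> s k = P")
      case False
      have "two P P i j \<in> C" using pairs i j sP by auto
      moreover have "two P P i j m = s m" if "m < n" for m
        using P[OF that] False j sP that by (auto simp: two_def)
      ultimately show ?thesis by (rule cong)
    next
      case True
      then obtain k where k: "k < n" "k \<noteq> i" "k \<noteq> j" "s k = P" by blast
      have dist: "l \<noteq> i" "l \<noteq> j" "l \<noteq> k" using sl j k sP by auto
      define R where "R = pm P Q"
      have R: "R \<noteq> PI" "R \<noteq> P" "R \<noteq> Q" "pm P R = Q" "pm R P = Q" "pm Q P = R" "pm P Q = R"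
        unfolding R_def using Q sP(2) by (cases P; cases Q; auto)+
      \<comment> \<open>A pair PP commutes with PP and with P I, so no single move erases a P. The
        detour multiplies by QQ on \<open>k\<close>, \<open>l\<close>, by PP on \<open>j\<close>,
        \<open>k\<close> and by PP on \<open>i\<close>, \<open>l\<close>: the letters P, P, P, I on
        \<open>i\<close>, \<open>j\<close>, \<open>k\<close>, \<open>l\<close> become I, I, Q,
        R.\<close>
      let ?s1 = "s(k := R, l := Q)"
      let ?s2 = "?s1(j := PI, k := Q)"
      let ?s3 = "?s2(i := PI, l := R)"
      have w: "weight n ?s3 < weight n s"
      proof -
        \<comment> \<open>The comparison string shifts one P from \<open>i\<close> to
          \<open>l\<close>, hence has the weight of \<open>s\<close>; the support of
          \<open>?s3\<close> is its support without \<open>j\<close>.\<close>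
        have "weight n ?s3 < weight n (s(i := PI, l := P))"
          using i j k l dist sP by (intro weight_update_less[of j]) (auto split: if_splits)
        also have "weight n (s(i := PI, l := P)) = weight n s"
          unfolding weight_def
          by (intro bij_betw_same_card[of "id(l := i)"] bij_betw_byWitness[where f' = "id(i := l)"])
            (use i l sl sP dist in \<open>auto split: if_splits\<close>)
        finally show ?thesis .
      qed
      have inv: "(\<Prod>m<n. sg (?s3 m) A) = 1" for A
      proof -
        have "(\<Prod>m<n. sg (?s3 m) A) = (\<Prod>m<n. sg (?s2 m) A)"
          by (rule prod_update_two[where h = "\<lambda>x. sg x A"])
             (use i l dist sP j k in \<open>auto simp: R_def sg_pm\<close>)
        also have "\<dots> = (\<Prod>m<n. sg (?s1 m) A)"
          by (rule prod_update_two[where h = "\<lambda>x. sg x A"])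
             (use i l dist sP j k in \<open>auto simp: R_def sg_pm\<close>)
        also have "\<dots> = (\<Prod>m<n. sg (s m) A)"
          by (rule prod_update_two[where h = "\<lambda>x. sg x A"])
            (use k l dist sl in \<open>auto simp: R_def sg_pm mult.assoc\<close>)
        finally show ?thesis using less.prems(1) by simp
      qed
      have "?s3 i = PI" "?s3 k = Q" using dist j k by auto
      then have "\<exists>m<n. ?s3 m \<noteq> A" for A using i(1) k(1) Q(1) by metis
      with w inv have s3: "?s3 \<in> C" by (rule less.hyps)
      have letters: "?s2 i = P" "?s2 l = Q" "?s1 j = P" "?s1 k = R"
        using i j k l dist sP by auto
      have "?s2 \<in> C"
        by (rule move_back_to[OF s3, where A = P and B = P], unfold letters)
          (use i l dist pairs R Q sP in \<open>auto simp: ac_def\<close>)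
      then have "?s1 \<in> C"
        by (rule move_back_to[where A = P and B = P], unfold letters)
          (use j k pairs R Q sP in \<open>auto simp: ac_def\<close>)
      then show ?thesis
        by (rule move_back_to[where A = Q and B = Q], unfold k sl)
          (use k l dist pairs R Q sP in \<open>auto simp: ac_def\<close>)
    qed
  qed
qed

text \<open>Multiplication by X at \<open>a\<close> and Y at \<open>b\<close> contracts the patterns
  ZY, XX, YY to YI, IZ, ZI. Each contraction shortens the string and keeps the parities of the
  numbers of X's and Y's. With both parities odd, a string without such a pattern consists of one X
  and one Y.\<close>

lemma odd_XY_in_closure:
  assumes pairs: "\<And>i j. i < n \<Longrightarrow> j < n \<Longrightarrow> i \<noteq> j \<Longrightarrow> two PX PY i j \<in> C"
    and "(\<Prod>k<n. if s k = PX then -1 else (1::complex)) = -1"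
    and "(\<Prod>k<n. if s k = PY then -1 else (1::complex)) = -1"
  shows "s \<in> C"
  using assms(2,3)
proof (induction "weight n s" arbitrary: s rule: less_induct)
  case less
  have ex: "\<exists>k<n. s k = A" if "(\<Prod>k<n. if s k = A then -1 else (1::complex)) = -1" for A
  proof (rule ccontr)
    assume "\<not> ?thesis"
    then have "(\<Prod>k<n. if s k = A then -1 else (1::complex)) = 1"
      by (intro prod.neutral) auto
    with that show False by simp
  qed
  obtain i j where ij: "i < n" "s i = PX" "j < n" "s j = PY"
    using ex less.prems by blast
  have reduce: "s \<in> C" if "a < n" "b < n" "a \<noteq> b" and sab: "(s a, s b) \<in> {(PZ, PY), (PX, PX), (PY, PY)}" for a b
  proof (rule move_back[of s a PX b PY])
    let ?t = "s(a := pm (s a) PX, b := pm (s b) PY)"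
    show "?t \<in> C"
    proof (rule less.hyps)
      show "weight n ?t < weight n s"
        by (rule weight_update_less[of "if s a = PX then a else b"]) (use that in \<open>auto split: if_splits\<close>)
      show "(\<Prod>k<n. if ?t k = PX then -1 else (1::complex)) = -1"
        by (subst prod_update_two[where h = "\<lambda>x. if x = PX then -1 else 1"]) (use that less.prems in auto)
      show "(\<Prod>k<n. if ?t k = PY then -1 else (1::complex)) = -1"
        by (subst prod_update_two[where h = "\<lambda>x. if x = PY then -1 else 1"]) (use that less.prems in auto)
    qed
  qed (use that pairs in \<open>auto simp: ac_def\<close>)
  show ?case
  proof (cases "\<exists>k<n. (k \<noteq> i \<and> s k = PX) \<or> (k \<noteq> j \<and> s k = PY) \<or> s k = PZ")
    case True
    then obtain k where k: "k < n" "(k \<noteq> i \<and> s k = PX) \<or> (k \<noteq> j \<and> s k = PY) \<or> s k = PZ" by blast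
    then show ?thesis
      using reduce[of k i] reduce[of k j] ij by (cases "k = j") auto
  next
    case False
    have eq: "two PX PY i j k = s k" if "k < n" for k
      using False ij that by (cases "s k") (auto simp: two_def)
    have "i \<noteq> j" using ij by auto
    then have "two PX PY i j \<in> C" using pairs ij by auto
    then show ?thesis by (rule cong[OF _ eq])
  qed
qed

text \<open>The sign condition says that X and Y together occur an even number of times. Surplus X's
  and Y's are contracted in pairs, and Z's are absorbed into an X or Y by ZZ. Both moves need an X
  or Y to act on, so the induction carries its existence along.\<close>

lemma even_XY_nonempty_in_closure:
  assumes pairs: "\<And>A B i j. i < n \<Longrightarrow> j < n \<Longrightarrow> i \<noteq> j \<Longrightarrow> A \<in> {PX, PY} \<Longrightarrow> B \<in> {PX, PY} \<Longrightarrow> two A B i j \<in> C"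
    and zz: "\<And>i j. i < n \<Longrightarrow> j < n \<Longrightarrow> i \<noteq> j \<Longrightarrow> two PZ PZ i j \<in> C"
    and "(\<Prod>k<n. sg (s k) PZ) = 1"
    and "\<exists>k<n. s k \<in> {PX, PY}"
  shows "s \<in> C"
  using assms(3,4)
proof (induction "weight n s" arbitrary: s rule: less_induct)
  case less
  obtain i where i: "i < n" "s i \<in> {PX, PY}" using less.prems(2) by blast
  have "\<exists>j<n. j \<noteq> i \<and> s j \<in> {PX, PY}"
  proof (rule ccontr)
    assume *: "\<not> ?thesis"
    have "\<forall>k\<in>{..<n} - {i}. sg (s k) PZ = 1"
    proof
      fix k
      assume "k \<in> {..<n} - {i}"
      then have "k < n" "k \<noteq> i" by auto
      with * have "s k \<notin> {PX, PY}" by blast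
      then show "sg (s k) PZ = 1" by (cases "s k") (simp_all add: sg_def ac_def)
    qed
    then have "(\<Prod>k\<in>{..<n} - {i}. sg (s k) PZ) = 1"
      by (rule prod.neutral)
    then have "(\<Prod>k<n. sg (s k) PZ) = sg (s i) PZ"
      using i by (subst prod.remove[of _ i]) auto
    then show False using less.prems(1) i by (auto simp: sg_def ac_def)
  qed
  then obtain j where j: "j < n" "j \<noteq> i" "s j \<in> {PX, PY}" by blast
  consider (flip) "\<exists>l<n. l \<noteq> i \<and> l \<noteq> j \<and> s l \<in> {PX, PY}"
    | (phase) "\<exists>l<n. s l = PZ"
    | (none) "\<not> (\<exists>l<n. l \<noteq> i \<and> l \<noteq> j \<and> s l \<in> {PX, PY})" "\<not> (\<exists>l<n. s l = PZ)"
    by argo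
  then show ?case
  proof cases
    case flip
    then obtain l where 1: "l < n" "l \<noteq> i" "l \<noteq> j" "s l \<in> {PX, PY}" by blast
    \<comment> \<open>With the other letter of X, Y, only site \<open>j\<close> anticommutes: site
      \<open>i\<close> is erased and site \<open>j\<close> becomes Z. The third site
      \<open>l\<close> keeps its X or Y for the induction.\<close>
    define B where "B = (if s j = PX then PY else PX)"
    let ?t = "s(i := pm (s i) (s i), j := pm (s j) B)"
    show ?thesis
    proof (rule move_back[of s i "s i" j B])
      show "?t \<in> C"
      proof (rule less.hyps)
        show "weight n ?t < weight n s"
          by (rule weight_update_less[of i]) (use i j in \<open>auto split: if_splits\<close>)
        show "(\<Prod>k<n. sg (?t k) PZ) = 1"
          by (subst prod_update_two[where h = "\<lambda>x. sg x PZ"])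
            (use i j less.prems in \<open>auto simp: sg_def ac_def B_def\<close>)
        show "\<exists>k<n. ?t k \<in> {PX, PY}" using 1 by (intro exI[of _ l]) auto
      qed
    qed (use i j in \<open>auto simp: ac_def B_def intro!: pairs\<close>)
  next
    case phase
    then obtain l where 2: "l < n" "s l = PZ" by blast
    have li: "l \<noteq> i" "l \<noteq> j" using 2 i j by auto
    let ?t = "s(i := pm (s i) PZ, l := pm (s l) PZ)"
    show ?thesis
    proof (rule move_back[of s i PZ l PZ])
      show "?t \<in> C"
      proof (rule less.hyps)
        show "weight n ?t < weight n s"
          by (rule weight_update_less[of l]) (use i 2 in \<open>auto split: if_splits\<close>)
        show "(\<Prod>k<n. sg (?t k) PZ) = 1"
          by (subst prod_update_two[where h = "\<lambda>x. sg x PZ"])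
            (use i 2 li less.prems in \<open>auto simp: sg_def ac_def\<close>)
        show "\<exists>k<n. ?t k \<in> {PX, PY}" using j li by (intro exI[of _ j]) auto
      qed
    qed (use i 2 li in \<open>auto simp: ac_def intro!: zz\<close>)
  next
    case none
    have "two (s i) (s j) i j \<in> C" using i j by (intro pairs) auto
    moreover have "two (s i) (s j) i j k = s k" if "k < n" for k
      using none that by (cases "s k") (auto simp: two_def)
    ultimately show ?thesis by (rule cong)
  qed
qed

text \<open>A string of I's and Z's that contains both letters is one XX move away from a string
  with X or Y: placed on a Z and an I, the pair XX anticommutes at exactly one site.\<close>

lemma even_XY_in_closure:
  assumes pairs: "\<And>A B i j. i < n \<Longrightarrow> j < n \<Longrightarrow> i \<noteq> j \<Longrightarrow> A \<in> {PX, PY} \<Longrightarrow> B \<in> {PX, PY} \<Longrightarrow> two A B i j \<in> C"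
    and zz: "\<And>i j. i < n \<Longrightarrow> j < n \<Longrightarrow> i \<noteq> j \<Longrightarrow> two PZ PZ i j \<in> C"
    and even: "(\<Prod>k<n. sg (s k) PZ) = 1"
    and nonconst: "\<exists>k<n. s k \<noteq> PI" "\<exists>k<n. s k \<noteq> PZ"
  shows "s \<in> C"
proof (cases "\<exists>k<n. s k \<in> {PX, PY}")
  case True
  then show ?thesis using even_XY_nonempty_in_closure pairs zz even by blast
next
  case False
  then have IZ: "s k \<in> {PI, PZ}" if "k < n" for k
    using that by (cases "s k") auto
  obtain i j where ij: "i < n" "s i = PZ" "j < n" "s j = PI"
    using nonconst IZ by (metis empty_iff insert_iff)
  let ?t = "s(i := pm (s i) PX, j := pm (s j) PX)"
  show ?thesis
  proof (rule move_back[of s i PX j PX])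
    show "?t \<in> C"
    proof (rule even_XY_nonempty_in_closure[OF pairs zz])
      show "(\<Prod>k<n. sg (?t k) PZ) = 1"
        by (subst prod_update_two[where h = "\<lambda>x. sg x PZ"])
          (use ij even in \<open>auto simp: sg_def ac_def\<close>)
      show "\<exists>k<n. ?t k \<in> {PX, PY}" using ij by (intro exI[of _ j]) auto
    qed auto
  qed (use ij in \<open>auto simp: ac_def intro!: pairs\<close>)
qed

end

section \<open>Lie algebras generated by strings\<close>

definition strs_of :: "nat \<Rightarrow> complex mat set \<Rightarrow> (nat \<Rightarrow> pauli) set" where
  "strs_of n L = {s. \<i> \<cdot>\<^sub>m pstr n s \<in> L}"

lemma ps2_two: "ps2 n A B i j = pstr n (two A B i j)"
  by (simp add: ps2_def two_def)

lemma comm_pstr: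
  "comm (\<i> \<cdot>\<^sub>m pstr n s) (\<i> \<cdot>\<^sub>m pstr n t) =
     (phs n t s - phs n s t) \<cdot>\<^sub>m pstr n (\<lambda>j. pm (s j) (t j))"
proof -
  have "(\<i> \<cdot>\<^sub>m pstr n s) * (\<i> \<cdot>\<^sub>m pstr n t) = (- phs n s t) \<cdot>\<^sub>m pstr n (\<lambda>j. pm (s j) (t j))" for s t
  proof -
    have "(\<i> \<cdot>\<^sub>m pstr n s) * (\<i> \<cdot>\<^sub>m pstr n t) = \<i> \<cdot>\<^sub>m (\<i> \<cdot>\<^sub>m (pstr n s * pstr n t))"
      by (simp add: mult_smult_assoc_mat[OF pstr_carrier smult_carrier_mat[OF pstr_carrier]]
          mult_smult_distrib[OF pstr_carrier pstr_carrier])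
    also have "\<dots> = (- phs n s t) \<cdot>\<^sub>m pstr n (\<lambda>j. pm (s j) (t j))"
      unfolding pstr_mult by (intro eq_matI) simp_all
    finally show ?thesis .
  qed
  moreover have "(\<lambda>j. pm (t j) (s j)) = (\<lambda>j. pm (s j) (t j))"
    by (intro ext pm_commute)
  ultimately show ?thesis
    unfolding comm_def by (intro eq_matI) (simp_all add: algebra_simps)
qed

lemma pauli_closed_lie_closure: "pauli_closed n (strs_of n (lie_closure (2 ^ n) S))"
proof
  fix s t
  assume "s \<in> strs_of n (lie_closure (2 ^ n) S)" "\<And>j. j < n \<Longrightarrow> s j = t j"
  then show "t \<in> strs_of n (lie_closure (2 ^ n) S)"
    using pstr_cong[of n s t] by (simp add: strs_of_def)
next
  fix s t
  let ?st = "pstr n (\<lambda>j. pm (s j) (t j))"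
  assume st: "s \<in> strs_of n (lie_closure (2 ^ n) S)" "t \<in> strs_of n (lie_closure (2 ^ n) S)"
    and anti: "acomm n s t"
  obtain e where e: "e \<noteq> 0" "phs n s t = \<i> * of_real e" by (rule phs_anticommuting[OF anti])
  have "phs n t s = - phs n s t" using phs_swap[of n s t] anti by simp
  \<comment> \<open>For anticommuting strings the bracket is -2 times the phase \<i>e times the
    product string, so the real factor -1/(2e) leaves exactly \<i> times that string.\<close>
  then have scaled: "complex_of_real (- 1 / (2 * e)) \<cdot>\<^sub>m comm (\<i> \<cdot>\<^sub>m pstr n s) (\<i> \<cdot>\<^sub>m pstr n t) = \<i> \<cdot>\<^sub>m ?st"
    unfolding comm_pstr using e by (intro eq_matI) simp_all
  have "complex_of_real (- 1 / (2 * e)) \<cdot>\<^sub>m comm (\<i> \<cdot>\<^sub>m pstr n s) (\<i> \<cdot>\<^sub>m pstr n t) \<in> lie_closure (2 ^ n) S"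
    by (intro lie_closure.smult lie_closure.bracket) (use st in \<open>simp_all add: strs_of_def\<close>)
  then show "(\<lambda>j. pm (s j) (t j)) \<in> strs_of n (lie_closure (2 ^ n) S)"
    unfolding scaled by (simp add: strs_of_def)
qed

lemma pauli_closed_perm: "pauli_closed n (strs_of n (perm_alg G n))"
  unfolding perm_alg_def Lie_def by (rule pauli_closed_lie_closure)

lemma pauli_closed_chain: "pauli_closed n (strs_of n (chain_alg G n))"
  unfolding chain_alg_def Lie_def by (rule pauli_closed_lie_closure)

lemma perm_gen:
  "(A, B) \<in> G \<Longrightarrow> i < n \<Longrightarrow> j < n \<Longrightarrow> i \<noteq> j \<Longrightarrow> two A B i j \<in> strs_of n (perm_alg G n)"
  unfolding perm_alg_def Lie_def strs_of_def
  by (auto intro!: lie_closure.gen imageI simp flip: ps2_two)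

lemma chain_gen:
  "(A, B) \<in> G \<Longrightarrow> Suc j < n \<Longrightarrow> two A B j (Suc j) \<in> strs_of n (chain_alg G n)"
  unfolding chain_alg_def Lie_def strs_of_def
  by (auto intro!: lie_closure.gen imageI simp flip: ps2_two)

lemma lie_closure_subset:
  assumes "S \<subseteq> lie_closure N T"
  shows "lie_closure N S \<subseteq> lie_closure N T"
proof
  fix x
  assume "x \<in> lie_closure N S"
  then show "x \<in> lie_closure N T"
    by induction (use assms in \<open>auto intro: lie_closure.intros\<close>)
qed

lemma perm_alg_subset:
  assumes "\<And>A B i j. (A, B) \<in> G \<Longrightarrow> i < n \<Longrightarrow> j < n \<Longrightarrow> i \<noteq> j \<Longrightarrow> two A B i j \<in> strs_of n L"
    and "L = lie_closure (2 ^ n) S"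
  shows "perm_alg G n \<subseteq> L"
  unfolding perm_alg_def Lie_def assms(2)
  by (rule lie_closure_subset) (use assms in \<open>auto simp: ps2_two strs_of_def\<close>)

lemmas perm_alg_subset_chain = perm_alg_subset[OF _ chain_alg_def[unfolded Lie_def]]

lemmas perm_alg_subset_perm = perm_alg_subset[OF _ perm_alg_def[unfolded Lie_def]]

lemma chain_subset_perm: "chain_alg G n \<subseteq> perm_alg G n"
  unfolding chain_alg_def perm_alg_def Lie_def
  by (rule lie_closure_subset) (fastforce intro!: lie_closure.gen)

lemma perm_eq_chain:
  assumes "\<And>A B i j. (A, B) \<in> G \<Longrightarrow> i < n \<Longrightarrow> j < n \<Longrightarrow> i \<noteq> j \<Longrightarrow> two A B i j \<in> strs_of n (chain_alg G n)"
  shows "perm_alg G n = chain_alg G n"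
  using perm_alg_subset_chain[OF assms] chain_subset_perm by blast

section \<open>Transporting pairs between sites\<close>

definition three :: "pauli \<Rightarrow> pauli \<Rightarrow> pauli \<Rightarrow> nat \<Rightarrow> nat \<Rightarrow> nat \<Rightarrow> nat \<Rightarrow> pauli" where
  "three A B D i j k = (\<lambda>m. if m = i then A else if m = j then B else if m = k then D else PI)"

lemma three_swap:
  "i \<noteq> j \<Longrightarrow> j \<noteq> k \<Longrightarrow> i \<noteq> k \<Longrightarrow> three A B D i j k = three A D B i k j"
  "i \<noteq> j \<Longrightarrow> j \<noteq> k \<Longrightarrow> i \<noteq> k \<Longrightarrow> three A B D i j k = three D B A k j i"
  by (auto simp: three_def)

lemma third_site:
  assumes "n \<ge> 3"
  obtains k :: nat where "k < n" "k \<noteq> i" "k \<noteq> j"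
proof -
  have "\<exists>k\<in>{0, 1, 2::nat}. k \<noteq> i \<and> k \<noteq> j" by auto
  then obtain k where "k \<in> {0, 1, 2::nat}" "k \<noteq> i" "k \<noteq> j" by blast
  then show thesis using that[of k] assms by auto
qed

context pauli_closed
begin

text \<open>The two strings overlap only at \<open>k\<close>, so anticommutation there decides.
  Followed by \<open>absorb\<close>, which removes the letter at \<open>k\<close> by anticommuting
  only at \<open>i\<close>, this carries pairs on (i, k) and (k, j) to a pair on (i, j).\<close>

lemma join:
  assumes "two A B i k \<in> C" "two B' D k j \<in> C" "ac B B'"
    "i < n" "k < n" "j < n" "i \<noteq> k" "k \<noteq> j" "i \<noteq> j"
  shows "three A (pm B B') D i k j \<in> C"
  by (rule move[OF assms(1,2)]) (use assms in \<open>auto simp: two_def three_def ac_def\<close>)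

lemma absorb:
  assumes "three A E D i k j \<in> C" "two A' E i k \<in> C" "ac A A'"
    "i < n" "k < n" "j < n" "i \<noteq> k" "k \<noteq> j" "i \<noteq> j"
  shows "two (pm A A') D i j \<in> C"
  by (rule move[OF assms(1,2)]) (use assms in \<open>auto simp: two_def three_def ac_def\<close>)

lemma single_cong: "two A PI i j \<in> C \<Longrightarrow> i \<noteq> j \<Longrightarrow> i \<noteq> k \<Longrightarrow> two A PI i k \<in> C"
  by (rule cong[of "two A PI i j"]) (auto simp: two_def)

lemma cancel_right:
  assumes "two A B i j \<in> C" "two A' B i j \<in> C" "ac A A'" "i < n" "j < n" "i \<noteq> j"
  shows "two (pm A A') PI i j \<in> C"
  by (rule move[OF assms(1,2)]) (use assms in \<open>auto simp: two_def ac_def\<close>)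

lemma rotate:
  assumes "two A B i j \<in> C" "\<And>D. D \<noteq> PI \<Longrightarrow> two D PI i j \<in> C" "A \<noteq> PI" "A' \<noteq> PI" "i < n" "j < n" "i \<noteq> j"
  shows "two A' B i j \<in> C"
proof (cases "A' = A")
  case False
  have *: "ac A (pm A A')" "pm A (pm A A') = A'" "pm A A' \<noteq> PI"
    using False assms(3,4) by (cases A; cases A'; auto simp: ac_def)+
  show ?thesis
    by (rule move[OF assms(1) assms(2)[OF *(3)]]) (use assms * in \<open>auto simp: two_def ac_def\<close>)
qed (use assms in auto)

text \<open>A relation on sites that holds for neighbours, is symmetric and composes through
  intermediate sites holds for all pairs. The side conditions keep the three sites distinct, as the
  products require.\<close>

lemma connect:
  assumes adjacent: "\<And>j. Suc j < n \<Longrightarrow> P j (Suc j)"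
    and sym: "\<And>i j. i < n \<Longrightarrow> j < n \<Longrightarrow> i \<noteq> j \<Longrightarrow> P i j \<Longrightarrow> P j i"
    and step: "\<And>i k j. i < n \<Longrightarrow> k < n \<Longrightarrow> j < n \<Longrightarrow> i \<noteq> k \<Longrightarrow> k \<noteq> j \<Longrightarrow> i \<noteq> j \<Longrightarrow> P i k \<Longrightarrow> P k j \<Longrightarrow> P i j"
    and "i < n" "j < n" "i \<noteq> j"
  shows "P i j"
proof -
  have *: "P i (Suc (i + d))" if "Suc (i + d) < n" for i d
    using that
  proof (induction d)
    case 0
    then show ?case using adjacent by simp
  next
    case (Suc d)
    then have "P i (Suc (i + d))" "P (Suc (i + d)) (Suc (i + Suc d))"
      using adjacent[of "Suc (i + d)"] by auto
    then show ?case by (rule step[rotated 6]) (use Suc.prems in auto)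
  qed
  show ?thesis
  proof (cases "i < j")
    case True
    then show ?thesis using *[of i "j - Suc i"] assms(4-6) by simp
  next
    case False
    then have "P j i" using *[of j "i - Suc j"] assms(4-6) by simp
    then show ?thesis by (rule sym[rotated 3]) (use assms(4-6) in auto)
  qed
qed

text \<open>With B = DA, the product of DD on (i, k) and AA on (k, j) is D, B, A on i, k, j; BB on
  (i, k) then clears site k and turns D into A.\<close>

lemma equal_pair_step:
  assumes "\<And>A. A \<noteq> PI \<Longrightarrow> two A A i k \<in> C" "\<And>A. A \<noteq> PI \<Longrightarrow> two A A k j \<in> C" "A \<noteq> PI"
    "i < n" "k < n" "j < n" "i \<noteq> k" "k \<noteq> j" "i \<noteq> j"
  shows "two A A i j \<in> C"
proof -
  have "\<exists>B D. B \<noteq> PI \<and> D \<noteq> PI \<and> ac D A \<and> ac D B \<and> pm D A = B \<and> pm D B = A"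
  proof (cases A)
    case PX
    show ?thesis unfolding PX by (rule exI[of _ PY], rule exI[of _ PZ]) (simp add: ac_def)
  next
    case PY
    show ?thesis unfolding PY by (rule exI[of _ PZ], rule exI[of _ PX]) (simp add: ac_def)
  next
    case PZ
    show ?thesis unfolding PZ by (rule exI[of _ PX], rule exI[of _ PY]) (simp add: ac_def)
  qed (use assms(3) in simp)
  then obtain B D where *: "B \<noteq> PI" "D \<noteq> PI" "ac D A" "ac D B" "pm D A = B" "pm D B = A"
    by blast
  have "three D (pm D A) A i k j \<in> C"
    by (rule join) (use assms * in auto)
  then have "two (pm D B) A i j \<in> C"
    by (rule absorb) (use assms * in auto)
  then show ?thesis using * by simp
qed

lemma equal_pairs:
  assumes "\<And>A j. A \<noteq> PI \<Longrightarrow> Suc j < n \<Longrightarrow> two A A j (Suc j) \<in> C"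
    and "A \<noteq> PI" "i < n" "j < n" "i \<noteq> j"
  shows "two A A i j \<in> C"
proof -
  let ?P = "\<lambda>i j. \<forall>A. A \<noteq> PI \<longrightarrow> two A A i j \<in> C"
  have "?P i j"
  proof (rule connect[of ?P, OF _ _ _ assms(3-5)])
    show "?P j (Suc j)" if "Suc j < n" for j
      using assms(1) that by blast
    show "?P j i" if "i \<noteq> j" "?P i j" for i j
      using that two_swap by blast
    show "?P i j" if "i < n" "k < n" "j < n" "i \<noteq> k" "k \<noteq> j" "i \<noteq> j" "?P i k" "?P k j" for i k j
      using equal_pair_step[of i k j] that by blast
  qed
  with assms(2) show ?thesis by blast
qed

text \<open>The two families support each other: ZY on (i, k), ZY on (k, j) and YX on (i, k)
  multiply to XY on (i, j), and interchanging X with Z gives ZY. The remaining two pairs follow by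
  reading the path backwards.\<close>

lemma odd_Y_pairs:
  assumes "\<And>j. Suc j < n \<Longrightarrow> {two PX PY j (Suc j), two PY PX j (Suc j), two PZ PY j (Suc j), two PY PZ j (Suc j)} \<subseteq> C"
    and "i < n" "j < n" "i \<noteq> j"
  shows "{two PX PY i j, two PY PX i j, two PZ PY i j, two PY PZ i j} \<subseteq> C"
proof -
  let ?P = "\<lambda>i j. {two PX PY i j, two PY PX i j, two PZ PY i j, two PY PZ i j} \<subseteq> C"
  have sym: "?P j i" if "i \<noteq> j" "?P i j" for i j
    using that two_swap by auto
  have half: "two PX PY i j \<in> C \<and> two PZ PY i j \<in> C"
    if "i < n" "k < n" "j < n" "i \<noteq> k" "k \<noteq> j" "i \<noteq> j" "?P i k" "?P k j" for i k j
  proof -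
    have "three PZ (pm PY PZ) PY i k j \<in> C" by (rule join) (use that in \<open>auto simp: ac_def\<close>)
    then have 1: "two (pm PZ PY) PY i j \<in> C"
      by (rule absorb) (use that in \<open>auto simp: ac_def\<close>)
    have "three PX (pm PY PX) PY i k j \<in> C" by (rule join) (use that in \<open>auto simp: ac_def\<close>)
    then have 2: "two (pm PX PY) PY i j \<in> C"
      by (rule absorb) (use that in \<open>auto simp: ac_def\<close>)
    show ?thesis using 1 2 by simp
  qed
  have step: "?P i j"
    if "i < n" "k < n" "j < n" "i \<noteq> k" "k \<noteq> j" "i \<noteq> j" "?P i k" "?P k j" for i k j
  proof -
    have "?P k i" "?P j k" using sym that by blast+
    then have "two PX PY j i \<in> C \<and> two PZ PY j i \<in> C"
      using half[of j k i] that by blast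
    then have "two PY PX i j \<in> C" "two PY PZ i j \<in> C"
      using two_swap[of j i PX PY] two_swap[of j i PZ PY] that(6) by auto
    then show ?thesis using half[OF that] by blast
  qed
  show ?thesis
  proof (rule connect[of ?P, OF _ _ _ assms(2-4)])
    show "?P j (Suc j)" if "Suc j < n" for j using assms(1) that by blast
    show "?P j i" if "i \<noteq> j" "?P i j" for i j using sym that by blast
    show "?P i j" if "i < n" "k < n" "j < n" "i \<noteq> k" "k \<noteq> j" "i \<noteq> j" "?P i k" "?P k j" for i k j
      using step that by blast
  qed
qed

text \<open>Write B as a product FG of anticommuting letters. The factors YF and ZG on (k, j) place
  B at j, while the letters X, Y, Z at k multiply to the identity.\<close>

lemma all_pairs_step:
  assumes "two A PX i k \<in> C" "\<And>B D. B \<noteq> PI \<Longrightarrow> D \<noteq> PI \<Longrightarrow> two B D k j \<in> C" "B \<noteq> PI"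
    "i < n" "k < n" "j < n" "i \<noteq> k" "k \<noteq> j" "i \<noteq> j"
  shows "two A B i j \<in> C"
proof -
  have "\<exists>F G. F \<noteq> PI \<and> G \<noteq> PI \<and> ac F G \<and> pm F G = B"
  proof (cases B)
    case PX
    show ?thesis unfolding PX by (rule exI[of _ PY], rule exI[of _ PZ]) (simp add: ac_def)
  next
    case PY
    show ?thesis unfolding PY by (rule exI[of _ PZ], rule exI[of _ PX]) (simp add: ac_def)
  next
    case PZ
    show ?thesis unfolding PZ by (rule exI[of _ PX], rule exI[of _ PY]) (simp add: ac_def)
  qed (use assms(3) in simp)
  then obtain F G where *: "F \<noteq> PI" "G \<noteq> PI" "ac F G" "pm F G = B" by blast
  have "three A (pm PX PY) F i k j \<in> C"
    by (rule join) (use assms * in \<open>auto simp: ac_def\<close>)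
  then have "three F PZ A j k i \<in> C"
    using assms three_swap(2)[of i k j] by simp
  moreover have "two G PZ j k \<in> C"
    using assms * two_swap[of k j PZ G] by simp
  ultimately have "two (pm F G) A j i \<in> C"
    by (rule absorb) (use assms * in auto)
  then show ?thesis using * assms two_swap by simp
qed

text \<open>The right site of a generator sees all of X, Y, Z against X on the left, so dividing two
  generators yields every single letter at every site except the first. Site 0 has no left
  neighbour; it gains its single letters from pairs with site 2, which is where three sites are
  needed.\<close>

lemma all_pairs:
  assumes n: "n \<ge> 3"
    and gens: "\<And>j. Suc j < n \<Longrightarrow> {two PX PX j (Suc j), two PX PY j (Suc j), two PX PZ j (Suc j), two PY PX j (Suc j)} \<subseteq> C"
    and "A \<noteq> PI" "B \<noteq> PI" "i < n" "j < n" "i \<noteq> j"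
  shows "two A B i j \<in> C"
proof -
  have Suc_single: "two D PI (Suc j) k \<in> C" if "D \<noteq> PI" "Suc j < n" "Suc j \<noteq> k" for D j k
  proof -
    have g: "two PX PX (Suc j) j \<in> C" "two PY PX (Suc j) j \<in> C" "two PZ PX (Suc j) j \<in> C"
      using gens[of j] that two_swap[of j "Suc j"] by auto
    have "two (pm PY PZ) PI (Suc j) j \<in> C" "two (pm PX PZ) PI (Suc j) j \<in> C" "two (pm PX PY) PI (Suc j) j \<in> C"
      by (rule cancel_right; use g that in \<open>simp add: ac_def\<close>)+
    then have "two D PI (Suc j) j \<in> C" using that by (cases D) auto
    then show ?thesis by (rule single_cong) (use that in auto)
  qed
  have right: "two A B j (Suc j) \<in> C" if "A \<in> {PX, PY}" "B \<noteq> PI" "Suc j < n" for A B j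
  proof -
    have "two PX A (Suc j) j \<in> C" using that gens[of j] two_swap[of j "Suc j"] by auto
    then have "two B A (Suc j) j \<in> C"
      by (rule rotate) (use that Suc_single in auto)
    then show ?thesis using two_swap by simp
  qed
  have inner: "two A B (Suc j) (Suc (Suc j)) \<in> C" if "A \<noteq> PI" "B \<noteq> PI" "Suc (Suc j) < n" for A B j
  proof -
    have "two PX B (Suc j) (Suc (Suc j)) \<in> C" using that right by auto
    then show ?thesis by (rule rotate) (use that Suc_single in auto)
  qed
  have n': "0 < n" "Suc 0 < n" "2 < n" using n by auto
  have P12: "two A B 1 2 \<in> C" if "A \<noteq> PI" "B \<noteq> PI" for A B
    using inner[of A B 0] that n' by (simp add: numeral_2_eq_2)
  have XY02: "two A PX 0 2 \<in> C" if "A \<in> {PX, PY}" for A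
    by (rule all_pairs_step[where k = 1]) (use P12 right[of A PX 0] that n' in auto)
  \<comment> \<open>XY on sites 0, 1 times ZX on sites 1, 2 is XXX; then YX on sites 0, 1 leaves the
    missing ZX on sites 0, 2.\<close>
  have "three PX (pm PY PZ) PX 0 1 2 \<in> C"
    by (rule join) (use P12 right[of PX PY 0] n' in \<open>auto simp: ac_def\<close>)
  then have "two (pm PX PY) PX 0 2 \<in> C"
    by (rule absorb) (use right[of PY PX 0] n' in \<open>auto simp: ac_def\<close>)
  then have ZX: "two PZ PX 0 2 \<in> C" by simp
  have XX: "two PX PX 0 2 \<in> C" and YX: "two PY PX 0 2 \<in> C" using XY02 by auto
  have "two (pm PZ PY) PI 0 2 \<in> C" "two (pm PZ PX) PI 0 2 \<in> C" "two (pm PX PY) PI 0 2 \<in> C"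
    by (rule cancel_right; use ZX XX YX n' in \<open>simp add: ac_def\<close>)+
  then have zero_single: "two D PI 0 k \<in> C" if "D \<noteq> PI" "k \<noteq> 0" for D k
    using that single_cong[of D 0 2 k] by (cases D) auto
  have adjacent: "two A B j (Suc j) \<in> C" if "A \<noteq> PI" "B \<noteq> PI" "Suc j < n" for A B j
  proof (cases j)
    case 0
    have "two PX B 0 (Suc 0) \<in> C" using right that n' by auto
    then have "two A B 0 (Suc 0) \<in> C" by (rule rotate) (use that zero_single n' in auto)
    then show ?thesis using 0 by simp
  next
    case (Suc i)
    then show ?thesis using inner that by simp
  qed
  let ?P = "\<lambda>i j. \<forall>A B. A \<noteq> PI \<longrightarrow> B \<noteq> PI \<longrightarrow> two A B i j \<in> C"
  have "?P i j"
  proof (rule connect[of ?P, OF _ _ _ assms(5-7)])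
    show "?P j (Suc j)" if "Suc j < n" for j
      using adjacent that by blast
    show "?P j i" if "i \<noteq> j" "?P i j" for i j
      using that two_swap by blast
    show "?P i j" if "i < n" "k < n" "j < n" "i \<noteq> k" "k \<noteq> j" "i \<noteq> j" "?P i k" "?P k j" for i k j
    proof (intro allI impI)
      fix A B
      assume "A \<noteq> PI" "B \<noteq> PI"
      then show "two A B i j \<in> C"
        by (intro all_pairs_step[of A i k j B]) (use that in auto)
    qed
  qed
  with assms(3,4) show ?thesis by blast
qed

text \<open>Dividing ZY by YY, or its reversal YZ by ZZ at the last site, leaves a single X. This X
  turns ZZ into ZY on any pair of sites.\<close>

lemma ZY_pairs:
  assumes n: "n \<ge> 2"
    and pairs: "\<And>A i j. A \<noteq> PI \<Longrightarrow> i < n \<Longrightarrow> j < n \<Longrightarrow> i \<noteq> j \<Longrightarrow> two A A i j \<in> C"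
    and gens: "\<And>j. Suc j < n \<Longrightarrow> two PZ PY j (Suc j) \<in> C"
    and ij: "i < n" "j < n" "i \<noteq> j"
  shows "two PZ PY i j \<in> C"
proof -
  have "\<exists>k. k \<noteq> j \<and> two PX PI j k \<in> C"
  proof (cases "Suc j < n")
    case True
    have "two (pm PZ PY) PI j (Suc j) \<in> C"
      by (rule cancel_right) (use True gens pairs in \<open>auto simp: ac_def\<close>)
    then show ?thesis by (intro exI[of _ "Suc j"]) auto
  next
    case False
    then obtain m where m: "j = Suc m" using n ij by (cases j) auto
    then have "two PY PZ j m \<in> C" using gens[of m] ij two_swap[of m j] by auto
    then have "two (pm PY PZ) PI j m \<in> C"
      by (rule cancel_right) (use m ij pairs in \<open>auto simp: ac_def\<close>)
    then show ?thesis using m by (intro exI[of _ m]) auto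
  qed
  then have single: "two PX PI j i \<in> C" using ij single_cong by metis
  have pair: "two PZ PZ j i \<in> C" using pairs ij by auto
  have "two PY PZ j i \<in> C"
    by (rule move[OF pair single]) (use ij in \<open>auto simp: two_def ac_def\<close>)
  then show ?thesis using two_swap ij by simp
qed

end

section \<open>Equalities between open-chain and permutation-invariant algebras\<close>

theorem perm_a7: "perm_alg a7 n = chain_alg a7 n"
proof (rule perm_eq_chain)
  interpret pauli_closed n "strs_of n (chain_alg a7 n)" by (rule pauli_closed_chain)
  have gens: "two A A j (Suc j) \<in> strs_of n (chain_alg a7 n)" if "A \<noteq> PI" "Suc j < n" for A j
    by (rule chain_gen) (use that in \<open>cases A; simp add: a7_def\<close>)+
  show "two A B i j \<in> strs_of n (chain_alg a7 n)" if "(A, B) \<in> a7" "i < n" "j < n" "i \<noteq> j" for A B i j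
  proof -
    have "B = A \<and> A \<noteq> PI" using that(1) by (auto simp: a7_def)
    then show ?thesis using equal_pairs[OF gens, of A i j] that(2-4) by auto
  qed
qed

theorem perm_a16: "perm_alg a16 n = chain_alg a16 n"
proof (rule perm_eq_chain)
  interpret pauli_closed n "strs_of n (chain_alg a16 n)" by (rule pauli_closed_chain)
  have gens: "{two PX PY j (Suc j), two PY PX j (Suc j), two PZ PY j (Suc j), two PY PZ j (Suc j)} \<subseteq> strs_of n (chain_alg a16 n)"
    if "Suc j < n" for j
    unfolding insert_subset
    by (intro conjI chain_gen that empty_subsetI) (simp_all add: a16_def)
  show "two A B i j \<in> strs_of n (chain_alg a16 n)" if "(A, B) \<in> a16" "i < n" "j < n" "i \<noteq> j" for A B i j
  proof -
    have "(A, B) \<in> {(PX, PY), (PY, PX), (PZ, PY), (PY, PZ)}" using that(1) by (auto simp: a16_def)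
    then show ?thesis using odd_Y_pairs[OF gens, of i j] that(2-4) by auto
  qed
qed

theorem perm_a20:
  assumes "n \<ge> 2"
  shows "perm_alg a20 n = chain_alg a20 n"
proof (rule perm_eq_chain)
  interpret pauli_closed n "strs_of n (chain_alg a20 n)" by (rule pauli_closed_chain)
  have gens: "two A A j (Suc j) \<in> strs_of n (chain_alg a20 n)" if "A \<noteq> PI" "Suc j < n" for A j
    by (rule chain_gen) (use that in \<open>cases A; simp add: a20_def\<close>)+
  have ZY: "two PZ PY j (Suc j) \<in> strs_of n (chain_alg a20 n)" if "Suc j < n" for j
    by (rule chain_gen) (use that in \<open>simp_all add: a20_def\<close>)
  show "two A B i j \<in> strs_of n (chain_alg a20 n)" if "(A, B) \<in> a20" "i < n" "j < n" "i \<noteq> j" for A B i j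
  proof -
    have "(B = A \<and> A \<noteq> PI) \<or> (A = PZ \<and> B = PY)" using that(1) by (auto simp: a20_def)
    then show ?thesis using equal_pairs[OF gens, of A i j] ZY_pairs[OF assms equal_pairs[OF gens] ZY, of i j] that(2-4) by auto
  qed
qed

theorem perm_a22:
  assumes "n \<ge> 3"
  shows "perm_alg a22 n = chain_alg a22 n"
proof (rule perm_eq_chain)
  interpret pauli_closed n "strs_of n (chain_alg a22 n)" by (rule pauli_closed_chain)
  have gens: "{two PX PX j (Suc j), two PX PY j (Suc j), two PX PZ j (Suc j), two PY PX j (Suc j)} \<subseteq> strs_of n (chain_alg a22 n)"
    if "Suc j < n" for j
    unfolding insert_subset
    by (intro conjI chain_gen that empty_subsetI) (simp_all add: a22_def)
  show "two A B i j \<in> strs_of n (chain_alg a22 n)" if "(A, B) \<in> a22" "i < n" "j < n" "i \<noteq> j" for A B i j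
  proof -
    have "A \<noteq> PI" "B \<noteq> PI" using that(1) by (auto simp: a22_def)
    then show ?thesis using all_pairs[OF assms gens, of A B i j] that(2-4) by auto
  qed
qed

text \<open>Only ZZ is missing: XX on (i, j), YY on (j, k) and YY on (i, k) multiply to ZZ on (i,
  j), the letters at k cancelling.\<close>

lemma a4_pairs:
  assumes "n \<ge> 3" "A \<noteq> PI" "i < n" "j < n" "i \<noteq> j"
  shows "two A A i j \<in> strs_of n (perm_alg a4 n)"
proof -
  interpret pauli_closed n "strs_of n (perm_alg a4 n)" by (rule pauli_closed_perm)
  have XY: "two B B i j \<in> strs_of n (perm_alg a4 n)" if "B \<in> {PX, PY}" "i < n" "j < n" "i \<noteq> j" for B i j
    by (rule perm_gen) (use that in \<open>auto simp: a4_def\<close>)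
  obtain k where k: "k < n" "k \<noteq> i" "k \<noteq> j" using third_site assms by blast
  have "three PX (pm PX PY) PY i j k \<in> strs_of n (perm_alg a4 n)"
    by (rule join) (use XY assms k in \<open>auto simp: ac_def\<close>)
  then have "three PX PY PZ i k j \<in> strs_of n (perm_alg a4 n)"
    using three_swap(1)[of i j k] assms k by simp
  then have "two (pm PX PY) PZ i j \<in> strs_of n (perm_alg a4 n)"
    by (rule absorb) (use XY assms k in \<open>auto simp: ac_def\<close>)
  then show ?thesis using XY assms by (cases A) auto
qed

theorem perm_a4:
  assumes "n \<ge> 3"
  shows "perm_alg a4 n = chain_alg a7 n"
proof -
  have "perm_alg a4 n \<subseteq> perm_alg a7 n"
  proof (rule perm_alg_subset_perm)
    have "a4 \<subseteq> a7" by (simp add: a4_def a7_def)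
    then show "two A B i j \<in> strs_of n (perm_alg a7 n)" if "(A, B) \<in> a4" "i < n" "j < n" "i \<noteq> j" for A B i j
      using that by (intro perm_gen) blast+
  qed
  moreover have "perm_alg a7 n \<subseteq> perm_alg a4 n"
  proof (rule perm_alg_subset_perm)
    fix A B i j
    assume *: "(A, B) \<in> a7" "i < n" "j < n" "i \<noteq> j"
    have "B = A \<and> A \<noteq> PI" using *(1) by (auto simp: a7_def)
    then show "two A B i j \<in> strs_of n (perm_alg a4 n)"
      using a4_pairs[OF assms, of A i j] *(2-4) by simp
  qed
  ultimately show ?thesis using perm_a7 by blast
qed

theorem perm_a6:
  assumes "n \<ge> 3"
  shows "perm_alg a6 n = chain_alg a20 n"
proof -
  interpret pauli_closed n "strs_of n (perm_alg a6 n)" by (rule pauli_closed_perm)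
  have gens: "two A B i j \<in> strs_of n (perm_alg a6 n)" if "(A, B) \<in> a6" "i < n" "j < n" "i \<noteq> j" for A B i j
    using that by (rule perm_gen)
  have g: "(PX, PX) \<in> a6" "(PY, PZ) \<in> a6" "(PZ, PY) \<in> a6" by (auto simp: a6_def)
  have new: "two PY PY i j \<in> strs_of n (perm_alg a6 n)" "two PZ PZ i j \<in> strs_of n (perm_alg a6 n)"
    if ij: "i < n" "j < n" "i \<noteq> j" for i j
  proof -
    obtain k where k: "k < n" "k \<noteq> i" "k \<noteq> j" using third_site assms by blast
    \<comment> \<open>ZY on (i, k) and (k, j) give Z, X, Y on i, k, j, and XX on (i, k) reduces this
      to YY; the mirror image with Y and Z interchanged gives ZZ.\<close>
    have "three PZ (pm PY PZ) PY i k j \<in> strs_of n (perm_alg a6 n)"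
      by (rule join) (use gens g ij k in \<open>auto simp: ac_def\<close>)
    then have 1: "two (pm PZ PX) PY i j \<in> strs_of n (perm_alg a6 n)"
      by (rule absorb) (use gens g ij k in \<open>auto simp: ac_def\<close>)
    have "three PY (pm PZ PY) PZ i k j \<in> strs_of n (perm_alg a6 n)"
      by (rule join) (use gens g ij k in \<open>auto simp: ac_def\<close>)
    then have 2: "two (pm PY PX) PZ i j \<in> strs_of n (perm_alg a6 n)"
      by (rule absorb) (use gens g ij k in \<open>auto simp: ac_def\<close>)
    show "two PY PY i j \<in> strs_of n (perm_alg a6 n)" "two PZ PZ i j \<in> strs_of n (perm_alg a6 n)"
      using 1 2 by auto
  qed
  have "perm_alg a6 n \<subseteq> perm_alg a20 n"
  proof (rule perm_alg_subset_perm)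
    interpret a20: pauli_closed n "strs_of n (perm_alg a20 n)" by (rule pauli_closed_perm)
    have "two A B i j \<in> strs_of n (perm_alg a20 n)" if "(A, B) \<in> a20" "i < n" "j < n" "i \<noteq> j" for A B i j
      using that by (rule perm_gen)
    note gens20 = this
    fix A B i j
    assume *: "(A, B) \<in> a6" "i < n" "j < n" "i \<noteq> j"
    have "(A, B) \<in> a20 \<or> (B, A) \<in> a20" using *(1) by (auto simp: a6_def a20_def)
    then show "two A B i j \<in> strs_of n (perm_alg a20 n)"
      using gens20[of A B i j] gens20[of B A j i] a20.two_swap[of j i B A] *(2-4) by auto
  qed
  moreover have "perm_alg a20 n \<subseteq> perm_alg a6 n"
  proof (rule perm_alg_subset_perm)
    fix A B i j
    assume *: "(A, B) \<in> a20" "i < n" "j < n" "i \<noteq> j"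
    have "(A, B) \<in> a6 \<or> A = B \<and> A \<in> {PY, PZ}" using *(1) by (auto simp: a6_def a20_def)
    then show "two A B i j \<in> strs_of n (perm_alg a6 n)"
      using gens[of A B i j] new[of i j] *(2-4) by auto
  qed
  ultimately show ?thesis using perm_a20 assms by auto
qed

text \<open>The last site has no right neighbour in the chain, so its letter comes from the
  generator with the identity first.\<close>

lemma chain_single:
  assumes "(A, PI) \<in> G" "(PI, A) \<in> G" "i < n" "j < n" "i \<noteq> j"
  shows "two A PI i j \<in> strs_of n (chain_alg G n)"
proof -
  interpret pauli_closed n "strs_of n (chain_alg G n)" by (rule pauli_closed_chain)
  show ?thesis
  proof (cases "Suc i < n")
    case True
    then show ?thesis using chain_gen[OF assms(1) True] single_cong[of A i "Suc i" j] assms by simp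
  next
    case False
    then obtain m where m: "i = Suc m" using assms by (cases i) auto
    have "two A PI i m \<in> strs_of n (chain_alg G n)"
      using two_swap[OF _ chain_gen[OF assms(2), of m]] m assms by simp
    then show ?thesis using single_cong[of A i m j] m assms by simp
  qed
qed

lemma perm_eq_chain_single:
  assumes "\<And>A B. (A, B) \<in> G \<Longrightarrow> (B = PI \<or> A = PI) \<and> (B, A) \<in> G"
  shows "perm_alg G n = chain_alg G n"
proof (rule perm_eq_chain)
  interpret pauli_closed n "strs_of n (chain_alg G n)" by (rule pauli_closed_chain)
  show "two A B i j \<in> strs_of n (chain_alg G n)" if "(A, B) \<in> G" "i < n" "j < n" "i \<noteq> j" for A B i j
    using assms[OF that(1)] that chain_single[of A G i n j] chain_single[of B G j n i] two_swap[of j i B A]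
    by auto
qed

theorem perm_b0: "perm_alg b0 n = chain_alg b0 n"
  by (rule perm_eq_chain_single) (auto simp: b0_def)

theorem perm_b3: "perm_alg b3 n = chain_alg b3 n"
  by (rule perm_eq_chain_single) (auto simp: b3_def)

section \<open>Pauli expansion and commutants\<close>

definition tr :: "complex mat \<Rightarrow> complex" where
  "tr M = (\<Sum>i<dim_row M. M $$ (i, i))"

lemma tr_comm:
  assumes "A \<in> carrier_mat N M" "B \<in> carrier_mat M N"
  shows "tr (A * B) = tr (B * A)"
proof -
  have "tr (A * B) = (\<Sum>i<N. \<Sum>k<M. A $$ (i, k) * B $$ (k, i))"
    unfolding tr_def using assms by (intro sum.cong) (auto simp: mult_mat_index simp del: index_mult_mat(1))
  also have "\<dots> = (\<Sum>k<M. \<Sum>i<N. B $$ (k, i) * A $$ (i, k))"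
    by (subst sum.swap) (simp add: mult.commute)
  also have "\<dots> = tr (B * A)"
    unfolding tr_def using assms by (intro sum.cong) (auto simp: mult_mat_index simp del: index_mult_mat(1))
  finally show ?thesis .
qed

lemma mult_carrier_square [simp]:
  "A \<in> carrier_mat N N \<Longrightarrow> B \<in> carrier_mat N N \<Longrightarrow> A * B \<in> carrier_mat N N"
  by (rule mult_carrier_mat)

lemma tr_smult: "tr (c \<cdot>\<^sub>m A) = c * tr A" if "A \<in> carrier_mat N N"
  using that by (auto simp: tr_def sum_distrib_left)

lemma tr_add: "A \<in> carrier_mat N N \<Longrightarrow> B \<in> carrier_mat N N \<Longrightarrow> tr (A + B) = tr A + tr B"
  by (auto simp: tr_def sum.distrib)

lemma tr_minus: "A \<in> carrier_mat N N \<Longrightarrow> B \<in> carrier_mat N N \<Longrightarrow> tr (A - B) = tr A - tr B"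
  by (auto simp: tr_def sum_subtractf)

definition dag :: "complex mat \<Rightarrow> complex mat" where
  "dag A = mat (dim_col A) (dim_row A) (\<lambda>(i, j). cnj (A $$ (j, i)))"

lemma dag_carrier [simp]: "A \<in> carrier_mat N M \<Longrightarrow> dag A \<in> carrier_mat M N"
  by (auto simp: dag_def)

lemma dag_mult:
  assumes "A \<in> carrier_mat N K" "B \<in> carrier_mat K M"
  shows "dag (A * B) = dag B * dag A"
proof (rule eq_matI)
  fix i j
  assume "i < dim_row (dag B * dag A)" "j < dim_col (dag B * dag A)"
  then have ij: "i < M" "j < N" using assms by (auto simp: dag_def)
  have "dag (A * B) $$ (i, j) = cnj (\<Sum>k<K. A $$ (j, k) * B $$ (k, i))"
    using assms ij mult_mat_index[OF assms, of j i] by (simp add: dag_def)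
  also have "\<dots> = (\<Sum>k<K. dag B $$ (i, k) * dag A $$ (k, j))"
    using assms ij by (auto simp: dag_def intro!: sum.cong)
  also have "\<dots> = (dag B * dag A) $$ (i, j)"
    using assms ij by (intro mult_mat_index[symmetric]) auto
  finally show "dag (A * B) $$ (i, j) = (dag B * dag A) $$ (i, j)" .
qed (use assms in \<open>auto simp: dag_def\<close>)

lemma dag_dag [simp]: "dag (dag A) = A"
  by (rule eq_matI) (auto simp: dag_def)

lemma dag_add: "A \<in> carrier_mat N M \<Longrightarrow> B \<in> carrier_mat N M \<Longrightarrow> dag (A + B) = dag A + dag B"
  by (rule eq_matI) (auto simp: dag_def)

lemma dag_smult: "dag (c \<cdot>\<^sub>m A) = cnj c \<cdot>\<^sub>m dag A"
  by (rule eq_matI) (auto simp: dag_def)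

lemma dag_pstr: "dag (pstr n s) = pstr n s"
  by (rule eq_matI) (auto simp: dag_def pstr_def prod_cnj cnj_pentry)

definition skew :: "nat \<Rightarrow> complex mat set" where
  "skew N = {M \<in> carrier_mat N N. dag M = - M}"

lemma skew_iff:
  "M \<in> skew N \<longleftrightarrow> M \<in> carrier_mat N N \<and> (\<forall>i<N. \<forall>j<N. M $$ (i, j) = - cnj (M $$ (j, i)))"
proof -
  have "dag M = - M \<longleftrightarrow> (\<forall>i<N. \<forall>j<N. M $$ (i, j) = - cnj (M $$ (j, i)))"
    if M: "M \<in> carrier_mat N N"
  proof
    assume d: "dag M = - M"
    show "\<forall>i<N. \<forall>j<N. M $$ (i, j) = - cnj (M $$ (j, i))"
    proof (intro allI impI)
      fix i j
      assume "i < N" "j < N"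
      then have "dag M $$ (i, j) = cnj (M $$ (j, i))" "(- M) $$ (i, j) = - M $$ (i, j)"
        using M by (auto simp: dag_def)
      then show "M $$ (i, j) = - cnj (M $$ (j, i))" using d by (metis minus_minus)
    qed
  next
    assume h: "\<forall>i<N. \<forall>j<N. M $$ (i, j) = - cnj (M $$ (j, i))"
    show "dag M = - M"
    proof (rule eq_matI)
      fix i j
      assume "i < dim_row (- M)" "j < dim_col (- M)"
      then have "i < N" "j < N" using M by auto
      then show "dag M $$ (i, j) = (- M) $$ (i, j)"
        using M h[rule_format, of i j] by (auto simp: dag_def)
    qed (use M in \<open>auto simp: dag_def\<close>)
  qed
  then show ?thesis by (auto simp: skew_def)
qed

lemma su_iff: "M \<in> su N \<longleftrightarrow> M \<in> skew N \<and> tr M = 0"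
  unfolding su_def skew_iff by (auto simp: tr_def)

lemma skew_zero: "0\<^sub>m N N \<in> skew N"
  by (simp add: skew_iff)

lemma skew_add: "x \<in> skew N \<Longrightarrow> y \<in> skew N \<Longrightarrow> x + y \<in> skew N"
  unfolding skew_def by (auto simp: dag_add intro!: eq_matI)

lemma skew_smult: "x \<in> skew N \<Longrightarrow> complex_of_real r \<cdot>\<^sub>m x \<in> skew N"
  unfolding skew_def by (auto simp: dag_smult intro!: eq_matI)

lemma comm_carrier [simp]: "x \<in> carrier_mat N N \<Longrightarrow> y \<in> carrier_mat N N \<Longrightarrow> comm x y \<in> carrier_mat N N"
  by (auto simp: comm_def)

lemma dag_minus: "A \<in> carrier_mat N M \<Longrightarrow> B \<in> carrier_mat N M \<Longrightarrow> dag (A - B) = dag A - dag B"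
  by (rule eq_matI) (auto simp: dag_def)

lemma skew_comm:
  assumes "x \<in> skew N" "y \<in> skew N"
  shows "comm x y \<in> skew N"
proof -
  have c: "x \<in> carrier_mat N N" "y \<in> carrier_mat N N" and d: "dag x = - x" "dag y = - y"
    using assms by (auto simp: skew_def)
  have "dag (comm x y) = dag (x * y) - dag (y * x)"
    unfolding comm_def using c by (intro dag_minus) auto
  also have "\<dots> = y * x - x * y"
    using c d by (simp add: dag_mult[OF c] dag_mult[OF c(2,1)])
  also have "\<dots> = - comm x y"
    unfolding comm_def using c by (intro eq_matI) auto
  finally show ?thesis using c by (simp add: skew_def)
qed

lemma i_pstr_skew: "\<i> \<cdot>\<^sub>m pstr n s \<in> skew (2 ^ n)"
proof -
  have "cnj \<i> \<cdot>\<^sub>m pstr n s = - (\<i> \<cdot>\<^sub>m pstr n s)" by (intro eq_matI) auto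
  then show ?thesis by (simp add: skew_def dag_smult dag_pstr)
qed

lemma tr_pstr:
  assumes "j < n" "s j \<noteq> PI"
  shows "tr (pstr n s) = 0"
proof -
  have "tr (pstr n s) = (\<Sum>c<2 ^ n. \<Prod>j<n. pentry (s j) (qbit c j) (qbit c j))"
    by (auto simp: tr_def pstr_def)
  also have "\<dots> = (\<Prod>j<n. \<Sum>x\<in>UNIV. pentry (s j) x x)"
    by (rule sum_prod_bits)
  also have "\<dots> = 0"
    using assms by (intro prod_zero) (auto simp: UNIV_bool intro!: bexI[of _ j], cases "s j", auto)
  finally show ?thesis .
qed

lemma tr_pstr_mult:
  assumes "j < n" "s j \<noteq> t j"
  shows "tr (pstr n s * pstr n t) = 0"
  unfolding pstr_mult using assms
  by (subst tr_smult[OF pstr_carrier]) (auto simp: tr_pstr[of j] pm_eq_PI_iff)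

text \<open>Conjugation by Q fixes M and negates P, so cyclicity gives tr (PM) = - tr (PM).\<close>

lemma tr_anticommuting:
  assumes M: "M \<in> carrier_mat (2 ^ n) (2 ^ n)" and c: "pstr n q * M = M * pstr n q" and a: "acomm n s q"
  shows "tr (pstr n s * M) = 0"
proof -
  let ?P = "pstr n s" and ?Q = "pstr n q"
  have "?P * ?Q = - 1 \<cdot>\<^sub>m (?Q * ?P)" using pstr_commute[of n s q] a by simp
  then have PQ: "?P * ?Q = - (?Q * ?P)" by (auto intro!: eq_matI)
  have "tr (?P * M) = tr (?P * (M * (?Q * ?Q)))"
    using M by (simp add: pstr_square)
  also have "?P * (M * (?Q * ?Q)) = (?P * M * ?Q) * ?Q"
    using M by (simp add: assoc_mult_mat[of _ "2 ^ n" "2 ^ n" _ "2 ^ n" _ "2 ^ n"])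
  also have "tr \<dots> = tr (?Q * (?P * M * ?Q))"
    using M by (intro tr_comm[of _ "2 ^ n" "2 ^ n"]) auto
  also have "?P * M * ?Q = ?P * ?Q * M"
    using M c by (simp add: assoc_mult_mat[of _ "2 ^ n" "2 ^ n" _ "2 ^ n" _ "2 ^ n"])
  also have "?Q * (?P * ?Q * M) = - (?Q * ?Q * (?P * M))"
    using M unfolding PQ
    by (simp add: assoc_mult_mat[of _ "2 ^ n" "2 ^ n" _ "2 ^ n" _ "2 ^ n"])
  also have "\<dots> = (- 1) \<cdot>\<^sub>m (?P * M)"
    using M by (auto simp: pstr_square intro!: eq_matI)
  also have "tr \<dots> = - tr (?P * M)"
    using M by (subst tr_smult[of _ "2 ^ n"]) auto
  finally show ?thesis by simp
qed

section \<open>Completeness of the Pauli strings\<close>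

lemma UNIV_pauli: "UNIV = {PI, PX, PY, PZ}"
  using pauli.exhaust by auto

instance pauli :: finite
  by standard (simp add: UNIV_pauli)

lemma pentry_complete:
  "(\<Sum>A\<in>UNIV. pentry A a b * pentry A d c) = (if a = c \<and> b = d then 2 else 0)"
  unfolding UNIV_pauli by (cases a; cases b; cases c; cases d) auto

text \<open>\<open>PiE\<close> fixes the values outside {..<n}, so each length-n string has exactly
  one representative and the index set is finite.\<close>

definition strings :: "nat \<Rightarrow> (nat \<Rightarrow> pauli) set" where
  "strings n = PiE {..<n} (\<lambda>_. UNIV)"

lemma finite_strings: "finite (strings n)"
  by (simp add: strings_def finite_PiE)

lemma pstr_complete:
  assumes "a < 2 ^ n" "b < 2 ^ n" "c < 2 ^ n" "d < 2 ^ n"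
  shows "(\<Sum>s\<in>strings n. pstr n s $$ (a, b) * pstr n s $$ (d, c)) = (if a = c \<and> b = d then 2 ^ n else 0)"
proof -
  have "(\<Sum>s\<in>strings n. pstr n s $$ (a, b) * pstr n s $$ (d, c))
      = (\<Sum>s\<in>strings n. \<Prod>j<n. pentry (s j) (qbit a j) (qbit b j) * pentry (s j) (qbit d j) (qbit c j))"
    using assms by (simp add: pstr_def prod.distrib)
  also have "\<dots> = (\<Prod>j<n. \<Sum>A\<in>UNIV. pentry A (qbit a j) (qbit b j) * pentry A (qbit d j) (qbit c j))"
    unfolding strings_def by (rule prod_sum_PiE[symmetric]) auto
  also have "\<dots> = (\<Prod>j<n. if qbit a j = qbit c j \<and> qbit b j = qbit d j then 2 else 0)"
    by (simp add: pentry_complete)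
  also have "\<dots> = (if a = c \<and> b = d then 2 ^ n else 0)"
    unfolding prod_indicator using bits_eq_iff[of a n c] bits_eq_iff[of b n d] assms by auto
  finally show ?thesis .
qed

text \<open>Obtained by inserting the completeness relation into the entries of M, with no detour
  through bases or dimensions. The divisor 2^n is the trace of the square of a string.\<close>

lemma pauli_expansion:
  assumes M: "M \<in> carrier_mat (2 ^ n) (2 ^ n)" and ab: "a < 2 ^ n" "b < 2 ^ n"
  shows "M $$ (a, b) = (\<Sum>s\<in>strings n. tr (pstr n s * M) * pstr n s $$ (a, b)) / 2 ^ n"
proof -
  have t: "tr (pstr n s * M) = (\<Sum>d<2 ^ n. \<Sum>c<2 ^ n. pstr n s $$ (d, c) * M $$ (c, d))" for s
    unfolding tr_def using M
    by (auto simp: mult_mat_index[OF pstr_carrier M] simp del: index_mult_mat(1) intro!: sum.cong)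
  have "(\<Sum>s\<in>strings n. tr (pstr n s * M) * pstr n s $$ (a, b))
      = (\<Sum>d<2 ^ n. \<Sum>c<2 ^ n. M $$ (c, d) * (\<Sum>s\<in>strings n. pstr n s $$ (a, b) * pstr n s $$ (d, c)))"
    unfolding t sum_distrib_left sum_distrib_right
    by (subst sum.swap, rule sum.cong[OF refl], subst sum.swap) (simp add: mult_ac)
  also have "\<dots> = (\<Sum>d<2 ^ n. \<Sum>c<2 ^ n. if c = a then if d = b then M $$ (a, b) * 2 ^ n else 0 else 0)"
    using ab by (intro sum.cong) (auto simp: pstr_complete)
  also have "\<dots> = M $$ (a, b) * 2 ^ n"
    using ab by (simp add: sum.delta)
  finally show ?thesis by simp
qed

lemma tr_skew:
  assumes "M \<in> skew (2 ^ n)"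
  shows "Re (tr (pstr n s * M)) = 0"
proof -
  have M: "M \<in> carrier_mat (2 ^ n) (2 ^ n)" and d: "dag M = - M"
    using assms by (auto simp: skew_def)
  have "cnj (tr (pstr n s * M)) = tr (dag (pstr n s * M))"
    using M by (auto simp: tr_def dag_def)
  also have "dag (pstr n s * M) = (- 1) \<cdot>\<^sub>m (M * pstr n s)"
    using M by (auto simp: dag_mult[OF pstr_carrier M] dag_pstr d intro!: eq_matI)
  also have "tr \<dots> = - tr (M * pstr n s)"
    using M by (subst tr_smult[of _ "2 ^ n"]) auto
  also have "tr (M * pstr n s) = tr (pstr n s * M)"
    using M by (intro tr_comm) auto
  finally show ?thesis by (simp add: complex_eq_iff)
qed

lemma lie_closure_sum:
  assumes "finite T" "\<And>s. s \<in> T \<Longrightarrow> F s \<in> carrier_mat N N" "\<And>s. s \<in> T \<Longrightarrow> F s \<in> lie_closure N S"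
  shows "mat N N (\<lambda>(a, b). \<Sum>s\<in>T. F s $$ (a, b)) \<in> lie_closure N S"
  using assms
proof (induction T rule: finite_induct)
  case empty
  have "mat N N (\<lambda>(a, b). \<Sum>s\<in>{}. F s $$ (a, b)) = 0\<^sub>m N N" by (intro eq_matI) auto
  then show ?case by (metis lie_closure.zero)
next
  case (insert x T)
  have "mat N N (\<lambda>(a, b). \<Sum>s\<in>insert x T. F s $$ (a, b)) = F x + mat N N (\<lambda>(a, b). \<Sum>s\<in>T. F s $$ (a, b))"
    using insert by (intro eq_matI) auto
  moreover have IH: "mat N N (\<lambda>(a, b). \<Sum>s\<in>T. F s $$ (a, b)) \<in> lie_closure N S"
    by (rule insert.IH) (use insert.prems in auto)
  have "F x + mat N N (\<lambda>(a, b). \<Sum>s\<in>T. F s $$ (a, b)) \<in> lie_closure N S"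
    by (rule lie_closure.add[OF _ IH]) (use insert.prems in auto)
  ultimately show ?case by metis
qed

text \<open>Strings are Hermitian, so the Pauli coefficients of a skew-Hermitian M are imaginary and
  M is a real combination of matrices \<i>P. Strings with coefficient zero contribute the zero
  matrix, so only those that occur must be reached.\<close>

lemma skew_in_lie_closure:
  assumes M: "M \<in> skew (2 ^ n)"
    and coeffs: "\<And>s. tr (pstr n s * M) \<noteq> 0 \<Longrightarrow> s \<in> strs_of n (lie_closure (2 ^ n) S)"
  shows "M \<in> lie_closure (2 ^ n) S"
proof -
  define F where "F s = complex_of_real (Im (tr (pstr n s * M)) / 2 ^ n) \<cdot>\<^sub>m (\<i> \<cdot>\<^sub>m pstr n s)" for s
  have car: "M \<in> carrier_mat (2 ^ n) (2 ^ n)" using M by (auto simp: skew_def)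
  have "F s \<in> lie_closure (2 ^ n) S" for s
  proof (cases "tr (pstr n s * M) = 0")
    case True
    then have "F s = complex_of_real 0 \<cdot>\<^sub>m 0\<^sub>m (2 ^ n) (2 ^ n)" by (auto simp: F_def intro!: eq_matI)
    moreover have "complex_of_real 0 \<cdot>\<^sub>m 0\<^sub>m (2 ^ n) (2 ^ n) \<in> lie_closure (2 ^ n) S"
      by (intro lie_closure.smult lie_closure.zero)
    ultimately show ?thesis by simp
  next
    case False
    then have "\<i> \<cdot>\<^sub>m pstr n s \<in> lie_closure (2 ^ n) S" using coeffs by (simp add: strs_of_def)
    then show ?thesis unfolding F_def by (rule lie_closure.smult)
  qed
  then have "mat (2 ^ n) (2 ^ n) (\<lambda>(a, b). \<Sum>s\<in>strings n. F s $$ (a, b)) \<in> lie_closure (2 ^ n) S"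
    by (intro lie_closure_sum finite_strings) (auto simp: F_def)
  moreover have "mat (2 ^ n) (2 ^ n) (\<lambda>(a, b). \<Sum>s\<in>strings n. F s $$ (a, b)) = M"
  proof (rule eq_matI)
    fix a b
    assume "a < dim_row M" "b < dim_col M"
    then have ab: "a < 2 ^ n" "b < 2 ^ n" using car by auto
    have "F s $$ (a, b) = tr (pstr n s * M) * pstr n s $$ (a, b) / 2 ^ n" for s
    proof -
      define r where "r = Im (tr (pstr n s * M))"
      have "tr (pstr n s * M) = \<i> * complex_of_real r"
        using tr_skew[OF M, of s] by (simp add: complex_eq_iff r_def)
      then show ?thesis using ab by (simp add: F_def)
    qed
    then show "mat (2 ^ n) (2 ^ n) (\<lambda>(a, b). \<Sum>s\<in>strings n. F s $$ (a, b)) $$ (a, b) = M $$ (a, b)"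
      using ab pauli_expansion[OF car ab] by (simp add: sum_divide_distrib)
  qed (use car in auto)
  ultimately show ?thesis by simp
qed

text \<open>Without the trace condition the set would contain \<i>Q itself whenever the strings in Q
  commute with one another, although generators orthogonal to Q and their brackets have no component
  along it.\<close>

definition commutant :: "nat \<Rightarrow> (nat \<Rightarrow> pauli) set \<Rightarrow> complex mat set" where
  "commutant n Q = {M \<in> skew (2 ^ n). \<forall>q\<in>Q. pstr n q * M = M * pstr n q \<and> tr (pstr n q * M) = 0}"

lemma comm_commutes:
  assumes "P \<in> carrier_mat N N" "x \<in> carrier_mat N N" "y \<in> carrier_mat N N" "P * x = x * P" "P * y = y * P"
  shows "P * comm x y = comm x y * P"
proof -
  note a = assoc_mult_mat[of _ N N _ N _ N]
  have "P * (x * y) = x * y * P" if "x \<in> carrier_mat N N" "y \<in> carrier_mat N N" "P * x = x * P" "P * y = y * P" for x y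
    using that assms(1) by (metis a)
  then have *: "P * (x * y) = x * y * P" "P * (y * x) = y * x * P" using assms by auto
  have "P * comm x y = P * (x * y) - P * (y * x)"
    unfolding comm_def using assms by (intro mult_minus_distrib_mat) auto
  also have "\<dots> = comm x y * P"
    unfolding comm_def * using assms by (intro minus_mult_distrib_mat[symmetric]) auto
  finally show ?thesis .
qed

text \<open>Moving P past x and then cycling x to the end shows tr (Pxy) = tr (Pyx).\<close>

lemma tr_comm_commuting:
  assumes "P \<in> carrier_mat N N" "x \<in> carrier_mat N N" "y \<in> carrier_mat N N" "P * x = x * P" "P * y = y * P"
  shows "tr (P * comm x y) = 0"
proof -
  note a = assoc_mult_mat[of _ N N _ N _ N]
  have "tr (P * (x * y)) = tr (x * (P * y))"
    using assms by (metis a)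
  also have "\<dots> = tr (P * y * x)"
    using assms by (intro tr_comm[of _ N N]) auto
  also have "P * y * x = P * (y * x)" using assms(1-3) by (intro a)
  finally have eq: "tr (P * (x * y)) = tr (P * (y * x))" .
  have "P * comm x y = P * (x * y) - P * (y * x)"
    unfolding comm_def using assms(1-3) by (intro mult_minus_distrib_mat) auto
  also have "tr \<dots> = tr (P * (x * y)) - tr (P * (y * x))"
    using assms(1-3) by (intro tr_minus) auto
  finally show ?thesis using eq by simp
qed

lemma lie_closure_in_commutant:
  assumes "\<And>x. x \<in> S \<Longrightarrow> x \<in> commutant n Q"
  shows "lie_closure (2 ^ n) S \<subseteq> commutant n Q"
proof
  fix x
  assume "x \<in> lie_closure (2 ^ n) S"
  then show "x \<in> commutant n Q"
  proof induction
    case (gen x)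
    then show ?case using assms by blast
  next
    case zero
    then show ?case by (auto simp: commutant_def skew_zero tr_def intro!: eq_matI)
  next
    case (add x y)
    then have c: "x \<in> carrier_mat (2 ^ n) (2 ^ n)" "y \<in> carrier_mat (2 ^ n) (2 ^ n)"
      by (auto simp: commutant_def skew_def)
    have "pstr n q * (x + y) = (x + y) * pstr n q \<and> tr (pstr n q * (x + y)) = 0" if "q \<in> Q" for q
    proof -
      have *: "pstr n q * x = x * pstr n q" "pstr n q * y = y * pstr n q"
        "tr (pstr n q * x) = 0" "tr (pstr n q * y) = 0"
        using add.IH that by (auto simp: commutant_def)
      have "pstr n q * (x + y) = pstr n q * x + pstr n q * y"
        by (rule mult_add_distrib_mat[OF pstr_carrier c])
      moreover have "(x + y) * pstr n q = x * pstr n q + y * pstr n q"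
        by (rule add_mult_distrib_mat[OF c pstr_carrier])
      moreover have "tr (pstr n q * x + pstr n q * y) = tr (pstr n q * x) + tr (pstr n q * y)"
        using c by (intro tr_add) auto
      ultimately show ?thesis using * by (metis add_0)
    qed
    then show ?case using add.IH skew_add unfolding commutant_def by blast
  next
    case (smult x r)
    then have c: "x \<in> carrier_mat (2 ^ n) (2 ^ n)"
      by (auto simp: commutant_def skew_def)
    let ?r = "complex_of_real r"
    have "pstr n q * (?r \<cdot>\<^sub>m x) = ?r \<cdot>\<^sub>m x * pstr n q \<and> tr (pstr n q * (?r \<cdot>\<^sub>m x)) = 0" if "q \<in> Q" for q
    proof -
      have *: "pstr n q * x = x * pstr n q" "tr (pstr n q * x) = 0"
        using smult.IH that by (auto simp: commutant_def)
      have "pstr n q * (?r \<cdot>\<^sub>m x) = ?r \<cdot>\<^sub>m (pstr n q * x)"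
        by (rule mult_smult_distrib[OF pstr_carrier c])
      moreover have "?r \<cdot>\<^sub>m x * pstr n q = ?r \<cdot>\<^sub>m (x * pstr n q)"
        by (rule mult_smult_assoc_mat[OF c pstr_carrier])
      moreover have "tr (?r \<cdot>\<^sub>m (pstr n q * x)) = ?r * tr (pstr n q * x)"
        using c by (intro tr_smult[of _ "2 ^ n"]) auto
      ultimately show ?thesis using * by (metis mult_zero_right)
    qed
    then show ?case using smult.IH skew_smult unfolding commutant_def by blast
  next
    case (bracket x y)
    then have c: "x \<in> carrier_mat (2 ^ n) (2 ^ n)" "y \<in> carrier_mat (2 ^ n) (2 ^ n)"
      by (auto simp: commutant_def skew_def)
    show ?case using bracket.IH skew_comm comm_commutes[OF pstr_carrier c] tr_comm_commuting[OF pstr_carrier c]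
      unfolding commutant_def by blast
  qed
qed

lemma pstr_in_commutant:
  assumes "\<And>q. q \<in> Q \<Longrightarrow> \<not> acomm n s q" "\<And>q. q \<in> Q \<Longrightarrow> \<exists>j<n. s j \<noteq> q j"
  shows "\<i> \<cdot>\<^sub>m pstr n s \<in> commutant n Q"
proof -
  have "pstr n q * (\<i> \<cdot>\<^sub>m pstr n s) = \<i> \<cdot>\<^sub>m pstr n s * pstr n q \<and> tr (pstr n q * (\<i> \<cdot>\<^sub>m pstr n s)) = 0"
    if q: "q \<in> Q" for q
  proof -
    have "pstr n q * (\<i> \<cdot>\<^sub>m pstr n s) = \<i> \<cdot>\<^sub>m (pstr n q * pstr n s)"
      by (rule mult_smult_distrib[OF pstr_carrier pstr_carrier])
    moreover have "\<i> \<cdot>\<^sub>m pstr n s * pstr n q = \<i> \<cdot>\<^sub>m (pstr n s * pstr n q)"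
      by (rule mult_smult_assoc_mat[OF pstr_carrier pstr_carrier])
    moreover have "pstr n s * pstr n q = pstr n q * pstr n s"
      using pstr_commute[of n s q] assms(1)[OF q] by (auto intro!: eq_matI)
    moreover have "tr (pstr n s * pstr n q) = 0"
      using assms(2)[OF q] tr_pstr_mult by blast
    moreover have "tr (\<i> \<cdot>\<^sub>m (pstr n q * pstr n s)) = \<i> * tr (pstr n q * pstr n s)"
      by (intro tr_smult[of _ "2 ^ n"]) auto
    ultimately show ?thesis by (metis mult_zero_right)
  qed
  then show ?thesis using i_pstr_skew unfolding commutant_def by blast
qed

text \<open>A string with nonzero coefficient in M cannot anticommute with any q, since M commutes
  with q, and cannot equal q, by the trace condition. The problem becomes purely
  combinatorial.\<close>

lemma commutant_in_lie_closure:
  assumes "\<And>s. \<forall>q\<in>Q. \<not> acomm n s q \<and> (\<exists>j<n. s j \<noteq> q j) \<Longrightarrow>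
      s \<in> strs_of n (lie_closure (2 ^ n) S)"
  shows "commutant n Q \<subseteq> lie_closure (2 ^ n) S"
proof
  fix M
  assume M: "M \<in> commutant n Q"
  then have sk: "M \<in> skew (2 ^ n)" and c: "M \<in> carrier_mat (2 ^ n) (2 ^ n)"
    by (auto simp: commutant_def skew_def)
  show "M \<in> lie_closure (2 ^ n) S"
  proof (rule skew_in_lie_closure[OF sk])
    fix s
    assume nz: "tr (pstr n s * M) \<noteq> 0"
    show "s \<in> strs_of n (lie_closure (2 ^ n) S)"
    proof (rule assms, intro ballI conjI)
      fix q
      assume q: "q \<in> Q"
      show "\<not> acomm n s q"
        using tr_anticommuting[OF c, of q s] M q nz by (auto simp: commutant_def)
      show "\<exists>j<n. s j \<noteq> q j"
      proof (rule ccontr)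
        assume "\<not> ?thesis"
        then have "pstr n s = pstr n q" by (intro pstr_cong) auto
        then show False using M q nz by (auto simp: commutant_def)
      qed
    qed
  qed
qed

lemma acomm_const_two: "\<lbrakk>i < n; j < n; i \<noteq> j\<rbrakk> \<Longrightarrow> acomm n (two A B i j) (\<lambda>_. D) \<longleftrightarrow> ac A D \<noteq> ac B D"
  unfolding acomm_def prod_two_points
  by (subst prod.neutral) (auto simp: two_def sg_def ac_def)

theorem perm_a14_commutant:
  assumes "n \<ge> 3"
  shows "perm_alg a14 n = commutant n {\<lambda>_. PI, \<lambda>_. PZ}"
proof
  show "perm_alg a14 n \<subseteq> commutant n {\<lambda>_. PI, \<lambda>_. PZ}"
    unfolding perm_alg_def Lie_def
  proof (rule lie_closure_in_commutant)
    fix x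
    assume "x \<in> (\<cdot>\<^sub>m) \<i> ` {ps2 n A B i j |A B i j. (A, B) \<in> a14 \<and> i < n \<and> j < n \<and> i \<noteq> j}"
    then obtain A B i j where x: "x = \<i> \<cdot>\<^sub>m pstr n (two A B i j)"
      and *: "(A, B) \<in> a14" "i < n" "j < n" "i \<noteq> j" by (auto simp: ps2_two)
    have "A \<in> {PX, PY}" "B \<in> {PX, PY}" using *(1) by (auto simp: a14_def)
    then have "\<not> acomm n (two A B i j) (\<lambda>_. PI)" "\<not> acomm n (two A B i j) (\<lambda>_. PZ)"
      using * by (auto simp: acomm_const_two ac_def)
    moreover have "two A B i j i \<noteq> PI" "two A B i j i \<noteq> PZ"
      using \<open>A \<in> {PX, PY}\<close> by (auto simp: two_def)
    ultimately show "x \<in> commutant n {\<lambda>_. PI, \<lambda>_. PZ}"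
      unfolding x using *(2) by (intro pstr_in_commutant) auto
  qed
  interpret pauli_closed n "strs_of n (perm_alg a14 n)" by (rule pauli_closed_perm)
  have pairs: "two A B i j \<in> strs_of n (perm_alg a14 n)"
    if "i < n" "j < n" "i \<noteq> j" "A \<in> {PX, PY}" "B \<in> {PX, PY}" for A B i j
  proof -
    have "(A, B) \<in> a14 \<or> (B, A) \<in> a14" using that by (auto simp: a14_def)
    then show ?thesis using perm_gen[of A B a14 i n j] perm_gen[of B A a14 j n i] two_swap[of j i B A] that by auto
  qed
  have zz: "two PZ PZ i j \<in> strs_of n (perm_alg a14 n)" if ij: "i < n" "j < n" "i \<noteq> j" for i j
  proof -
    obtain k where k: "k < n" "k \<noteq> i" "k \<noteq> j" using third_site assms by blast
    \<comment> \<open>XX on (j, i) times YX on (i, k) is X, Z, X on j, i, k; YX on (j, k) clears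
      site k and leaves ZZ.\<close>
    have "three PX (pm PX PY) PX j i k \<in> strs_of n (perm_alg a14 n)"
      by (rule join) (use pairs ij k in \<open>auto simp: ac_def\<close>)
    then have "three PX PX PZ j k i \<in> strs_of n (perm_alg a14 n)"
      using three_swap(1)[of j i k] ij k by simp
    then have "two (pm PX PY) PZ j i \<in> strs_of n (perm_alg a14 n)"
      by (rule absorb) (use pairs ij k in \<open>auto simp: ac_def\<close>)
    then show ?thesis using two_swap[of j i PZ PZ] ij by simp
  qed
  have closure: "s \<in> strs_of n (perm_alg a14 n)"
    if "\<forall>q\<in>{\<lambda>_. PI, \<lambda>_. PZ}. \<not> acomm n s q \<and> (\<exists>j<n. s j \<noteq> q j)" for s
  proof (rule even_XY_in_closure[OF pairs zz])
    show "(\<Prod>k<n. sg (s k) PZ) = 1" using that by (simp add: not_acomm_iff)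
    show "\<exists>k<n. s k \<noteq> PI" "\<exists>k<n. s k \<noteq> PZ" using that by simp_all
  qed
  show "commutant n {\<lambda>_. PI, \<lambda>_. PZ} \<subseteq> perm_alg a14 n"
    unfolding perm_alg_def Lie_def
    by (rule commutant_in_lie_closure[OF closure[unfolded perm_alg_def Lie_def]])
qed

text \<open>One description serves both parities of n, although the constant strings commute with
  one another for n even and anticommute for n odd; the parity matters only for the isomorphism
  type.\<close>

theorem chain_a7_commutant:
  assumes "n \<ge> 3"
  shows "chain_alg a7 n = commutant n {\<lambda>_. PI, \<lambda>_. PX, \<lambda>_. PY, \<lambda>_. PZ}"
    (is "_ = commutant n ?Q")
  unfolding perm_a7[symmetric]
proof
  have Q: "?Q = range (\<lambda>A _. A)" by (auto simp: UNIV_pauli)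
  show "perm_alg a7 n \<subseteq> commutant n ?Q"
    unfolding perm_alg_def Lie_def
  proof (rule lie_closure_in_commutant)
    fix x
    assume "x \<in> (\<cdot>\<^sub>m) \<i> ` {ps2 n A B i j |A B i j. (A, B) \<in> a7 \<and> i < n \<and> j < n \<and> i \<noteq> j}"
    then obtain A B i j where x: "x = \<i> \<cdot>\<^sub>m pstr n (two A B i j)"
      and *: "(A, B) \<in> a7" "i < n" "j < n" "i \<noteq> j" by (auto simp: ps2_two)
    have AB: "B = A" "A \<noteq> PI" using *(1) by (auto simp: a7_def)
    \<comment> \<open>A third site carries the identity, which separates the generator from every
      nontrivial constant string; site \<open>i\<close> separates it from the trivial one.\<close>
    obtain k where k: "k < n" "k \<noteq> i" "k \<noteq> j" using third_site assms by blast
    have "\<exists>m<n. two A B i j m \<noteq> q m" if "q \<in> ?Q" for q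
    proof (cases "q i = PI")
      case True
      then show ?thesis using * AB by (intro exI[of _ i]) (auto simp: two_def)
    next
      case False
      have "q k = q i" using that by auto
      then show ?thesis using k False by (intro exI[of _ k]) (auto simp: two_def)
    qed
    moreover have "\<not> acomm n (two A B i j) q" if "q \<in> ?Q" for q
      using that * AB by (auto simp: acomm_const_two)
    ultimately show "x \<in> commutant n ?Q"
      unfolding x by (intro pstr_in_commutant)
  qed
  interpret pauli_closed n "strs_of n (perm_alg a7 n)" by (rule pauli_closed_perm)
  have pairs: "two A A i j \<in> strs_of n (perm_alg a7 n)"
    if "i < n" "j < n" "i \<noteq> j" "A \<noteq> PI" for A i j
  proof -
    have "(A, A) \<in> a7" using that by (cases A) (auto simp: a7_def)
    then show ?thesis using that by (intro perm_gen)
  qed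
  have closure: "s \<in> strs_of n (perm_alg a7 n)"
    if "\<forall>q\<in>?Q. \<not> acomm n s q \<and> (\<exists>j<n. s j \<noteq> q j)" for s
  proof (rule nonconstant_in_closure[OF pairs])
    fix A
    have "(\<lambda>_. A) \<in> ?Q" unfolding Q by simp
    from bspec[OF that this] show "(\<Prod>k<n. sg (s k) A) = 1" "\<exists>k<n. s k \<noteq> A"
      by (simp_all add: not_acomm_iff)
  qed
  show "commutant n ?Q \<subseteq> perm_alg a7 n"
    unfolding perm_alg_def Lie_def
    by (rule commutant_in_lie_closure[OF closure[unfolded perm_alg_def Lie_def]])
qed

section \<open>Parity and complementation of basis states\<close>

definition zsgn :: "nat \<Rightarrow> nat \<Rightarrow> complex" where
  "zsgn n a = (\<Prod>j<n. if qbit a j then -1 else 1)"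

text \<open>Subtraction from the all-ones number complements every bit without borrowing. This is
  the permutation of basis states effected by X...X.\<close>

definition cpl :: "nat \<Rightarrow> nat \<Rightarrow> nat" where
  "cpl n a = 2 ^ n - 1 - a"

lemma zsgn_cases: "zsgn n a = 1 \<or> zsgn n a = -1"
  unfolding zsgn_def by (induction n) auto

lemma cpl_less: "cpl n a < 2 ^ n"
  unfolding cpl_def by (simp add: less_imp_diff_less)

lemma cpl_cpl: "a < 2 ^ n \<Longrightarrow> cpl n (cpl n a) = a"
  unfolding cpl_def by simp

lemma qbit_cpl:
  assumes "a < 2 ^ n" "j < n"
  shows "qbit (cpl n a) j \<longleftrightarrow> \<not> qbit a j"
  using assms
proof (induction n arbitrary: a)
  case 0
  then show ?case by simp
next
  case (Suc n)
  show ?case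
  proof (cases "a < 2 ^ n")
    case True
    have eq: "cpl (Suc n) a = cpl n a + 2 ^ n" using True by (simp add: cpl_def)
    show ?thesis unfolding eq
      using Suc True qbit_high[OF True, of n] by (auto simp: qbit_add_high cpl_less less_Suc_eq)
  next
    case False
    define c where "c = a - 2 ^ n"
    have c: "a = c + 2 ^ n" "c < 2 ^ n" using False Suc.prems by (auto simp: c_def)
    have eq: "cpl (Suc n) a = cpl n c" using c by (simp add: cpl_def)
    show ?thesis unfolding eq
      using Suc.IH[OF c(2)] Suc.prems(2) qbit_high[OF cpl_less, of n n c] c
      by (auto simp: qbit_add_high less_Suc_eq)
  qed
qed

lemma eq_cpl_iff: "a < 2 ^ n \<Longrightarrow> b < 2 ^ n \<Longrightarrow> b = cpl n a \<longleftrightarrow> (\<forall>j<n. qbit a j \<noteq> qbit b j)"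
  using bits_eq_iff[of b n "cpl n a"] cpl_less[of n a] by (auto simp: qbit_cpl)

lemma zsgn_cpl:
  assumes "a < 2 ^ n"
  shows "zsgn n (cpl n a) = (-1) ^ n * zsgn n a"
proof -
  have "zsgn n (cpl n a) = (\<Prod>j<n. (-1) * (if qbit a j then -1 else 1))"
    unfolding zsgn_def using assms by (intro prod.cong) (auto simp: qbit_cpl)
  then show ?thesis unfolding prod.distrib zsgn_def by simp
qed

lemma zsgn_low: "a < 2 ^ m \<Longrightarrow> zsgn (Suc m) a = zsgn m a"
  unfolding zsgn_def using qbit_high[of a m m] by simp

lemma zsgn_high: "a < 2 ^ m \<Longrightarrow> zsgn (Suc m) (a + 2 ^ m) = - zsgn m a"
  unfolding zsgn_def by (simp add: qbit_add_high)

lemma pstr_PZ_index: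
  assumes "a < 2 ^ n" "b < 2 ^ n"
  shows "pstr n (\<lambda>_. PZ) $$ (a, b) = (if a = b then zsgn n a else 0)"
proof (cases "a = b")
  case False
  then obtain j where "j < n" "qbit a j \<noteq> qbit b j" using bits_eqI assms by blast
  then have "(\<Prod>j<n. pentry PZ (qbit a j) (qbit b j)) = 0"
    by (intro prod_zero) (auto intro!: bexI[of _ j])
  then show ?thesis using assms False by (simp add: pstr_def)
qed (use assms in \<open>simp add: pstr_def zsgn_def\<close>)

lemma pstr_PX_index:
  assumes "a < 2 ^ n" "b < 2 ^ n"
  shows "pstr n (\<lambda>_. PX) $$ (a, b) = (if b = cpl n a then 1 else 0)"
  using assms eq_cpl_iff[OF assms] by (simp add: pstr_def prod_indicator)

lemma mult_PZ_index:
  assumes "M \<in> carrier_mat N (2 ^ n)" "a < N" "b < 2 ^ n"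
  shows "(M * pstr n (\<lambda>_. PZ)) $$ (a, b) = M $$ (a, b) * zsgn n b"
proof -
  have "(M * pstr n (\<lambda>_. PZ)) $$ (a, b) = (\<Sum>c<2 ^ n. if c = b then M $$ (a, b) * zsgn n b else 0)"
    unfolding mult_mat_index[OF assms(1) pstr_carrier assms(2,3)]
    using assms by (intro sum.cong) (auto simp: pstr_PZ_index)
  then show ?thesis using assms by simp
qed

lemma PZ_mult_index:
  assumes "M \<in> carrier_mat (2 ^ n) N" "a < 2 ^ n" "b < N"
  shows "(pstr n (\<lambda>_. PZ) * M) $$ (a, b) = zsgn n a * M $$ (a, b)"
proof -
  have "(pstr n (\<lambda>_. PZ) * M) $$ (a, b) = (\<Sum>c<2 ^ n. if c = a then zsgn n a * M $$ (a, b) else 0)"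
    unfolding mult_mat_index[OF pstr_carrier assms(1-3)]
    using assms by (intro sum.cong) (auto simp: pstr_PZ_index)
  then show ?thesis using assms by simp
qed

lemma mult_PX_index:
  assumes "M \<in> carrier_mat N (2 ^ n)" "a < N" "b < 2 ^ n"
  shows "(M * pstr n (\<lambda>_. PX)) $$ (a, b) = M $$ (a, cpl n b)"
proof -
  have "(M * pstr n (\<lambda>_. PX)) $$ (a, b) = (\<Sum>c<2 ^ n. if c = cpl n b then M $$ (a, cpl n b) else 0)"
    unfolding mult_mat_index[OF assms(1) pstr_carrier assms(2,3)]
    using assms by (intro sum.cong) (auto simp: pstr_PX_index cpl_cpl)
  then show ?thesis using cpl_less by simp
qed

lemma PX_mult_index:
  assumes "M \<in> carrier_mat (2 ^ n) N" "a < 2 ^ n" "b < N"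
  shows "(pstr n (\<lambda>_. PX) * M) $$ (a, b) = M $$ (cpl n a, b)"
proof -
  have "(pstr n (\<lambda>_. PX) * M) $$ (a, b) = (\<Sum>c<2 ^ n. if c = cpl n a then M $$ (cpl n a, b) else 0)"
    unfolding mult_mat_index[OF pstr_carrier assms(1-3)]
    using assms by (intro sum.cong) (auto simp: pstr_PX_index)
  then show ?thesis using cpl_less by simp
qed

section \<open>Transposition and the real skew-symmetric algebra\<close>

lemma so_iff:
  "M \<in> so N \<longleftrightarrow> M \<in> skew N \<and> (\<forall>i<N. \<forall>j<N. M $$ (i, j) \<in> \<real>)"
proof -
  have "cnj z = z" if "z \<in> \<real>" for z using that by (simp add: Reals_cnj_iff)
  then show ?thesis unfolding so_def skew_iff mem_Collect_eq by metis
qed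

lemma so_carrier: "M \<in> so N \<Longrightarrow> M \<in> carrier_mat N N"
  by (simp add: so_def)

lemma real_mult_index:
  assumes "A \<in> carrier_mat N K" "B \<in> carrier_mat K M"
    "\<forall>i<N. \<forall>j<K. A $$ (i, j) \<in> \<real>" "\<forall>i<K. \<forall>j<M. B $$ (i, j) \<in> \<real>"
  shows "\<forall>i<N. \<forall>j<M. (A * B) $$ (i, j) \<in> \<real>"
  using assms by (auto simp: mult_mat_index[OF assms(1,2)] simp del: index_mult_mat(1) intro!: sum_in_Reals Reals_mult)

lemma so_comm:
  assumes "x \<in> so N" "y \<in> so N"
  shows "comm x y \<in> so N"
proof -
  have xy: "x \<in> skew N" "y \<in> skew N" "\<forall>i<N. \<forall>j<N. x $$ (i, j) \<in> \<real>" "\<forall>i<N. \<forall>j<N. y $$ (i, j) \<in> \<real>"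
    using assms by (auto simp: so_iff)
  then have c: "x \<in> carrier_mat N N" "y \<in> carrier_mat N N" by (auto simp: skew_def)
  have "\<forall>i<N. \<forall>j<N. (x * y) $$ (i, j) \<in> \<real>" "\<forall>i<N. \<forall>j<N. (y * x) $$ (i, j) \<in> \<real>"
    using real_mult_index c xy by blast+
  then have "\<forall>i<N. \<forall>j<N. comm x y $$ (i, j) \<in> \<real>"
    using c by (auto simp: comm_def simp del: index_mult_mat(1) intro!: Reals_diff)
  then show ?thesis using skew_comm xy by (simp add: so_iff)
qed

lemma pentry_transpose: "pentry A b a = (if A = PY then -1 else 1) * pentry A a b"
  by (cases A) auto

lemma pstr_transpose:
  assumes "a < 2 ^ n" "b < 2 ^ n"
  shows "pstr n s $$ (b, a) = (\<Prod>k<n. if s k = PY then -1 else 1) * pstr n s $$ (a, b)"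
  using assms by (simp add: pstr_def pentry_transpose[of _ "qbit b _" "qbit a _"] flip: prod.distrib)

text \<open>Y is antisymmetric and the other letters are symmetric. With an odd number of Y's the
  string is antisymmetric and Hermitian, hence purely imaginary, and \<i> makes it real.\<close>

lemma i_pstr_so:
  assumes "(\<Prod>k<n. if s k = PY then -1 else (1::complex)) = -1"
  shows "\<i> \<cdot>\<^sub>m pstr n s \<in> so (2 ^ n)"
proof -
  have "\<i> * pstr n s $$ (a, b) \<in> \<real>" if "a < 2 ^ n" "b < 2 ^ n" for a b
  proof -
    have "dag (pstr n s) $$ (a, b) = cnj (pstr n s $$ (b, a))"
      using that by (simp add: dag_def)
    then have "cnj (pstr n s $$ (b, a)) = pstr n s $$ (a, b)" by (simp add: dag_pstr)
    then have "cnj (pstr n s $$ (a, b)) = - pstr n s $$ (a, b)"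
      using pstr_transpose[OF that, of s] assms by (simp add: complex_eq_iff)
    then show ?thesis by (simp add: Reals_cnj_iff)
  qed
  then show ?thesis using i_pstr_skew by (auto simp: so_iff)
qed

text \<open>Transposition turns the trace of a symmetric times an antisymmetric matrix into its
  negative.\<close>

lemma tr_symmetric_so:
  assumes "(\<Prod>k<n. if s k = PY then -1 else (1::complex)) = 1" "M \<in> so (2 ^ n)"
  shows "tr (pstr n s * M) = 0"
proof -
  have M: "M \<in> carrier_mat (2 ^ n) (2 ^ n)"
    and anti: "\<And>i j. i < 2 ^ n \<Longrightarrow> j < 2 ^ n \<Longrightarrow> M $$ (i, j) = - M $$ (j, i)"
    using assms(2) unfolding so_def by blast+
  have t: "tr (pstr n s * M) = (\<Sum>d<2 ^ n. \<Sum>c<2 ^ n. pstr n s $$ (d, c) * M $$ (c, d))"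
    unfolding tr_def using M
    by (auto simp: mult_mat_index[OF pstr_carrier M] simp del: index_mult_mat(1) intro!: sum.cong)
  also have "\<dots> = (\<Sum>d<2 ^ n. \<Sum>c<2 ^ n. - (pstr n s $$ (c, d) * M $$ (d, c)))"
  proof (intro sum.cong refl)
    fix d c :: nat
    assume "d \<in> {..<2 ^ n}" "c \<in> {..<2 ^ n}"
    then show "pstr n s $$ (d, c) * M $$ (c, d) = - (pstr n s $$ (c, d) * M $$ (d, c))"
      using pstr_transpose[of c n d s] assms(1) anti[of c d] by simp
  qed
  also have "\<dots> = - (\<Sum>d<2 ^ n. \<Sum>c<2 ^ n. pstr n s $$ (c, d) * M $$ (d, c))"
    by (simp add: sum_negf)
  also have "\<dots> = - (\<Sum>d<2 ^ n. \<Sum>c<2 ^ n. pstr n s $$ (d, c) * M $$ (c, d))"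
    by (subst sum.swap) simp
  finally show ?thesis using t by simp
qed

lemma prod_Y_cases: "(\<Prod>k<(n::nat). if P k then -1 else (1::complex)) \<in> {1, -1}"
  by (induction n) auto

theorem perm_a2_eq:
  "perm_alg a2 n = {g \<in> so (2 ^ n). g * pstr n (\<lambda>_. PZ) = pstr n (\<lambda>_. PZ) * g}"
  (is "_ = ?R")
proof
  let ?Z = "pstr n (\<lambda>_. PZ)"
  show "perm_alg a2 n \<subseteq> ?R"
  proof
    fix x
    assume "x \<in> perm_alg a2 n"
    then show "x \<in> ?R"
      unfolding perm_alg_def Lie_def
    proof induction
      case (gen x)
      then obtain A B i j where x: "x = \<i> \<cdot>\<^sub>m pstr n (two A B i j)"
        and *: "(A, B) \<in> a2" "i < n" "j < n" "i \<noteq> j" by (auto simp: ps2_two)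
      have AB: "(A, B) = (PX, PY) \<or> (A, B) = (PY, PX)" using *(1) by (auto simp: a2_def)
      have "(\<Prod>k<n. if two A B i j k = PY then -1 else (1::complex)) =
          (if A = PY then -1 else 1) * (if B = PY then -1 else 1)"
        unfolding prod_two_points[OF *(2-4)] using *(4)
        by (subst prod.neutral) (auto simp: two_def)
      then have so: "x \<in> so (2 ^ n)" unfolding x using AB by (intro i_pstr_so) auto
      have "\<not> acomm n (two A B i j) (\<lambda>_. PZ)" using AB * by (auto simp: acomm_const_two ac_def)
      then have "pstr n (two A B i j) * ?Z = ?Z * pstr n (two A B i j)"
        by (subst pstr_commute) (auto intro!: eq_matI)
      then have "x * ?Z = ?Z * x"
        unfolding x mult_smult_distrib[OF pstr_carrier pstr_carrier]
          mult_smult_assoc_mat[OF pstr_carrier pstr_carrier] by simp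
      with so show ?case by simp
    next
      case zero
      then show ?case by (auto simp: so_iff skew_zero)
    next
      case (add x y)
      then have c: "x \<in> carrier_mat (2 ^ n) (2 ^ n)" "y \<in> carrier_mat (2 ^ n) (2 ^ n)"
        using so_carrier by blast+
      have "x + y \<in> so (2 ^ n)" using add.IH skew_add c by (auto simp: so_iff)
      then show ?case
        using add.IH by (simp add: mult_add_distrib_mat[OF pstr_carrier c] add_mult_distrib_mat[OF c pstr_carrier])
    next
      case (smult x r)
      then have c: "x \<in> carrier_mat (2 ^ n) (2 ^ n)" using so_carrier by blast
      have "complex_of_real r \<cdot>\<^sub>m x \<in> so (2 ^ n)" using smult.IH skew_smult c by (auto simp: so_iff)
      then show ?case
        using smult.IH by (simp add: mult_smult_distrib[OF pstr_carrier c] mult_smult_assoc_mat[OF c pstr_carrier])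
    next
      case (bracket x y)
      then have c: "x \<in> carrier_mat (2 ^ n) (2 ^ n)" "y \<in> carrier_mat (2 ^ n) (2 ^ n)"
        using so_carrier by blast+
      show ?case using bracket.IH so_comm comm_commutes[OF pstr_carrier[of n "\<lambda>_. PZ"] c] by auto
    qed
  qed
  interpret pauli_closed n "strs_of n (perm_alg a2 n)" by (rule pauli_closed_perm)
  have pairs: "two PX PY i j \<in> strs_of n (perm_alg a2 n)" if "i < n" "j < n" "i \<noteq> j" for i j
    by (rule perm_gen) (use that in \<open>auto simp: a2_def\<close>)
  show "?R \<subseteq> perm_alg a2 n"
  proof
    fix M
    assume "M \<in> ?R"
    then have M: "M \<in> so (2 ^ n)" "M \<in> skew (2 ^ n)" "M \<in> carrier_mat (2 ^ n) (2 ^ n)" "?Z * M = M * ?Z"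
      by (auto simp: so_iff skew_def)
    show "M \<in> perm_alg a2 n"
      unfolding perm_alg_def Lie_def
    proof (rule skew_in_lie_closure[OF M(2)])
      fix s
      assume nz: "tr (pstr n s * M) \<noteq> 0"
      have Y: "(\<Prod>k<n. if s k = PY then -1 else (1::complex)) = -1"
        using prod_Y_cases[where n = n and P = "\<lambda>k. s k = PY"] tr_symmetric_so[OF _ M(1), of s] nz by auto
      have "\<not> acomm n s (\<lambda>_. PZ)" using tr_anticommuting[OF M(3,4)] nz by blast
      then have Z: "(\<Prod>k<n. sg (s k) PZ) = 1" by (simp add: not_acomm_iff)
      \<comment> \<open>Antisymmetry forces an odd number of Y's, commuting with Z...Z forces X's
        and Y's together to be even in number, so the X's are odd as well: the two invariants of the
        combinatorial lemma.\<close>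
      have "sg A PZ = (if A = PX then -1 else 1) * (if A = PY then -1 else 1)" for A
        by (cases A) (auto simp: sg_def ac_def)
      then have "(\<Prod>k<n. if s k = PX then -1 else (1::complex)) = -1"
        using Y Z by (simp add: prod.distrib minus_equation_iff)
      with pairs Y show "s \<in> strs_of n (lie_closure (2 ^ n) ((\<cdot>\<^sub>m) \<i> ` {ps2 n A B i j |A B i j.
          (A, B) \<in> a2 \<and> i < n \<and> j < n \<and> i \<noteq> j}))"
        using odd_XY_in_closure[of s] unfolding perm_alg_def Lie_def by blast
    qed
  qed
qed

section \<open>Isomorphisms by conjugation\<close>

lemma lie_isoI:
  assumes "bij_betw f L1 L2"
    and "\<And>x y. x \<in> L1 \<Longrightarrow> y \<in> L1 \<Longrightarrow> f (x + y) = f x + f y"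
    and "\<And>r x. x \<in> L1 \<Longrightarrow> f (complex_of_real r \<cdot>\<^sub>m x) = complex_of_real r \<cdot>\<^sub>m f x"
    and "\<And>x y. x \<in> L1 \<Longrightarrow> y \<in> L1 \<Longrightarrow> f (comm x y) = comm (f x) (f y)"
  shows "L1 \<cong>\<^sub>L L2"
  unfolding lie_iso_def using assms by blast

locale conjugation =
  fixes N :: nat and V W :: "complex mat"
  assumes V [simp]: "V \<in> carrier_mat N N" and W [simp]: "W \<in> carrier_mat N N"
    and VW: "V * W = 1\<^sub>m N"
begin

lemma WV: "W * V = 1\<^sub>m N"
  by (rule mat_mult_left_right_inverse[OF V W VW])

lemmas assoc = assoc_mult_mat[of _ N N _ N _ N]

lemma conj_cancel:
  assumes "M \<in> carrier_mat N N"
  shows "W * (V * M * W) * V = M"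
proof -
  have "W * (V * M * W) * V = (W * V) * M * (W * V)"
    using assms by (simp add: assoc)
  then show ?thesis using assms by (simp add: WV)
qed

lemma conj_mult:
  assumes "x \<in> carrier_mat N N" "y \<in> carrier_mat N N"
  shows "V * (x * y) * W = (V * x * W) * (V * y * W)"
proof -
  have "(V * x * W) * (V * y * W) = V * x * (W * V) * (y * W)"
    using assms by (simp add: assoc)
  also have "\<dots> = V * (x * y) * W"
    using assms by (simp add: WV assoc)
  finally show ?thesis by simp
qed

lemma conj_comm:
  assumes "x \<in> carrier_mat N N" "y \<in> carrier_mat N N"
  shows "V * comm x y * W = comm (V * x * W) (V * y * W)"
proof -
  have "V * comm x y * W = (V * (x * y) - V * (y * x)) * W"
    unfolding comm_def using assms by (subst mult_minus_distrib_mat[of _ N N _ N]) auto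
  also have "\<dots> = V * (x * y) * W - V * (y * x) * W"
    using assms by (subst minus_mult_distrib_mat[of _ N N _ _ N]) auto
  finally show ?thesis using assms by (simp add: comm_def conj_mult)
qed

lemma conj_add:
  assumes "x \<in> carrier_mat N N" "y \<in> carrier_mat N N"
  shows "V * (x + y) * W = V * x * W + V * y * W"
proof -
  have "V * (x + y) * W = (V * x + V * y) * W"
    using assms by (subst mult_add_distrib_mat[of _ N N _ N]) auto
  also have "\<dots> = V * x * W + V * y * W"
    using assms by (intro add_mult_distrib_mat[of _ N N _ _ N]) auto
  finally show ?thesis .
qed

lemma conj_smult:
  assumes "x \<in> carrier_mat N N"
  shows "V * (c \<cdot>\<^sub>m x) * W = c \<cdot>\<^sub>m (V * x * W)"
proof -
  have "V * (c \<cdot>\<^sub>m x) * W = (c \<cdot>\<^sub>m (V * x)) * W"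
    using assms by (subst mult_smult_distrib[of _ N N _ N]) auto
  also have "\<dots> = c \<cdot>\<^sub>m (V * x * W)"
    using assms by (intro mult_smult_assoc_mat[of _ N N _ N]) auto
  finally show ?thesis .
qed

lemma conj_zero: "V * 0\<^sub>m N N * W = 0\<^sub>m N N"
  by (metis V W left_mult_zero_mat right_mult_zero_mat)

lemma conj_iso:
  assumes L: "L1 \<subseteq> carrier_mat N N" and im: "(\<lambda>M. V * M * W) ` L1 = L2"
  shows "L1 \<cong>\<^sub>L L2"
proof (rule lie_isoI[of "\<lambda>M. V * M * W"])
  have "inj_on (\<lambda>M. V * M * W) L1"
    by (rule inj_on_inverseI[of _ "\<lambda>M. W * M * V"]) (use L conj_cancel in blast)
  then show "bij_betw (\<lambda>M. V * M * W) L1 L2" using im by (simp add: bij_betw_def)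
  show "V * (x + y) * W = V * x * W + V * y * W" if "x \<in> L1" "y \<in> L1" for x y
    using that L by (intro conj_add) auto
  show "V * (complex_of_real r \<cdot>\<^sub>m x) * W = complex_of_real r \<cdot>\<^sub>m (V * x * W)" if "x \<in> L1" for r x
    using that L by (intro conj_smult) auto
  show "V * comm x y * W = comm (V * x * W) (V * y * W)" if "x \<in> L1" "y \<in> L1" for x y
    using that L by (intro conj_comm) auto
qed

lemma conj_image_eq:
  assumes "L1 \<subseteq> carrier_mat N N" "L2 \<subseteq> carrier_mat N N"
    and "\<And>M. M \<in> carrier_mat N N \<Longrightarrow> M \<in> L1 \<longleftrightarrow> V * M * W \<in> L2"
  shows "(\<lambda>M. V * M * W) ` L1 = L2"
proof
  show "(\<lambda>M. V * M * W) ` L1 \<subseteq> L2" using assms by auto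
  show "L2 \<subseteq> (\<lambda>M. V * M * W) ` L1"
  proof
    fix D
    assume D: "D \<in> L2"
    interpret inv: conjugation N W V by standard (auto simp: WV)
    have c: "D \<in> carrier_mat N N" using D assms by auto
    have "V * (W * D * V) * W = D" using inv.conj_cancel[OF c] .
    then show "D \<in> (\<lambda>M. V * M * W) ` L1"
      using D assms(3)[of "W * D * V"] c by (intro image_eqI[of _ _ "W * D * V"]) auto
  qed
qed

lemma image_lie_closure:
  assumes "S \<subseteq> carrier_mat N N"
  shows "(\<lambda>M. V * M * W) ` lie_closure N S = lie_closure N ((\<lambda>M. V * M * W) ` S)"
    and "lie_closure N S \<subseteq> carrier_mat N N"
proof -
  let ?f = "\<lambda>M. V * M * W"
  have *: "x \<in> carrier_mat N N" if "x \<in> lie_closure N S" for x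
    using that by induction (use assms in auto)
  then show "lie_closure N S \<subseteq> carrier_mat N N" by blast
  have "?f x \<in> lie_closure N (?f ` S)" if "x \<in> lie_closure N S" for x
    using that
  proof induction
    case (gen x)
    then show ?case by (intro lie_closure.gen) auto
  next
    case zero
    show ?case unfolding conj_zero by (rule lie_closure.zero)
  next
    case (add x y)
    then show ?case using * by (simp add: conj_add lie_closure.add)
  next
    case (smult x r)
    then show ?case using * by (simp add: conj_smult lie_closure.smult)
  next
    case (bracket x y)
    then show ?case using * by (simp add: conj_comm lie_closure.bracket)
  qed
  moreover have "y \<in> ?f ` lie_closure N S" if "y \<in> lie_closure N (?f ` S)" for y
    using that
  proof induction
    case (gen x)
    then show ?case by (auto intro: lie_closure.gen)
  next
    case zero
    show ?case
      by (rule image_eqI[where x = "0\<^sub>m N N"], rule conj_zero[symmetric], rule lie_closure.zero)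
  next
    case (add x y)
    then obtain x' y' where "x = ?f x'" "y = ?f y'" "x' \<in> lie_closure N S" "y' \<in> lie_closure N S" by blast
    then show ?case using * by (intro image_eqI[of _ _ "x' + y'"]) (auto simp: conj_add lie_closure.add)
  next
    case (smult x r)
    then obtain x' where "x = ?f x'" "x' \<in> lie_closure N S" by blast
    then show ?case using *
      by (intro image_eqI[of _ _ "complex_of_real r \<cdot>\<^sub>m x'"]) (auto simp: conj_smult lie_closure.smult)
  next
    case (bracket x y)
    then obtain x' y' where "x = ?f x'" "y = ?f y'" "x' \<in> lie_closure N S" "y' \<in> lie_closure N S" by blast
    then show ?case using * by (intro image_eqI[of _ _ "comm x' y'"]) (auto simp: conj_comm lie_closure.bracket)
  qed
  ultimately show "?f ` lie_closure N S = lie_closure N (?f ` S)" by blast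
qed

end

section \<open>Block-diagonal matrices\<close>

definition block :: "nat \<Rightarrow> complex mat \<Rightarrow> nat \<Rightarrow> complex mat" where
  "block K B k = mat K K (\<lambda>(a, b). B $$ (k * K + a, k * K + b))"

definition block_diag :: "nat \<Rightarrow> nat \<Rightarrow> complex mat \<Rightarrow> bool" where
  "block_diag m K B \<longleftrightarrow> (\<forall>i<m * K. \<forall>j<m * K. i div K \<noteq> j div K \<longrightarrow> B $$ (i, j) = 0)"

lemma dsum_iff:
  "B \<in> dsum m K L \<longleftrightarrow> B \<in> carrier_mat (m * K) (m * K) \<and> block_diag m K B \<and> (\<forall>k<m. block K B k \<in> L)"
  by (simp add: dsum_def block_def block_diag_def)

lemma block_index_less: "k < m \<Longrightarrow> a < K \<Longrightarrow> k * K + a < m * (K::nat)"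
proof -
  assume "k < m" "a < K"
  then have "k * K + a < Suc k * K" "Suc k * K \<le> m * K" using mult_le_mono1[of "Suc k" m K] by auto
  then show ?thesis by linarith
qed

lemma block_indexE:
  assumes "i < m * (K::nat)"
  obtains k a where "k < m" "a < K" "i = k * K + a"
proof
  have "K > 0" using assms by (cases K) auto
  then show "i div K < m" "i mod K < K" "i = i div K * K + i mod K"
    using assms by (auto simp: less_mult_imp_div_less)
qed

lemma sum_blocks:
  fixes f :: "nat \<Rightarrow> complex"
  shows "(\<Sum>i<m * K. f i) = (\<Sum>k<m. \<Sum>a<K. f (k * K + a))"
proof (induction m)
  case 0
  then show ?case by simp
next
  case (Suc m)
  have "(\<Sum>i<Suc m * K. f i) = (\<Sum>i<m * K. f i) + (\<Sum>i\<in>{m * K..<m * K + K}. f i)"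
    by (subst sum.union_disjoint[symmetric]) (auto simp: ivl_disj_un add.commute intro!: sum.cong)
  also have "(\<Sum>i\<in>{m * K..<m * K + K}. f i) = (\<Sum>a<K. f (m * K + a))"
    using sum.shift_bounds_nat_ivl[of f 0 "m * K" K] by (simp add: lessThan_atLeast0 add.commute)
  finally show ?case using Suc by simp
qed

lemma skew_blocks:
  assumes "B \<in> carrier_mat (m * K) (m * K)" "block_diag m K B"
  shows "B \<in> skew (m * K) \<longleftrightarrow> (\<forall>k<m. block K B k \<in> skew K)"
proof
  assume B: "B \<in> skew (m * K)"
  show "\<forall>k<m. block K B k \<in> skew K"
  proof (intro allI impI)
    fix k
    assume "k < m"
    have h: "\<forall>i<m * K. \<forall>j<m * K. B $$ (i, j) = - cnj (B $$ (j, i))"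
      using B unfolding skew_iff by (rule conjunct2)
    have "block K B k $$ (a, b) = - cnj (block K B k $$ (b, a))" if "a < K" "b < K" for a b
    proof -
      have *: "block K B k $$ (a, b) = B $$ (k * K + a, k * K + b)" "block K B k $$ (b, a) = B $$ (k * K + b, k * K + a)"
        using that by (simp_all add: block_def)
      show ?thesis
        unfolding * by (rule h[rule_format]) (use block_index_less \<open>k < m\<close> that in blast)+
    qed
    then show "block K B k \<in> skew K"
      unfolding skew_iff by (intro conjI) (simp add: block_def, blast)
  qed
next
  assume h: "\<forall>k<m. block K B k \<in> skew K"
  have "B $$ (i, j) = - cnj (B $$ (j, i))" if ij: "i < m * K" "j < m * K" for i j
  proof (cases "i div K = j div K")
    case True
    obtain k a where i: "k < m" "a < K" "i = k * K + a" using block_indexE ij(1) by blast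
    obtain l b where j: "l < m" "b < K" "j = l * K + b" using block_indexE ij(2) by blast
    have "l = k" using True i j by simp
    have "block K B k \<in> skew K" using h i(1) by blast
    then have "block K B k $$ (a, b) = - cnj (block K B k $$ (b, a))"
      using i(2) j(2) unfolding skew_iff by blast
    then show ?thesis using i j \<open>l = k\<close> by (simp add: block_def)
  next
    case False
    then have "B $$ (i, j) = 0" "B $$ (j, i) = 0"
      using assms(2) ij unfolding block_diag_def by metis+
    then show ?thesis by simp
  qed
  then show "B \<in> skew (m * K)" unfolding skew_iff using assms(1) by blast
qed

lemma dsum_so_iff:
  "B \<in> dsum m K (so K) \<longleftrightarrow> B \<in> so (m * K) \<and> block_diag m K B"
proof -
  have "(\<forall>k<m. \<forall>a<K. \<forall>b<K. block K B k $$ (a, b) \<in> \<real>) \<longleftrightarrow> (\<forall>i<m * K. \<forall>j<m * K. B $$ (i, j) \<in> \<real>)"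
    if bd: "block_diag m K B"
  proof
    assume h: "\<forall>k<m. \<forall>a<K. \<forall>b<K. block K B k $$ (a, b) \<in> \<real>"
    show "\<forall>i<m * K. \<forall>j<m * K. B $$ (i, j) \<in> \<real>"
    proof (intro allI impI)
      fix i j
      assume ij: "i < m * K" "j < m * K"
      obtain k a where i: "k < m" "a < K" "i = k * K + a" using block_indexE ij(1) by blast
      obtain l b where j: "l < m" "b < K" "j = l * K + b" using block_indexE ij(2) by blast
      show "B $$ (i, j) \<in> \<real>"
      proof (cases "l = k")
        case True
        have "block K B k $$ (a, b) \<in> \<real>" using h i j by blast
        then show ?thesis using i j True by (simp add: block_def)
      next
        case False
        then have "B $$ (i, j) = 0" using bd ij i j unfolding block_diag_def by auto
        then show ?thesis by simp
      qed
    qed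
  next
    assume h: "\<forall>i<m * K. \<forall>j<m * K. B $$ (i, j) \<in> \<real>"
    show "\<forall>k<m. \<forall>a<K. \<forall>b<K. block K B k $$ (a, b) \<in> \<real>"
      using h block_index_less by (auto simp: block_def)
  qed
  then show ?thesis
    unfolding dsum_iff so_iff using skew_blocks[of B m K] by (auto simp: skew_def)
qed

definition diagm :: "nat \<Rightarrow> nat \<Rightarrow> (nat \<Rightarrow> complex) \<Rightarrow> complex mat" where
  "diagm m K \<chi> = mat (m * K) (m * K) (\<lambda>(i, j). if i = j then \<chi> (i div K) else 0)"

lemma diagm_carrier [simp]: "diagm m K \<chi> \<in> carrier_mat (m * K) (m * K)"
  by (simp add: diagm_def)

lemma diagm_mult_index:
  assumes "B \<in> carrier_mat (m * K) N" "i < m * K" "j < N"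
  shows "(diagm m K \<chi> * B) $$ (i, j) = \<chi> (i div K) * B $$ (i, j)"
proof -
  have "(diagm m K \<chi> * B) $$ (i, j) = (\<Sum>c<m * K. if c = i then \<chi> (i div K) * B $$ (i, j) else 0)"
    unfolding mult_mat_index[OF diagm_carrier assms]
    using assms by (intro sum.cong) (auto simp: diagm_def)
  then show ?thesis using assms by simp
qed

lemma mult_diagm_index:
  assumes "B \<in> carrier_mat N (m * K)" "i < N" "j < m * K"
  shows "(B * diagm m K \<chi>) $$ (i, j) = B $$ (i, j) * \<chi> (j div K)"
proof -
  have "(B * diagm m K \<chi>) $$ (i, j) = (\<Sum>c<m * K. if c = j then B $$ (i, j) * \<chi> (j div K) else 0)"
    unfolding mult_mat_index[OF assms(1) diagm_carrier assms(2,3)]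
    using assms by (intro sum.cong) (auto simp: diagm_def)
  then show ?thesis using assms by simp
qed

text \<open>Commuting with q multiplies the (i, j) entry by the difference of the eigenvalues of the
  two blocks. Once every two blocks are separated by some q, exactly the block-diagonal matrices
  remain.\<close>

lemma commute_diagm_iff:
  assumes B: "B \<in> carrier_mat (m * K) (m * K)"
    and sep: "\<And>k l. k < m \<Longrightarrow> l < m \<Longrightarrow> k \<noteq> l \<Longrightarrow> \<exists>q\<in>Q. \<chi> q k \<noteq> \<chi> q l"
  shows "(\<forall>q\<in>Q. diagm m K (\<chi> q) * B = B * diagm m K (\<chi> q)) \<longleftrightarrow> block_diag m K B"
proof
  assume h: "\<forall>q\<in>Q. diagm m K (\<chi> q) * B = B * diagm m K (\<chi> q)"
  show "block_diag m K B"
    unfolding block_diag_def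
  proof (intro allI impI)
    fix i j
    assume ij: "i < m * K" "j < m * K" "i div K \<noteq> j div K"
    then have "i div K < m" "j div K < m" by (simp_all add: less_mult_imp_div_less)
    with sep ij obtain q where q: "q \<in> Q" "\<chi> q (i div K) \<noteq> \<chi> q (j div K)" by blast
    have "\<chi> q (i div K) * B $$ (i, j) = B $$ (i, j) * \<chi> q (j div K)"
      using h q(1) ij(1,2) by (metis diagm_mult_index[OF B] mult_diagm_index[OF B])
    then have "(\<chi> q (i div K) - \<chi> q (j div K)) * B $$ (i, j) = 0"
      by (simp add: algebra_simps)
    then show "B $$ (i, j) = 0" using q(2) by simp
  qed
next
  assume bd: "block_diag m K B"
  show "\<forall>q\<in>Q. diagm m K (\<chi> q) * B = B * diagm m K (\<chi> q)"
  proof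
    fix q
    show "diagm m K (\<chi> q) * B = B * diagm m K (\<chi> q)"
    proof (rule eq_matI)
      fix i j
      assume "i < dim_row (B * diagm m K (\<chi> q))" "j < dim_col (B * diagm m K (\<chi> q))"
      then have ij: "i < m * K" "j < m * K" using B by (auto simp: diagm_def)
      show "(diagm m K (\<chi> q) * B) $$ (i, j) = (B * diagm m K (\<chi> q)) $$ (i, j)"
        unfolding diagm_mult_index[OF B ij] mult_diagm_index[OF B ij]
        using bd ij unfolding block_diag_def by (cases "i div K = j div K") auto
    qed (use B in \<open>auto simp: diagm_def\<close>)
  qed
qed

lemma tr_diagm:
  assumes B: "B \<in> carrier_mat (m * K) (m * K)"
  shows "tr (diagm m K \<chi> * B) = (\<Sum>k<m. \<chi> k * tr (block K B k))"
proof -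
  have "tr (diagm m K \<chi> * B) = (\<Sum>i<m * K. \<chi> (i div K) * B $$ (i, i))"
  proof -
    have "dim_row (diagm m K \<chi> * B) = m * K" by (simp add: diagm_def)
    then show ?thesis
      unfolding tr_def using B
      by (intro sum.cong) (simp_all add: diagm_mult_index[OF B] del: index_mult_mat(1))
  qed
  also have "\<dots> = (\<Sum>k<m. \<chi> k * tr (block K B k))"
    unfolding sum_blocks by (intro sum.cong) (auto simp: tr_def block_def sum_distrib_left)
  finally show ?thesis .
qed

locale unitary =
  fixes N :: nat and V :: "complex mat"
  assumes V_carrier: "V \<in> carrier_mat N N" and unitary: "V * dag V = 1\<^sub>m N"

sublocale unitary \<subseteq> conjugation N V "dag V"
  by standard (auto simp: V_carrier unitary)

context unitary
begin

lemma conj_skew_iff: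
  assumes M: "M \<in> carrier_mat N N"
  shows "V * M * dag V \<in> skew N \<longleftrightarrow> M \<in> skew N"
proof -
  have *: "V * M * dag V \<in> skew N"
    if V: "V \<in> carrier_mat N N" and M: "M \<in> skew N" for V M
  proof -
    have c: "M \<in> carrier_mat N N" and d: "dag M = - M" using M by (auto simp: skew_def)
    have "dag (V * M * dag V) = V * (dag M * dag V)"
      using V c by (simp add: dag_mult[of _ N N _ N])
    also have "V * (dag M * dag V) = - (V * (M * dag V))"
    proof -
      have dims: "dim_row (dag V) = N" "dim_col M = N" "dim_row M = N" "dim_col V = N"
        using V c by (auto simp: dag_def)
      have "dag M * dag V = - (M * dag V)" unfolding d by (intro uminus_mult_left_mat) (simp add: dims)
      moreover have "V * - (M * dag V) = - (V * (M * dag V))" by (intro uminus_mult_right_mat) (simp add: dims)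
      ultimately show ?thesis by simp
    qed
    also have "V * (M * dag V) = V * M * dag V"
      using V c by (intro assoc_mult_mat[symmetric, of _ N N _ N _ N]) auto
    finally show ?thesis using V c by (simp add: skew_def)
  qed
  have "dag V * (V * M * dag V) * dag (dag V) \<in> skew N" if "V * M * dag V \<in> skew N"
    using *[of "dag V" "V * M * dag V"] that by simp
  then show ?thesis using * conj_cancel[OF M] M by auto
qed

lemma conj_commute_iff:
  assumes M: "M \<in> carrier_mat N N" and P: "P \<in> carrier_mat N N" and D: "D \<in> carrier_mat N N"
    and VP: "V * P = D * V"
  shows "P * M = M * P \<longleftrightarrow> D * (V * M * dag V) = (V * M * dag V) * D"
    and "tr (P * M) = tr (D * (V * M * dag V))"
proof -
  let ?B = "V * M * dag V"
  have B: "?B \<in> carrier_mat N N" using M by simp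
  have DVPW: "V * P * dag V = D"
    unfolding VP using D by (simp add: assoc unitary)
  have PM: "V * (P * M) * dag V = D * ?B"
    using conj_mult[OF P M] DVPW by simp
  have MP: "V * (M * P) * dag V = ?B * D"
    using conj_mult[OF M P] DVPW by simp
  show "P * M = M * P \<longleftrightarrow> D * ?B = ?B * D"
    using PM MP conj_cancel[of "P * M"] conj_cancel[of "M * P"] M P by (metis mult_carrier_square)
  have "tr (D * ?B) = tr (dag V * (V * (P * M)))"
    unfolding PM[symmetric] using M P by (intro tr_comm[of _ N N]) auto
  also have "dag V * (V * (P * M)) = dag V * V * (P * M)"
    using M P by (intro assoc[symmetric]) auto
  also have "\<dots> = P * M" unfolding WV using M P by simp
  finally show "tr (P * M) = tr (D * ?B)" by simp
qed

end

text \<open>V diagonalises all strings in Q at once, with eigenvalue \<open>\<chi> q k\<close> on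
  block k. Separation of the eigenvalue systems turns commutation into block-diagonality; their
  independence turns the trace conditions, which are linear in the block traces, into tracelessness
  of each block.\<close>

lemma commutant_iso_dsum:
  assumes V: "V \<in> carrier_mat (2 ^ n) (2 ^ n)" "V * dag V = 1\<^sub>m (2 ^ n)" and N: "m * K = 2 ^ n"
    and VP: "\<And>q. q \<in> Q \<Longrightarrow> V * pstr n q = diagm m K (\<chi> q) * V"
    and sep: "\<And>k l. k < m \<Longrightarrow> l < m \<Longrightarrow> k \<noteq> l \<Longrightarrow> \<exists>q\<in>Q. \<chi> q k \<noteq> \<chi> q l"
    and indep: "\<And>t k. \<forall>q\<in>Q. (\<Sum>k<m. \<chi> q k * t k) = 0 \<Longrightarrow> k < m \<Longrightarrow> t k = (0::complex)"
  shows "commutant n Q \<cong>\<^sub>L dsum m K (su K)"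
proof -
  interpret unitary "2 ^ n" V by standard (fact V)+
  have dc: "diagm m K \<chi> \<in> carrier_mat (2 ^ n) (2 ^ n)" for \<chi> using diagm_carrier[of m K \<chi>] N by simp
  show ?thesis
  proof (rule conj_iso[OF _ conj_image_eq])
    show "commutant n Q \<subseteq> carrier_mat (2 ^ n) (2 ^ n)" by (auto simp: commutant_def skew_def)
    then show "commutant n Q \<subseteq> carrier_mat (2 ^ n) (2 ^ n)" .
    show "dsum m K (su K) \<subseteq> carrier_mat (2 ^ n) (2 ^ n)" using N by (auto simp: dsum_iff)
    fix M :: "complex mat"
    assume M: "M \<in> carrier_mat (2 ^ n) (2 ^ n)"
    define B where "B = V * M * dag V"
    have B: "B \<in> carrier_mat (m * K) (m * K)" "B \<in> carrier_mat (2 ^ n) (2 ^ n)" unfolding B_def N using M by simp_all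
    have "M \<in> commutant n Q \<longleftrightarrow> B \<in> skew (2 ^ n) \<and> (\<forall>q\<in>Q. diagm m K (\<chi> q) * B = B * diagm m K (\<chi> q))
        \<and> (\<forall>q\<in>Q. tr (diagm m K (\<chi> q) * B) = 0)"
      unfolding commutant_def mem_Collect_eq B_def
      using conj_skew_iff[OF M] conj_commute_iff[OF M pstr_carrier dc VP] by auto
    also have "\<dots> \<longleftrightarrow> B \<in> skew (m * K) \<and> block_diag m K B \<and> (\<forall>q\<in>Q. tr (diagm m K (\<chi> q) * B) = 0)"
      using commute_diagm_iff[OF B(1) sep] N by simp
    also have "(\<forall>q\<in>Q. tr (diagm m K (\<chi> q) * B) = 0) \<longleftrightarrow> (\<forall>k<m. tr (block K B k) = 0)"
      unfolding tr_diagm[OF B(1)] using indep[of "\<lambda>k. tr (block K B k)"] by auto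
    also have "B \<in> skew (m * K) \<and> block_diag m K B \<and> (\<forall>k<m. tr (block K B k) = 0) \<longleftrightarrow> B \<in> dsum m K (su K)"
      unfolding dsum_iff su_iff using skew_blocks[OF B(1)] B(1) by auto
    finally show "M \<in> commutant n Q \<longleftrightarrow> V * M * dag V \<in> dsum m K (su K)" unfolding B_def .
  qed
qed

section \<open>Splitting by parity\<close>

text \<open>A new top bit is appended so that the parity sign of the longer index becomes
  \<open>k\<close>. It enumerates the basis states of one parity by their lower bits.\<close>

definition pemb :: "nat \<Rightarrow> complex \<Rightarrow> nat \<Rightarrow> nat" where
  "pemb m k a = (if zsgn m a = k then a else a + 2 ^ m)"

lemma pemb_less: "a < 2 ^ m \<Longrightarrow> pemb m k a < 2 ^ Suc m"
  by (simp add: pemb_def)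

lemma zsgn_pemb: "a < 2 ^ m \<Longrightarrow> k = 1 \<or> k = -1 \<Longrightarrow> zsgn (Suc m) (pemb m k a) = k"
  using zsgn_cases[of m a] by (auto simp: pemb_def zsgn_low zsgn_high)

lemma pemb_eq_iff:
  assumes "a < 2 ^ m" "b < 2 ^ m" "k = 1 \<or> k = -1" "l = 1 \<or> l = -1"
  shows "pemb m k a = pemb m l b \<longleftrightarrow> k = l \<and> a = b"
proof
  assume eq: "pemb m k a = pemb m l b"
  then have "k = l" using zsgn_pemb assms by metis
  moreover have "a = b" using eq assms(1,2) by (auto simp: pemb_def split: if_splits)
  ultimately show "k = l \<and> a = b" by simp
qed simp

lemma pemb_mod:
  assumes "c < 2 ^ Suc m" "zsgn (Suc m) c = k"
  shows "pemb m k (c mod 2 ^ m) = c"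
proof (cases "c < 2 ^ m")
  case True
  then show ?thesis using assms by (simp add: pemb_def zsgn_low)
next
  case False
  define d where "d = c - 2 ^ m"
  have d: "c = d + 2 ^ m" "d < 2 ^ m" using False assms(1) by (auto simp: d_def)
  have "zsgn m d = - k" using assms(2) d by (metis zsgn_high minus_minus)
  moreover have "k \<noteq> 0" using assms(2) zsgn_cases[of "Suc m" c] by auto
  ultimately show ?thesis using d by (auto simp: pemb_def)
qed

definition psign :: "nat \<Rightarrow> complex" where
  "psign k = (if even k then 1 else -1)"

lemma psign_cases: "psign k = 1 \<or> psign k = -1"
  by (simp add: psign_def)

text \<open>The permutation matrix that sorts the basis states by parity: even ones in block 0, odd
  ones in block 1.\<close>

definition parity_perm :: "nat \<Rightarrow> complex mat" where
  "parity_perm m = mat (2 * 2 ^ m) (2 * 2 ^ m)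
     (\<lambda>(i, a). if a = pemb m (psign (i div 2 ^ m)) (i mod 2 ^ m) then 1 else 0)"

lemma parity_perm_carrier [simp]:
  "parity_perm m \<in> carrier_mat (2 ^ Suc m) (2 ^ Suc m)"
  "parity_perm m \<in> carrier_mat (2 * 2 ^ m) (2 * 2 ^ m)"
  by (simp_all add: parity_perm_def)

lemma parity_perm_unitary: "parity_perm m * dag (parity_perm m) = 1\<^sub>m (2 ^ Suc m)"
proof (rule eq_matI)
  fix i j
  assume "i < dim_row (1\<^sub>m (2 ^ Suc m))" "j < dim_col (1\<^sub>m (2 ^ Suc m))"
  then have ij: "i < 2 ^ Suc m" "j < 2 ^ Suc m" by auto
  let ?p = "\<lambda>i. pemb m (psign (i div 2 ^ m)) (i mod 2 ^ m)"
  have p: "?p i < 2 ^ Suc m" by (intro pemb_less) simp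
  have "(parity_perm m * dag (parity_perm m)) $$ (i, j)
      = (\<Sum>a<2 ^ Suc m. parity_perm m $$ (i, a) * dag (parity_perm m) $$ (a, j))"
    using ij by (intro mult_mat_index) auto
  also have "\<dots> = (\<Sum>a<2 ^ Suc m. if a = ?p i then if ?p i = ?p j then 1 else 0 else 0)"
    using ij by (intro sum.cong) (auto simp: parity_perm_def dag_def)
  also have "\<dots> = (if ?p i = ?p j then 1 else 0)" using p by simp
  also have "?p i = ?p j \<longleftrightarrow> i = j"
  proof
    assume "?p i = ?p j"
    then have *: "psign (i div 2 ^ m) = psign (j div 2 ^ m)" "i mod 2 ^ m = j mod 2 ^ m"
      using pemb_eq_iff psign_cases by auto
    have "i div 2 ^ m < 2" "j div 2 ^ m < 2" using ij by (auto simp: less_mult_imp_div_less)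
    then have "i div 2 ^ m = j div 2 ^ m" using *(1) by (auto simp: psign_def dest!: less_2_cases)
    then show "i = j" using *(2) by (metis div_mult_mod_eq)
  qed simp
  finally show "(parity_perm m * dag (parity_perm m)) $$ (i, j) = 1\<^sub>m (2 ^ Suc m) $$ (i, j)"
    using ij by simp
qed (simp_all add: dag_def parity_perm_def)

lemma parity_perm_PZ:
  "parity_perm m * pstr (Suc m) (\<lambda>_. PZ) = diagm 2 (2 ^ m) psign * parity_perm m"
proof (rule eq_matI)
  fix i a
  assume "i < dim_row (diagm 2 (2 ^ m) psign * parity_perm m)" "a < dim_col (diagm 2 (2 ^ m) psign * parity_perm m)"
  then have ia: "i < 2 ^ Suc m" "a < 2 ^ Suc m" "i < 2 * 2 ^ m" by (auto simp: parity_perm_def diagm_def)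
  have "parity_perm m $$ (i, a) * zsgn (Suc m) a = psign (i div 2 ^ m) * parity_perm m $$ (i, a)"
    using ia zsgn_pemb[of "i mod 2 ^ m" m "psign (i div 2 ^ m)"] psign_cases[of "i div 2 ^ m"]
    by (auto simp: parity_perm_def)
  then show "(parity_perm m * pstr (Suc m) (\<lambda>_. PZ)) $$ (i, a) = (diagm 2 (2 ^ m) psign * parity_perm m) $$ (i, a)"
    using mult_PZ_index[OF parity_perm_carrier(1) ia(1,2)]
      diagm_mult_index[of "parity_perm m" 2 "2 ^ m" "2 ^ Suc m" i a psign] ia by simp
qed (simp_all add: parity_perm_def diagm_def)

lemma psign_separates: "k < 2 \<Longrightarrow> l < 2 \<Longrightarrow> k \<noteq> l \<Longrightarrow> psign k \<noteq> psign l"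
  by (auto simp: psign_def dest!: less_2_cases)

theorem commutant_Z_iso:
  "commutant (Suc m) {\<lambda>_. PI, \<lambda>_. PZ} \<cong>\<^sub>L dsum 2 (2 ^ m) (su (2 ^ m))"
proof (rule commutant_iso_dsum[where V = "parity_perm m" and
      \<chi> = "\<lambda>q k. if q = (\<lambda>_. PI) then 1 else psign k"])
  show "parity_perm m * pstr (Suc m) q = diagm 2 (2 ^ m) (\<lambda>k. if q = (\<lambda>_. PI) then 1 else psign k) * parity_perm m"
    if q: "q \<in> {\<lambda>_. PI, \<lambda>_. PZ}" for q
  proof (cases "q = (\<lambda>_. PI)")
    case True
    have "diagm 2 (2 ^ m) (\<lambda>k. 1) = 1\<^sub>m (2 ^ Suc m)" by (intro eq_matI) (auto simp: diagm_def)
    then show ?thesis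
      using True right_mult_one_mat[OF parity_perm_carrier(1)[of m]] left_mult_one_mat[OF parity_perm_carrier(1)[of m]]
      by (simp add: pstr_PI)
  next
    case False
    then have "q = (\<lambda>_. PZ)" using q by auto
    then show ?thesis using parity_perm_PZ False by simp
  qed
next
  fix k l :: nat
  assume "k < 2" "l < 2" "k \<noteq> l"
  then have "psign k \<noteq> psign l" by (rule psign_separates)
  then show "\<exists>q\<in>{\<lambda>_. PI, \<lambda>_. PZ}. (if q = (\<lambda>_. PI) then 1 else psign k) \<noteq> (if q = (\<lambda>_. PI) then 1 else psign l)"
    by (intro bexI[of _ "\<lambda>_. PZ"]) (auto simp: fun_eq_iff)
next
  fix t :: "nat \<Rightarrow> complex" and k :: nat
  assume h: "\<forall>q\<in>{\<lambda>_. PI, \<lambda>_. PZ}. (\<Sum>k<2. (if q = (\<lambda>_. PI) then 1 else psign k) * t k) = 0" and k: "k < 2"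
  have "t 0 + t 1 = 0" "t 0 - t 1 = 0"
    using bspec[OF h, of "\<lambda>_. PI"] bspec[OF h, of "\<lambda>_. PZ"]
    by (simp_all add: numeral_2_eq_2 psign_def fun_eq_iff)
  then show "t k = 0" using k by (auto dest!: less_2_cases simp: algebra_simps)
qed (simp_all add: parity_perm_unitary del: power_Suc, simp)

text \<open>The basis change is a permutation matrix, so it and its inverse are real and conjugation
  preserves reality as well as skewness.\<close>

theorem so_Z_iso:
  "{g \<in> so (2 ^ Suc m). g * pstr (Suc m) (\<lambda>_. PZ) = pstr (Suc m) (\<lambda>_. PZ) * g}
     \<cong>\<^sub>L dsum 2 (2 ^ m) (so (2 ^ m))" (is "?L \<cong>\<^sub>L _")
proof -
  let ?V = "parity_perm m"
  interpret unitary "2 ^ Suc m" ?V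
    by standard (simp_all add: parity_perm_unitary del: power_Suc)
  have dc: "diagm 2 (2 ^ m) \<chi> \<in> carrier_mat (2 ^ Suc m) (2 ^ Suc m)" for \<chi> by (simp add: diagm_def)
  have real: "\<forall>i<2 ^ Suc m. \<forall>j<2 ^ Suc m. ?V $$ (i, j) \<in> \<real>" "\<forall>i<2 ^ Suc m. \<forall>j<2 ^ Suc m. dag ?V $$ (i, j) \<in> \<real>"
    by (auto simp: parity_perm_def dag_def)
  have V: "?V \<in> carrier_mat (2 ^ Suc m) (2 ^ Suc m)" "dag ?V \<in> carrier_mat (2 ^ Suc m) (2 ^ Suc m)"
    by simp_all
  have realI: "\<forall>i<2 ^ Suc m. \<forall>j<2 ^ Suc m. (A * M * B) $$ (i, j) \<in> \<real>"
    if "A \<in> carrier_mat (2 ^ Suc m) (2 ^ Suc m)" "M \<in> carrier_mat (2 ^ Suc m) (2 ^ Suc m)"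
      "B \<in> carrier_mat (2 ^ Suc m) (2 ^ Suc m)" "\<forall>i<2 ^ Suc m. \<forall>j<2 ^ Suc m. A $$ (i, j) \<in> \<real>"
      "\<forall>i<2 ^ Suc m. \<forall>j<2 ^ Suc m. M $$ (i, j) \<in> \<real>" "\<forall>i<2 ^ Suc m. \<forall>j<2 ^ Suc m. B $$ (i, j) \<in> \<real>"
    for A M B
    by (rule real_mult_index[OF mult_carrier_square[OF that(1,2)] that(3) real_mult_index[OF that(1,2,4,5)] that(6)])
  show ?thesis
  proof (rule conj_iso[OF _ conj_image_eq])
    show "?L \<subseteq> carrier_mat (2 ^ Suc m) (2 ^ Suc m)" using so_carrier by blast
    then show "?L \<subseteq> carrier_mat (2 ^ Suc m) (2 ^ Suc m)" .
    show "dsum 2 (2 ^ m) (so (2 ^ m)) \<subseteq> carrier_mat (2 ^ Suc m) (2 ^ Suc m)" by (auto simp: dsum_iff)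
    fix M :: "complex mat"
    assume M: "M \<in> carrier_mat (2 ^ Suc m) (2 ^ Suc m)"
    define B where "B = ?V * M * dag ?V"
    have B: "B \<in> carrier_mat (2 ^ Suc m) (2 ^ Suc m)" "B \<in> carrier_mat (2 * 2 ^ m) (2 * 2 ^ m)"
      unfolding B_def using mult_carrier_square[OF mult_carrier_square[OF V(1) M] V(2)] by simp_all
    have MB: "M = dag ?V * B * ?V" unfolding B_def using conj_cancel[OF M] by simp
    have so: "M \<in> so (2 ^ Suc m) \<longleftrightarrow> B \<in> so (2 ^ Suc m)"
    proof
      assume "M \<in> so (2 ^ Suc m)"
      then show "B \<in> so (2 ^ Suc m)"
        using conj_skew_iff[OF M] realI[OF V(1) M V(2) real(1) _ real(2)] unfolding so_iff B_def by blast
    next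
      assume "B \<in> so (2 ^ Suc m)"
      then show "M \<in> so (2 ^ Suc m)"
        using conj_skew_iff[OF M] realI[OF V(2) B(1) V(1) real(2) _ real(1)] unfolding so_iff MB[symmetric] B_def[symmetric] by blast
    qed
    have "(M * pstr (Suc m) (\<lambda>_. PZ) = pstr (Suc m) (\<lambda>_. PZ) * M)
        \<longleftrightarrow> diagm 2 (2 ^ m) psign * B = B * diagm 2 (2 ^ m) psign"
      using conj_commute_iff(1)[OF M pstr_carrier dc parity_perm_PZ] unfolding B_def by auto
    also have "\<dots> \<longleftrightarrow> block_diag 2 (2 ^ m) B"
      using commute_diagm_iff[OF B(2), of "{()}" "\<lambda>_. psign"] psign_separates by simp
    finally show "M \<in> ?L \<longleftrightarrow> ?V * M * dag ?V \<in> dsum 2 (2 ^ m) (so (2 ^ m))"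
      unfolding dsum_so_iff B_def[symmetric] using so by simp
  qed
qed

section \<open>Splitting by parity and complementation\<close>

text \<open>The eigenvalue of X...X on block k, as \<open>psign k\<close> is that of Z...Z. The
  blocks 0, 1, 2, 3 run through the four pairs of signs.\<close>

definition esign :: "nat \<Rightarrow> complex" where
  "esign k = (if k < 2 then 1 else -1)"

lemma esign_square [simp]: "esign k * esign k = 1" "esign k * (esign k * x) = x"
  by (simp_all add: esign_def)

text \<open>Of m + 2 bits the top one is left zero, so that each complementary pair of states has
  one representative; the next bit adjusts the parity to the block.\<close>

definition bell_index :: "nat \<Rightarrow> nat \<Rightarrow> nat" where
  "bell_index m i = pemb m (psign (i div 2 ^ m)) (i mod 2 ^ m)"

definition delta :: "nat \<Rightarrow> nat \<Rightarrow> complex" where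
  "delta x a = (if a = x then 1 else 0)"

text \<open>The rows are the vectors (|c> + |c'>)/sqrt 2 and (|c> - |c'>)/sqrt 2, where c' is the bitwise
  complement of c and the top bit of c vanishes: they diagonalise all the strings Z...Z and X...X
  simultaneously.\<close>

definition bell :: "nat \<Rightarrow> complex mat" where
  "bell m = mat (4 * 2 ^ m) (4 * 2 ^ m) (\<lambda>(i, a). complex_of_real (1 / sqrt 2) *
     (delta (bell_index m i) a + esign (i div 2 ^ m) * delta (cpl (m + 2) (bell_index m i)) a))"

lemma bell_carrier [simp]: "bell m \<in> carrier_mat (2 ^ (m + 2)) (2 ^ (m + 2))"
  by (simp add: bell_def)

lemma bell_index_less: "bell_index m i < 2 ^ (m + 1)"
  using pemb_less[of "i mod 2 ^ m" m] by (simp add: bell_index_def)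

lemma bell_index_less': "bell_index m i < 2 ^ (m + 2)"
  using bell_index_less[of m i] by simp

lemma cpl_bell_index: "2 ^ (m + 1) \<le> cpl (m + 2) (bell_index m i)"
  using bell_index_less[of m i] by (simp add: cpl_def)

lemma zsgn_bell_index: "zsgn (m + 2) (bell_index m i) = psign (i div 2 ^ m)"
  using zsgn_pemb[of "i mod 2 ^ m" m "psign (i div 2 ^ m)"] psign_cases zsgn_low[of "bell_index m i" "Suc m"]
    bell_index_less[of m i] by (simp add: bell_index_def)

lemma sign_pair_inj:
  assumes "k < 4" "l < 4" "psign k = psign l" "esign k = esign l"
  shows "k = l"
proof -
  have "k \<in> {0, 1, 2, 3}" "l \<in> {0, 1, 2, 3}" using assms by auto
  then show ?thesis using assms(3,4) by (auto simp: psign_def esign_def)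
qed

lemma sum_delta: "x < N \<Longrightarrow> (\<Sum>a<N. delta x a * delta y a) = delta x y"
proof -
  assume "x < N"
  have "(\<Sum>a<N. delta x a * delta y a) = (\<Sum>a<N. if a = x then delta x y else 0)"
    by (intro sum.cong) (auto simp: delta_def)
  then show ?thesis using \<open>x < N\<close> by simp
qed

lemma bell_unitary: "bell m * dag (bell m) = 1\<^sub>m (2 ^ (m + 2))"
proof (rule eq_matI)
  fix i j
  assume "i < dim_row (1\<^sub>m (2 ^ (m + 2)))" "j < dim_col (1\<^sub>m (2 ^ (m + 2)))"
  then have ij: "i < 2 ^ (m + 2)" "j < 2 ^ (m + 2)" "i < 4 * 2 ^ m" "j < 4 * 2 ^ m" by auto
  let ?N = "2 ^ (m + 2) :: nat"
  let ?c = "bell_index m"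
  let ?e = "\<lambda>i. esign (i div 2 ^ m)"
  let ?d = "\<lambda>i. cpl (m + 2) (?c i)"
  have lt: "?c i < ?N" "?d i < ?N" for i by (rule bell_index_less', rule cpl_less)
  have rr: "complex_of_real (1 / sqrt 2) * complex_of_real (1 / sqrt 2) = 1 / 2"
    unfolding of_real_mult[symmetric] by simp
  have "(bell m * dag (bell m)) $$ (i, j) = (\<Sum>a<?N. bell m $$ (i, a) * dag (bell m) $$ (a, j))"
    by (rule mult_mat_index[OF bell_carrier dag_carrier[OF bell_carrier] ij(1,2)])
  also have "\<dots> = (\<Sum>a<?N. 1 / 2 * (delta (?c i) a * delta (?c j) a + ?e j * (delta (?c i) a * delta (?d j) a)
      + ?e i * (delta (?d i) a * delta (?c j) a) + ?e i * ?e j * (delta (?d i) a * delta (?d j) a)))"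
  proof (intro sum.cong refl)
    fix a
    assume "a \<in> {..<?N}"
    then have a: "a < 4 * 2 ^ m" by simp
    have r: "cnj (delta x y) = delta x y" "cnj (esign k) = esign k" for x y k by (simp_all add: delta_def esign_def)
    have "dag (bell m) $$ (a, j) = complex_of_real (1 / sqrt 2) * (delta (?c j) a + ?e j * delta (?d j) a)"
      using a ij by (simp add: dag_def bell_def r)
    moreover have "bell m $$ (i, a) = complex_of_real (1 / sqrt 2) * (delta (?c i) a + ?e i * delta (?d i) a)"
      using a ij by (simp add: bell_def)
    ultimately have "bell m $$ (i, a) * dag (bell m) $$ (a, j) = (complex_of_real (1 / sqrt 2) * complex_of_real (1 / sqrt 2)) *
       ((delta (?c i) a + ?e i * delta (?d i) a) * (delta (?c j) a + ?e j * delta (?d j) a))"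
      by (simp only: mult_ac)
    then show "bell m $$ (i, a) * dag (bell m) $$ (a, j) = 1 / 2 * (delta (?c i) a * delta (?c j) a + ?e j * (delta (?c i) a * delta (?d j) a)
      + ?e i * (delta (?d i) a * delta (?c j) a) + ?e i * ?e j * (delta (?d i) a * delta (?d j) a))"
      unfolding rr by (simp only: distrib_left distrib_right mult_ac add_ac)
  qed
  also have "\<dots> = 1 / 2 * (delta (?c i) (?c j) + ?e j * delta (?c i) (?d j) + ?e i * delta (?d i) (?c j) + ?e i * ?e j * delta (?d i) (?d j))"
    unfolding sum_distrib_left[symmetric] sum.distrib by (simp only: sum_delta[OF lt(1)] sum_delta[OF lt(2)])
  \<comment> \<open>The cross terms vanish because representatives have top bit 0 and their
    complements have top bit 1.\<close>
  also have "delta (?c i) (?d j) = 0" using bell_index_less[of m i] cpl_bell_index[of m j] by (simp add: delta_def)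
  also have "delta (?d i) (?c j) = 0" using bell_index_less[of m j] cpl_bell_index[of m i] by (simp add: delta_def)
  also have "delta (?d i) (?d j) = delta (?c i) (?c j)"
    using cpl_cpl[OF bell_index_less'] unfolding delta_def by metis
  finally have *: "(bell m * dag (bell m)) $$ (i, j) = 1 / 2 * (delta (?c i) (?c j) * (1 + ?e i * ?e j))"
    by (simp add: algebra_simps)
  have "?c i = ?c j \<longleftrightarrow> psign (i div 2 ^ m) = psign (j div 2 ^ m) \<and> i mod 2 ^ m = j mod 2 ^ m"
    unfolding bell_index_def by (intro pemb_eq_iff psign_cases) simp_all
  moreover have inj: "i = j" if "psign (i div 2 ^ m) = psign (j div 2 ^ m)" "i mod 2 ^ m = j mod 2 ^ m" "?e i = ?e j"
  proof -
    have "i div 2 ^ m < 4" "j div 2 ^ m < 4" using ij by (simp_all add: less_mult_imp_div_less)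
    then have "i div 2 ^ m = j div 2 ^ m" using sign_pair_inj that by blast
    then show ?thesis using that(2) by (metis div_mult_mod_eq)
  qed
  moreover have opposite: "1 + ?e i * ?e j = 0" if "?e i \<noteq> ?e j"
    using that by (auto simp: esign_def split: if_splits)
  ultimately have "delta (?c i) (?c j) * (1 + ?e i * ?e j) = (if i = j then 2 else 0)"
    by (auto simp: delta_def)
  then show "(bell m * dag (bell m)) $$ (i, j) = 1\<^sub>m (2 ^ (m + 2)) $$ (i, j)"
    unfolding * using ij by simp
qed (simp_all add: dag_def bell_def)

text \<open>For an even number of qubits a state and its complement have equal parity, so their sums
  and differences remain eigenvectors of Z...Z.\<close>

lemma bell_PZ:
  assumes "even m" "i < 2 ^ (m + 2)" "a < 2 ^ (m + 2)"
  shows "bell m $$ (i, a) * zsgn (m + 2) a = psign (i div 2 ^ m) * bell m $$ (i, a)"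
proof -
  have "zsgn (m + 2) (cpl (m + 2) (bell_index m i)) = psign (i div 2 ^ m)"
    unfolding zsgn_cpl[OF bell_index_less'] zsgn_bell_index using assms(1) by simp
  then have "zsgn (m + 2) a = psign (i div 2 ^ m) \<or> bell m $$ (i, a) = 0"
    using assms(2,3) zsgn_bell_index[of m i] by (auto simp: bell_def delta_def)
  then show ?thesis by auto
qed

lemma bell_PX:
  assumes "i < 2 ^ (m + 2)" "a < 2 ^ (m + 2)"
  shows "bell m $$ (i, cpl (m + 2) a) = esign (i div 2 ^ m) * bell m $$ (i, a)"
proof -
  have "cpl (m + 2) a = bell_index m i \<longleftrightarrow> a = cpl (m + 2) (bell_index m i)"
    "cpl (m + 2) a = cpl (m + 2) (bell_index m i) \<longleftrightarrow> a = bell_index m i"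
    using cpl_cpl[OF assms(2)] cpl_cpl[OF bell_index_less'] by metis+
  moreover have "cpl (m + 2) a < 4 * 2 ^ m" using cpl_less[of "m + 2" a] by simp
  ultimately show ?thesis
    using assms by (simp add: bell_def delta_def distrib_left)
qed

definition all_consts :: "(nat \<Rightarrow> pauli) set" where
  "all_consts = {\<lambda>_. PI, \<lambda>_. PX, \<lambda>_. PY, \<lambda>_. PZ}"

text \<open>The phase in the product of X...X and Z...Z, left unevaluated since it depends on n.
  Y...Y is recovered from the other two by dividing by it.\<close>

definition wXZ :: "nat \<Rightarrow> complex" where
  "wXZ n = phs n (\<lambda>_. PX) (\<lambda>_. PZ)"

lemma XZ_mult: "pstr n (\<lambda>_. PX) * pstr n (\<lambda>_. PZ) = wXZ n \<cdot>\<^sub>m pstr n (\<lambda>_. PY)"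
  unfolding pstr_mult wXZ_def by simp

lemma wXZ_nonzero: "wXZ n \<noteq> 0"
  unfolding wXZ_def by (rule phs_nonzero)

lemma mult_PY_index:
  assumes M: "M \<in> carrier_mat N (2 ^ n)" and ab: "a < N" "b < 2 ^ n"
  shows "(M * pstr n (\<lambda>_. PY)) $$ (a, b) = M $$ (a, cpl n b) * zsgn n b / wXZ n"
proof -
  have c: "M * pstr n (\<lambda>_. PX) \<in> carrier_mat N (2 ^ n)" using M by (rule mult_carrier_mat) simp
  have "wXZ n \<cdot>\<^sub>m (M * pstr n (\<lambda>_. PY)) = M * pstr n (\<lambda>_. PX) * pstr n (\<lambda>_. PZ)"
    using M by (simp add: assoc_mult_mat[OF M pstr_carrier pstr_carrier] XZ_mult mult_smult_distrib[OF M pstr_carrier])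
  then have "(wXZ n \<cdot>\<^sub>m (M * pstr n (\<lambda>_. PY))) $$ (a, b) = M $$ (a, cpl n b) * zsgn n b"
    using mult_PZ_index[OF c ab] mult_PX_index[OF M ab] by simp
  then have "wXZ n * (M * pstr n (\<lambda>_. PY)) $$ (a, b) = M $$ (a, cpl n b) * zsgn n b"
    using M ab by (simp del: index_mult_mat(1))
  then show ?thesis using wXZ_nonzero[of n] by (simp add: field_simps del: index_mult_mat(1))
qed

text \<open>The strings in question are constant, so the letter at site 0 identifies them. The
  eigenvalue of Y...Y is the product of the other two, up to the phase.\<close>

definition bell_char :: "nat \<Rightarrow> (nat \<Rightarrow> pauli) \<Rightarrow> nat \<Rightarrow> complex" where
  "bell_char n q k = (case q 0 of PI \<Rightarrow> 1 | PX \<Rightarrow> esign k | PY \<Rightarrow> esign k * psign k / wXZ n | PZ \<Rightarrow> psign k)"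

text \<open>The coefficient matrix is the character table of the Klein four-group, whose rows are
  orthogonal.\<close>

lemma four_signs:
  fixes a b c d :: complex
  assumes h: "a + b + c + d = 0" "a + b - c - d = 0" "a - b + c - d = 0" "a - b - c + d = 0"
  shows "a = 0 \<and> b = 0 \<and> c = 0 \<and> d = 0"
proof -
  have "4 * a = (a + b + c + d) + (a + b - c - d) + (a - b + c - d) + (a - b - c + d)"
    "4 * b = (a + b + c + d) + (a + b - c - d) - (a - b + c - d) - (a - b - c + d)"
    "4 * c = (a + b + c + d) - (a + b - c - d) + (a - b + c - d) - (a - b - c + d)"
    "4 * d = (a + b + c + d) - (a + b - c - d) - (a - b + c - d) + (a - b - c + d)"
    by simp_all
  then show ?thesis unfolding h by simp
qed

theorem commutant_all_even_iso:
  assumes "even m"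
  shows "commutant (m + 2) all_consts \<cong>\<^sub>L dsum 4 (2 ^ m) (su (2 ^ m))"
proof (rule commutant_iso_dsum[where V = "bell m" and \<chi> = "bell_char (m + 2)"])
  fix q
  assume q: "q \<in> all_consts"
  show "bell m * pstr (m + 2) q = diagm 4 (2 ^ m) (bell_char (m + 2) q) * bell m"
  proof (rule eq_matI)
    fix i a
    assume "i < dim_row (diagm 4 (2 ^ m) (bell_char (m + 2) q) * bell m)"
      "a < dim_col (diagm 4 (2 ^ m) (bell_char (m + 2) q) * bell m)"
    then have ia: "i < 2 ^ (m + 2)" "a < 2 ^ (m + 2)" "i < 4 * 2 ^ m" by (auto simp: bell_def diagm_def)
    have b: "bell m \<in> carrier_mat (4 * 2 ^ m) (2 ^ (m + 2))" by (simp add: bell_def)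
    have rhs: "(diagm 4 (2 ^ m) (bell_char (m + 2) q) * bell m) $$ (i, a) = bell_char (m + 2) q (i div 2 ^ m) * bell m $$ (i, a)"
      by (rule diagm_mult_index[OF b ia(3,2)])
    have one: "bell m * 1\<^sub>m (2 ^ (m + 2)) = bell m" by (rule right_mult_one_mat[OF bell_carrier])
    consider "q = (\<lambda>_. PI)" | "q = (\<lambda>_. PX)" | "q = (\<lambda>_. PY)" | "q = (\<lambda>_. PZ)"
      using q unfolding all_consts_def by blast
    then show "(bell m * pstr (m + 2) q) $$ (i, a) = (diagm 4 (2 ^ m) (bell_char (m + 2) q) * bell m) $$ (i, a)"
    proof cases
      case 1
      show ?thesis unfolding rhs unfolding 1 pstr_PI one by (simp add: bell_char_def)
    next
      case 2
      show ?thesis unfolding rhs unfolding 2 mult_PX_index[OF bell_carrier ia(1,2)] bell_PX[OF ia(1,2)]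
        by (simp add: bell_char_def)
    next
      case 3
      show ?thesis unfolding rhs unfolding 3 mult_PY_index[OF bell_carrier ia(1,2)] bell_PX[OF ia(1,2)]
        using bell_PZ[OF assms ia(1,2)] by (simp add: bell_char_def mult.assoc)
    next
      case 4
      show ?thesis unfolding rhs unfolding 4 mult_PZ_index[OF bell_carrier ia(1,2)] bell_PZ[OF assms ia(1,2)]
        by (simp add: bell_char_def)
    qed
  qed (simp_all add: bell_def diagm_def)
next
  fix k l :: nat
  assume kl: "k < 4" "l < 4" "k \<noteq> l"
  then have "psign k \<noteq> psign l \<or> esign k \<noteq> esign l" using sign_pair_inj by blast
  then show "\<exists>q\<in>all_consts. bell_char (m + 2) q k \<noteq> bell_char (m + 2) q l"
  proof
    assume "psign k \<noteq> psign l"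
    then show ?thesis by (intro bexI[of _ "\<lambda>_. PZ"]) (simp_all add: bell_char_def all_consts_def)
  next
    assume "esign k \<noteq> esign l"
    then show ?thesis by (intro bexI[of _ "\<lambda>_. PX"]) (simp_all add: bell_char_def all_consts_def)
  qed
next
  fix t :: "nat \<Rightarrow> complex" and k :: nat
  assume h: "\<forall>q\<in>all_consts. (\<Sum>k<4. bell_char (m + 2) q k * t k) = 0" and k: "k < 4"
  let ?w = "wXZ (m + 2)"
  have four: "(\<Sum>k<4. f k) = f 0 + f 1 + f 2 + f 3" for f :: "nat \<Rightarrow> complex"
    by (simp add: eval_nat_numeral)
  have "t 0 + t 1 + t 2 + t 3 = 0" "t 0 + t 1 - t 2 - t 3 = 0" "t 0 - t 1 + t 2 - t 3 = 0"
    using bspec[OF h, of "\<lambda>_. PI"] bspec[OF h, of "\<lambda>_. PX"] bspec[OF h, of "\<lambda>_. PZ"]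
    unfolding four by (simp_all add: bell_char_def esign_def psign_def all_consts_def)
  moreover have "(t 0 - t 1 - t 2 + t 3) / ?w = 0"
    using bspec[OF h, of "\<lambda>_. PY"]
    unfolding four by (simp add: bell_char_def esign_def psign_def all_consts_def diff_divide_distrib add_divide_distrib)
  then have "t 0 - t 1 - t 2 + t 3 = 0" using wXZ_nonzero by simp
  ultimately have "t 0 = 0 \<and> t 1 = 0 \<and> t 2 = 0 \<and> t 3 = 0" by (intro four_signs)
  moreover have "k \<in> {0, 1, 2, 3}" using k by auto
  ultimately show "t k = 0" by auto
qed (simp_all add: bell_unitary del: power_Suc add_2_eq_Suc', simp)

section \<open>The commutant of an anticommuting pair\<close>

definition even_part :: "nat \<Rightarrow> complex mat \<Rightarrow> complex mat" where
  "even_part m M = mat (2 ^ m) (2 ^ m) (\<lambda>(i, j). M $$ (pemb m 1 i, pemb m 1 j))"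

lemma sum_pemb:
  fixes g :: "nat \<Rightarrow> complex"
  shows "(\<Sum>i<2 ^ m. g (pemb m 1 i)) = (\<Sum>a<2 ^ Suc m. if zsgn (Suc m) a = 1 then g a else 0)"
proof -
  have inj: "inj_on (pemb m 1) {..<2 ^ m}"
    by (auto simp: inj_on_def pemb_eq_iff)
  have im: "pemb m 1 ` {..<2 ^ m} = {a \<in> {..<2 ^ Suc m}. zsgn (Suc m) a = 1}"
  proof
    show "pemb m 1 ` {..<2 ^ m} \<subseteq> {a \<in> {..<2 ^ Suc m}. zsgn (Suc m) a = 1}"
      using pemb_less[of _ m 1] zsgn_pemb[of _ m 1] by auto
    show "{a \<in> {..<2 ^ Suc m}. zsgn (Suc m) a = 1} \<subseteq> pemb m 1 ` {..<2 ^ m}"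
    proof
      fix a
      assume "a \<in> {a \<in> {..<2 ^ Suc m}. zsgn (Suc m) a = 1}"
      then have "pemb m 1 (a mod 2 ^ m) = a" by (intro pemb_mod) auto
      then show "a \<in> pemb m 1 ` {..<2 ^ m}" by (intro image_eqI[of _ _ "a mod 2 ^ m"]) auto
    qed
  qed
  have "(\<Sum>i<2 ^ m. g (pemb m 1 i)) = sum g (pemb m 1 ` {..<2 ^ m})"
    by (subst sum.reindex[OF inj]) simp
  then show ?thesis by (simp only: im sum.inter_filter[OF finite_lessThan])
qed

lemma commute_PZ_iff:
  assumes M: "M \<in> carrier_mat (2 ^ n) (2 ^ n)"
  shows "pstr n (\<lambda>_. PZ) * M = M * pstr n (\<lambda>_. PZ) \<longleftrightarrow>
    (\<forall>a<2 ^ n. \<forall>b<2 ^ n. zsgn n a \<noteq> zsgn n b \<longrightarrow> M $$ (a, b) = 0)"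
proof
  assume h: "pstr n (\<lambda>_. PZ) * M = M * pstr n (\<lambda>_. PZ)"
  show "\<forall>a<2 ^ n. \<forall>b<2 ^ n. zsgn n a \<noteq> zsgn n b \<longrightarrow> M $$ (a, b) = 0"
  proof (intro allI impI)
    fix a b
    assume ab: "a < 2 ^ n" "b < 2 ^ n" and ne: "zsgn n a \<noteq> zsgn n b"
    have "zsgn n a * M $$ (a, b) = M $$ (a, b) * zsgn n b"
      by (metis PZ_mult_index[OF M ab] mult_PZ_index[OF M ab] h)
    then have "(zsgn n a - zsgn n b) * M $$ (a, b) = 0" by (simp add: algebra_simps)
    then show "M $$ (a, b) = 0" using ne by simp
  qed
next
  assume h: "\<forall>a<2 ^ n. \<forall>b<2 ^ n. zsgn n a \<noteq> zsgn n b \<longrightarrow> M $$ (a, b) = 0"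
  show "pstr n (\<lambda>_. PZ) * M = M * pstr n (\<lambda>_. PZ)"
  proof (rule eq_matI)
    fix a b
    assume "a < dim_row (M * pstr n (\<lambda>_. PZ))" "b < dim_col (M * pstr n (\<lambda>_. PZ))"
    then have ab: "a < 2 ^ n" "b < 2 ^ n" using M by auto
    show "(pstr n (\<lambda>_. PZ) * M) $$ (a, b) = (M * pstr n (\<lambda>_. PZ)) $$ (a, b)"
      unfolding PZ_mult_index[OF M ab] mult_PZ_index[OF M ab] using h ab by (cases "zsgn n a = zsgn n b") auto
  qed (use M in auto)
qed

lemma commute_PX_iff:
  assumes M: "M \<in> carrier_mat (2 ^ n) (2 ^ n)"
  shows "pstr n (\<lambda>_. PX) * M = M * pstr n (\<lambda>_. PX) \<longleftrightarrow>
    (\<forall>a<2 ^ n. \<forall>b<2 ^ n. M $$ (cpl n a, b) = M $$ (a, cpl n b))"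
proof
  assume h: "pstr n (\<lambda>_. PX) * M = M * pstr n (\<lambda>_. PX)"
  show "\<forall>a<2 ^ n. \<forall>b<2 ^ n. M $$ (cpl n a, b) = M $$ (a, cpl n b)"
  proof (intro allI impI)
    fix a b :: nat
    assume ab: "a < 2 ^ n" "b < 2 ^ n"
    show "M $$ (cpl n a, b) = M $$ (a, cpl n b)"
      by (metis PX_mult_index[OF M ab] mult_PX_index[OF M ab] h)
  qed
next
  assume h: "\<forall>a<2 ^ n. \<forall>b<2 ^ n. M $$ (cpl n a, b) = M $$ (a, cpl n b)"
  show "pstr n (\<lambda>_. PX) * M = M * pstr n (\<lambda>_. PX)"
  proof (rule eq_matI)
    fix a b
    assume "a < dim_row (M * pstr n (\<lambda>_. PX))" "b < dim_col (M * pstr n (\<lambda>_. PX))"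
    then have ab: "a < 2 ^ n" "b < 2 ^ n" using M by auto
    show "(pstr n (\<lambda>_. PX) * M) $$ (a, b) = (M * pstr n (\<lambda>_. PX)) $$ (a, b)"
      unfolding PX_mult_index[OF M ab] mult_PX_index[OF M ab] using h ab by blast
  qed (use M in auto)
qed

lemma commute_PY:
  assumes M: "M \<in> carrier_mat (2 ^ n) (2 ^ n)"
    and X: "pstr n (\<lambda>_. PX) * M = M * pstr n (\<lambda>_. PX)" and Z: "pstr n (\<lambda>_. PZ) * M = M * pstr n (\<lambda>_. PZ)"
  shows "pstr n (\<lambda>_. PY) * M = M * pstr n (\<lambda>_. PY)"
proof -
  let ?X = "pstr n (\<lambda>_. PX)" and ?Y = "pstr n (\<lambda>_. PY)" and ?Z = "pstr n (\<lambda>_. PZ)"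
  note a = assoc_mult_mat[of _ "2 ^ n" "2 ^ n" _ "2 ^ n" _ "2 ^ n"]
  have "?X * ?Z * M = ?X * (M * ?Z)" using M Z a[of ?X ?Z M] by simp
  also have "\<dots> = M * ?X * ?Z" using M X a[of ?X M ?Z] by simp
  also have "\<dots> = M * (?X * ?Z)" using M by (intro a) auto
  finally have "wXZ n \<cdot>\<^sub>m ?Y * M = M * (wXZ n \<cdot>\<^sub>m ?Y)" unfolding XZ_mult .
  then have "wXZ n \<cdot>\<^sub>m (?Y * M) = wXZ n \<cdot>\<^sub>m (M * ?Y)"
    unfolding mult_smult_assoc_mat[OF pstr_carrier M] mult_smult_distrib[OF M pstr_carrier] .
  then have "(1 / wXZ n) \<cdot>\<^sub>m (wXZ n \<cdot>\<^sub>m (?Y * M)) = (1 / wXZ n) \<cdot>\<^sub>m (wXZ n \<cdot>\<^sub>m (M * ?Y))" by (rule arg_cong)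
  moreover have "(1 / wXZ n) \<cdot>\<^sub>m (wXZ n \<cdot>\<^sub>m A) = A" for A :: "complex mat"
    using wXZ_nonzero[of n] by (intro eq_matI) auto
  ultimately show ?thesis by simp
qed

lemma acomm_const: "odd n \<Longrightarrow> ac A B \<Longrightarrow> acomm n (\<lambda>_. A) (\<lambda>_. B)"
  by (simp add: acomm_def sg_def)

lemma even_part_minus:
  assumes "A \<in> carrier_mat (2 ^ Suc m) (2 ^ Suc m)" "B \<in> carrier_mat (2 ^ Suc m) (2 ^ Suc m)"
  shows "even_part m (A - B) = even_part m A - even_part m B"
proof (rule eq_matI)
  fix i j
  assume "i < dim_row (even_part m A - even_part m B)" "j < dim_col (even_part m A - even_part m B)"
  then have "i < 2 ^ m" "j < 2 ^ m" by (auto simp: even_part_def)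
  moreover from this have "pemb m 1 i < 2 ^ Suc m" "pemb m 1 j < 2 ^ Suc m" using pemb_less by blast+
  ultimately show "even_part m (A - B) $$ (i, j) = (even_part m A - even_part m B) $$ (i, j)"
    using assms by (simp add: even_part_def)
qed (simp_all add: even_part_def)

text \<open>Only \<open>x\<close> has to preserve parity: from an even row it reaches only even
  intermediate indices, so the sum in the product restricts to the even block.\<close>

lemma even_part_mult:
  assumes "x \<in> carrier_mat (2 ^ Suc m) (2 ^ Suc m)" "y \<in> carrier_mat (2 ^ Suc m) (2 ^ Suc m)"
    and zero: "\<And>a b. a < 2 ^ Suc m \<Longrightarrow> b < 2 ^ Suc m \<Longrightarrow> zsgn (Suc m) a \<noteq> zsgn (Suc m) b \<Longrightarrow> x $$ (a, b) = 0"
  shows "even_part m (x * y) = even_part m x * even_part m y"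
proof (rule eq_matI)
  fix i j
  assume "i < dim_row (even_part m x * even_part m y)" "j < dim_col (even_part m x * even_part m y)"
  then have ij: "i < 2 ^ m" "j < 2 ^ m" by (auto simp: even_part_def)
  have p: "pemb m 1 i < 2 ^ Suc m" if "i < 2 ^ m" for i using pemb_less that by blast
  have "even_part m (x * y) $$ (i, j) = (\<Sum>c<2 ^ Suc m. x $$ (pemb m 1 i, c) * y $$ (c, pemb m 1 j))"
    using ij mult_mat_index[OF assms(1,2) p p] by (simp add: even_part_def del: index_mult_mat(1) power_Suc)
  also have "\<dots> = (\<Sum>c<2 ^ Suc m. if zsgn (Suc m) c = 1 then x $$ (pemb m 1 i, c) * y $$ (c, pemb m 1 j) else 0)"
  proof (intro sum.cong refl)
    fix c :: nat
    assume "c \<in> {..<2 ^ Suc m}"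
    then show "x $$ (pemb m 1 i, c) * y $$ (c, pemb m 1 j) = (if zsgn (Suc m) c = 1 then x $$ (pemb m 1 i, c) * y $$ (c, pemb m 1 j) else 0)"
      using zero[OF p[OF ij(1)], of c] zsgn_pemb[OF ij(1), of 1] by auto
  qed
  also have "\<dots> = (\<Sum>k<2 ^ m. x $$ (pemb m 1 i, pemb m 1 k) * y $$ (pemb m 1 k, pemb m 1 j))"
    by (rule sum_pemb[symmetric])
  also have "\<dots> = (\<Sum>k<2 ^ m. even_part m x $$ (i, k) * even_part m y $$ (k, j))"
    using ij by (intro sum.cong) (auto simp: even_part_def)
  also have "\<dots> = (even_part m x * even_part m y) $$ (i, j)"
    using ij by (intro mult_mat_index[symmetric]) (auto simp: even_part_def)
  finally show "even_part m (x * y) $$ (i, j) = (even_part m x * even_part m y) $$ (i, j)" .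
qed (simp_all add: even_part_def)

text \<open>The inverse of \<open>even_part\<close> on the commutant. For an odd number of qubits
  complementation exchanges the parities, so the odd block must be the copy of the even one
  transported by X...X.\<close>

definition spread :: "nat \<Rightarrow> complex mat \<Rightarrow> complex mat" where
  "spread m B = mat (2 ^ Suc m) (2 ^ Suc m) (\<lambda>(a, b).
     if zsgn (Suc m) a \<noteq> zsgn (Suc m) b then 0
     else if zsgn (Suc m) a = 1 then B $$ (a mod 2 ^ m, b mod 2 ^ m)
     else B $$ (cpl (Suc m) a mod 2 ^ m, cpl (Suc m) b mod 2 ^ m))"

lemma pemb_mod_low: "i < 2 ^ m \<Longrightarrow> pemb m k i mod 2 ^ m = i"
  by (simp add: pemb_def)

lemma even_part_spread: "B \<in> carrier_mat (2 ^ m) (2 ^ m) \<Longrightarrow> even_part m (spread m B) = B"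
  using pemb_less[of _ m 1] zsgn_pemb[of _ m 1]
  by (intro eq_matI) (auto simp: even_part_def spread_def pemb_mod_low)

lemma spread_in_commutant:
  assumes m: "even m" and B: "B \<in> su (2 ^ m)"
  shows "spread m B \<in> commutant (Suc m) all_consts"
proof -
  let ?n = "Suc m" and ?M = "spread m B"
  have c: "?M \<in> carrier_mat (2 ^ ?n) (2 ^ ?n)" by (simp add: spread_def)
  have sk: "\<And>i j. i < 2 ^ m \<Longrightarrow> j < 2 ^ m \<Longrightarrow> B $$ (i, j) = - cnj (B $$ (j, i))" and trB: "tr B = 0"
    and cB: "B \<in> carrier_mat (2 ^ m) (2 ^ m)"
    using B unfolding su_iff skew_iff by blast+
  have flip: "zsgn ?n (cpl ?n a) = - zsgn ?n a" if "a < 2 ^ ?n" for a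
    using zsgn_cpl[OF that] m by simp
  have idx: "?M $$ (a, b) = (if zsgn ?n a \<noteq> zsgn ?n b then 0
     else if zsgn ?n a = 1 then B $$ (a mod 2 ^ m, b mod 2 ^ m)
     else B $$ (cpl ?n a mod 2 ^ m, cpl ?n b mod 2 ^ m))" if "a < 2 ^ ?n" "b < 2 ^ ?n" for a b
    using that by (simp add: spread_def)
  have X: "pstr ?n (\<lambda>_. PX) * ?M = ?M * pstr ?n (\<lambda>_. PX)"
    unfolding commute_PX_iff[OF c]
  proof (intro allI impI)
    fix a b :: nat
    assume ab: "a < 2 ^ ?n" "b < 2 ^ ?n"
    show "?M $$ (cpl ?n a, b) = ?M $$ (a, cpl ?n b)"
      unfolding idx[OF cpl_less ab(2)] idx[OF ab(1) cpl_less] flip[OF ab(1)] flip[OF ab(2)]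
      using zsgn_cases[of ?n a] zsgn_cases[of ?n b] by (auto simp: cpl_cpl ab simp del: power_Suc)
  qed
  have Z: "pstr ?n (\<lambda>_. PZ) * ?M = ?M * pstr ?n (\<lambda>_. PZ)"
    unfolding commute_PZ_iff[OF c] using idx by simp
  have "?M $$ (a, b) = - cnj (?M $$ (b, a))" if "a < 2 ^ ?n" "b < 2 ^ ?n" for a b
    unfolding idx[OF that] idx[OF that(2,1)]
    using sk[of "a mod 2 ^ m" "b mod 2 ^ m"] sk[of "cpl ?n a mod 2 ^ m" "cpl ?n b mod 2 ^ m"]
    by (simp del: power_Suc)
  then have skew: "?M \<in> skew (2 ^ ?n)" using c unfolding skew_iff by blast
  let ?ev = "\<Sum>a<2 ^ ?n. if zsgn ?n a = 1 then ?M $$ (a, a) else 0"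
  have "?ev = (\<Sum>i<2 ^ m. ?M $$ (pemb m 1 i, pemb m 1 i))"
    by (rule sum_pemb[symmetric])
  also have "\<dots> = tr B"
    unfolding tr_def using cB
    by (intro sum.cong) (auto simp: idx pemb_less zsgn_pemb pemb_mod_low simp del: power_Suc)
  finally have ev: "?ev = 0" using trB by simp
  have bij: "bij_betw (cpl ?n) {..<2 ^ ?n} {..<2 ^ ?n}"
    by (rule bij_betw_byWitness[where f' = "cpl ?n"]) (auto simp: cpl_cpl cpl_less simp del: power_Suc)
  \<comment> \<open>Complementation carries the odd diagonal positions onto the even ones, and
    commuting with X...X makes the entries agree, so both halves have the same sum.\<close>
  have od: "(\<Sum>a<2 ^ ?n. if zsgn ?n a = 1 then 0 else ?M $$ (a, a)) = ?ev"
  proof -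
    have "(\<Sum>a<2 ^ ?n. if zsgn ?n a = 1 then 0 else ?M $$ (a, a))
        = (\<Sum>a<2 ^ ?n. if zsgn ?n (cpl ?n a) = 1 then 0 else ?M $$ (cpl ?n a, cpl ?n a))"
      by (rule sum.reindex_bij_betw[OF bij, symmetric])
    also have "\<dots> = ?ev"
    proof (intro sum.cong refl)
      fix a :: nat
      assume "a \<in> {..<2 ^ ?n}"
      then have a: "a < 2 ^ ?n" by simp
      have "?M $$ (cpl ?n a, cpl ?n a) = ?M $$ (a, a)"
        using X[unfolded commute_PX_iff[OF c]] a cpl_less[of ?n a] cpl_cpl[OF a] by metis
      then show "(if zsgn ?n (cpl ?n a) = 1 then 0 else ?M $$ (cpl ?n a, cpl ?n a)) = (if zsgn ?n a = 1 then ?M $$ (a, a) else 0)"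
        using flip[OF a] zsgn_cases[of ?n a] by auto
    qed
    finally show ?thesis .
  qed
  have "tr ?M = ?ev + (\<Sum>a<2 ^ ?n. if zsgn ?n a = 1 then 0 else ?M $$ (a, a))"
    unfolding sum.distrib[symmetric] tr_def using c by (intro sum.cong) auto
  then have trM: "tr ?M = 0" using ev od by simp
  have n: "odd ?n" using m by simp
  \<comment> \<open>For odd n each nontrivial constant string anticommutes with another one that
    commutes with the matrix, so these three traces vanish automatically.\<close>
  have "tr (pstr ?n (\<lambda>_. PX) * ?M) = 0" "tr (pstr ?n (\<lambda>_. PY) * ?M) = 0" "tr (pstr ?n (\<lambda>_. PZ) * ?M) = 0"
    using tr_anticommuting[OF c Z acomm_const[OF n, of PX PZ]] tr_anticommuting[OF c Z acomm_const[OF n, of PY PZ]]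
      tr_anticommuting[OF c X acomm_const[OF n, of PZ PX]] by (auto simp: ac_def)
  moreover have "pstr ?n (\<lambda>_. PI) * ?M = ?M" "?M * pstr ?n (\<lambda>_. PI) = ?M"
    unfolding pstr_PI using c by (rule left_mult_one_mat, rule right_mult_one_mat)
  ultimately show ?thesis
    unfolding commutant_def all_consts_def using skew X Z commute_PY[OF c X Z] trM by simp
qed

lemma commutant_all_entries:
  assumes "M \<in> commutant n all_consts"
  shows "M \<in> carrier_mat (2 ^ n) (2 ^ n)" "M \<in> skew (2 ^ n)" "tr M = 0"
    and "\<forall>a<2 ^ n. \<forall>b<2 ^ n. zsgn n a \<noteq> zsgn n b \<longrightarrow> M $$ (a, b) = 0"
    and "\<forall>a<2 ^ n. \<forall>b<2 ^ n. M $$ (cpl n a, b) = M $$ (a, cpl n b)"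
    and "(\<Sum>a<2 ^ n. zsgn n a * M $$ (a, a)) = 0"
proof -
  have M: "M \<in> skew (2 ^ n)" and com: "\<And>q. q \<in> all_consts \<Longrightarrow> pstr n q * M = M * pstr n q"
    and tr: "\<And>q. q \<in> all_consts \<Longrightarrow> tr (pstr n q * M) = 0"
    using assms unfolding commutant_def by blast+
  then show c: "M \<in> carrier_mat (2 ^ n) (2 ^ n)" and "M \<in> skew (2 ^ n)" by (auto simp: skew_def)
  have q: "(\<lambda>_. PI) \<in> all_consts" "(\<lambda>_. PX) \<in> all_consts" "(\<lambda>_. PZ) \<in> all_consts"
    by (simp_all add: all_consts_def)
  show "tr M = 0" using tr[OF q(1)] left_mult_one_mat[OF c] by (simp add: pstr_PI)
  show "\<forall>a<2 ^ n. \<forall>b<2 ^ n. zsgn n a \<noteq> zsgn n b \<longrightarrow> M $$ (a, b) = 0"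
    using com[OF q(3)] commute_PZ_iff[OF c] by blast
  show "\<forall>a<2 ^ n. \<forall>b<2 ^ n. M $$ (cpl n a, b) = M $$ (a, cpl n b)"
    using com[OF q(2)] commute_PX_iff[OF c] by blast
  have "tr (pstr n (\<lambda>_. PZ) * M) = (\<Sum>a<2 ^ n. zsgn n a * M $$ (a, a))"
    unfolding tr_def using c
    by (intro sum.cong) (simp_all add: PZ_mult_index[OF c] del: index_mult_mat(1))
  then show "(\<Sum>a<2 ^ n. zsgn n a * M $$ (a, a)) = 0" using tr[OF q(3)] by simp
qed

text \<open>Here X...X and Z...Z anticommute and cannot be diagonalised together. Z...Z splits the
  space by parity and X...X identifies the two halves, so a single block determines the whole
  matrix.\<close>

theorem commutant_all_odd_iso:
  assumes m: "even m"
  shows "commutant (Suc m) all_consts \<cong>\<^sub>L su (2 ^ m)"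
proof (rule lie_isoI[of "even_part m"])
  let ?n = "Suc m" and ?L = "commutant (Suc m) all_consts"
  note E = commutant_all_entries[of _ ?n]
  have p: "pemb m 1 i < 2 ^ ?n" if "i < 2 ^ m" for i using pemb_less that by blast
  have flip: "zsgn ?n (cpl ?n a) = - zsgn ?n a" if "a < 2 ^ ?n" for a
    using zsgn_cpl[OF that] m by simp
  show "bij_betw (even_part m) ?L (su (2 ^ m))"
    unfolding bij_betw_def
  proof
    show "inj_on (even_part m) ?L"
    proof (rule inj_onI)
      fix x y
      assume xy: "x \<in> ?L" "y \<in> ?L" and eq: "even_part m x = even_part m y"
      have ev: "x $$ (a, b) = y $$ (a, b)" if "a < 2 ^ ?n" "b < 2 ^ ?n" "zsgn ?n a = 1" "zsgn ?n b = 1" for a b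
      proof -
        have "even_part m x $$ (a mod 2 ^ m, b mod 2 ^ m) = even_part m y $$ (a mod 2 ^ m, b mod 2 ^ m)"
          using eq by simp
        then show ?thesis using that by (simp add: even_part_def pemb_mod)
      qed
      have flip2: "z $$ (cpl ?n a, cpl ?n b) = z $$ (a, b)" if "z \<in> ?L" "a < 2 ^ ?n" "b < 2 ^ ?n" for z a b
        using E(5)[OF that(1)] that(2,3) cpl_less[of ?n b] cpl_cpl[OF that(3)] by metis
      show "x = y"
      proof (rule eq_matI)
        fix a b
        assume "a < dim_row y" "b < dim_col y"
        then have ab: "a < 2 ^ ?n" "b < 2 ^ ?n" using E(1)[OF xy(2)] by auto
        show "x $$ (a, b) = y $$ (a, b)"
        proof (cases "zsgn ?n a = zsgn ?n b")
          case False
          then have "x $$ (a, b) = 0" "y $$ (a, b) = 0" using E(4)[OF xy(1)] E(4)[OF xy(2)] ab by blast+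
          then show ?thesis by simp
        next
          case same: True
          show ?thesis
          proof (cases "zsgn ?n a = 1")
            case True
            then show ?thesis using ev ab same by simp
          next
            case False
            then have "zsgn ?n a = -1" using zsgn_cases by blast
            then have "zsgn ?n (cpl ?n a) = 1" "zsgn ?n (cpl ?n b) = 1" using flip ab same by simp_all
            then have "x $$ (cpl ?n a, cpl ?n b) = y $$ (cpl ?n a, cpl ?n b)" by (intro ev cpl_less)
            then show ?thesis using flip2 xy ab by simp
          qed
        qed
      qed (use E(1)[OF xy(1)] E(1)[OF xy(2)] in auto)
    qed
    show "even_part m ` ?L = su (2 ^ m)"
    proof
      show "even_part m ` ?L \<subseteq> su (2 ^ m)"
      proof
        fix B
        assume "B \<in> even_part m ` ?L"
        then obtain M where M: "M \<in> ?L" "B = even_part m M" by blast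
        have h: "M $$ (a, b) = - cnj (M $$ (b, a))" if "a < 2 ^ ?n" "b < 2 ^ ?n" for a b
          using E(2)[OF M(1)] that unfolding skew_iff by blast
        have "B $$ (i, j) = - cnj (B $$ (j, i))" if "i < 2 ^ m" "j < 2 ^ m" for i j
        proof -
          have *: "B $$ (i, j) = M $$ (pemb m 1 i, pemb m 1 j)" "B $$ (j, i) = M $$ (pemb m 1 j, pemb m 1 i)"
            using that by (simp_all add: M(2) even_part_def)
          show ?thesis unfolding * by (rule h[OF p[OF that(1)] p[OF that(2)]])
        qed
        moreover have "B \<in> carrier_mat (2 ^ m) (2 ^ m)" by (simp add: M(2) even_part_def)
        ultimately have "B \<in> skew (2 ^ m)" unfolding skew_iff by blast
        moreover have "tr B = 0"
        proof -
          have "tr B = (\<Sum>i<2 ^ m. M $$ (pemb m 1 i, pemb m 1 i))" by (simp add: tr_def M(2) even_part_def)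
          also have "\<dots> = (\<Sum>a<2 ^ ?n. if zsgn ?n a = 1 then M $$ (a, a) else 0)" by (rule sum_pemb)
          \<comment> \<open>The indicator of even parity is (1 + zsgn)/2, so the trace of the even
            block is the mean of tr M and the trace against Z...Z, both of which vanish.\<close>
          also have "\<dots> = (\<Sum>a<2 ^ ?n. 1 / 2 * (M $$ (a, a) + zsgn ?n a * M $$ (a, a)))"
          proof (intro sum.cong refl)
            fix a
            show "(if zsgn ?n a = 1 then M $$ (a, a) else 0) = 1 / 2 * (M $$ (a, a) + zsgn ?n a * M $$ (a, a))"
              using zsgn_cases[of ?n a] by auto
          qed
          also have "\<dots> = 1 / 2 * (tr M + (\<Sum>a<2 ^ ?n. zsgn ?n a * M $$ (a, a)))"
            unfolding sum_distrib_left[symmetric] sum.distrib tr_def using E(1)[OF M(1)] by (simp del: power_Suc)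
          finally show ?thesis using E(3,6)[OF M(1)] by simp
        qed
        ultimately show "B \<in> su (2 ^ m)" by (simp add: su_iff)
      qed
      show "su (2 ^ m) \<subseteq> even_part m ` ?L"
      proof
        fix B
        assume B: "B \<in> su (2 ^ m)"
        then have "B \<in> carrier_mat (2 ^ m) (2 ^ m)" by (simp add: su_iff skew_def)
        then show "B \<in> even_part m ` ?L"
          using spread_in_commutant[OF m B] even_part_spread by (intro image_eqI[of _ _ "spread m B"]) simp_all
      qed
    qed
  qed
  show "even_part m (x + y) = even_part m x + even_part m y" if "x \<in> ?L" "y \<in> ?L" for x y
    using E(1)[OF that(1)] E(1)[OF that(2)] p by (intro eq_matI) (auto simp: even_part_def)
  show "even_part m (complex_of_real r \<cdot>\<^sub>m x) = complex_of_real r \<cdot>\<^sub>m even_part m x" if "x \<in> ?L" for r x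
    using E(1)[OF that(1)] p by (intro eq_matI) (auto simp: even_part_def)
  show "even_part m (comm x y) = comm (even_part m x) (even_part m y)" if xy: "x \<in> ?L" "y \<in> ?L" for x y
  proof -
    have c: "x \<in> carrier_mat (2 ^ ?n) (2 ^ ?n)" "y \<in> carrier_mat (2 ^ ?n) (2 ^ ?n)" using E(1) xy by blast+
    have cc: "x * y \<in> carrier_mat (2 ^ ?n) (2 ^ ?n)" "y * x \<in> carrier_mat (2 ^ ?n) (2 ^ ?n)"
      using mult_carrier_square c by blast+
    have "even_part m (x * y - y * x) = even_part m (x * y) - even_part m (y * x)"
      by (rule even_part_minus[OF cc])
    moreover have "even_part m (x * y) = even_part m x * even_part m y"
      by (rule even_part_mult[OF c]) (use E(4)[OF xy(1)] in blast)
    moreover have "even_part m (y * x) = even_part m y * even_part m x"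
      by (rule even_part_mult[OF c(2,1)]) (use E(4)[OF xy(2)] in blast)
    ultimately show ?thesis by (simp add: comm_def)
  qed
qed

section \<open>Direct sums of commuting copies\<close>

definition lie_algebra :: "nat \<Rightarrow> complex mat set \<Rightarrow> bool" where
  "lie_algebra K L \<longleftrightarrow> L \<subseteq> carrier_mat K K \<and> 0\<^sub>m K K \<in> L
    \<and> (\<forall>x\<in>L. \<forall>y\<in>L. x + y \<in> L \<and> comm x y \<in> L)
    \<and> (\<forall>x\<in>L. \<forall>r. complex_of_real r \<cdot>\<^sub>m x \<in> L)"

lemma tr_comm_zero: "x \<in> carrier_mat N N \<Longrightarrow> y \<in> carrier_mat N N \<Longrightarrow> tr (comm x y) = 0"
  unfolding comm_def using tr_minus[of "x * y" N "y * x"] tr_comm[of x N N y] by simp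

lemma lie_algebra_su: "lie_algebra K (su K)"
  unfolding lie_algebra_def
proof (intro conjI ballI allI)
  show "su K \<subseteq> carrier_mat K K" by (auto simp: su_iff skew_def)
  show "0\<^sub>m K K \<in> su K" by (simp add: su_iff skew_zero tr_def)
  fix x
  assume x: "x \<in> su K"
  then have c: "x \<in> carrier_mat K K" by (auto simp: su_iff skew_def)
  show "complex_of_real r \<cdot>\<^sub>m x \<in> su K" for r using x skew_smult tr_smult[OF c] by (simp add: su_iff)
  fix y
  assume y: "y \<in> su K"
  then have "y \<in> carrier_mat K K" by (auto simp: su_iff skew_def)
  with c x y show "x + y \<in> su K" "comm x y \<in> su K"
    using skew_add skew_comm by (simp_all add: su_iff tr_add[of _ K] tr_comm_zero)
qed

lemma u1_skew: "u1 = skew 1"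
proof -
  have "M \<in> u1 \<longleftrightarrow> M \<in> skew 1" for M
  proof -
    have "Re z = 0 \<longleftrightarrow> z = - cnj z" for z by (auto simp: complex_eq_iff)
    then show ?thesis unfolding u1_def skew_iff by simp
  qed
  then show ?thesis by blast
qed

lemma lie_algebra_u1: "lie_algebra 1 u1"
proof -
  have "skew 1 \<subseteq> carrier_mat 1 1" unfolding skew_def by blast
  then show ?thesis
    unfolding lie_algebra_def u1_skew using skew_zero skew_add skew_smult skew_comm by blast
qed

lemma block_carrier [simp]: "block K B k \<in> carrier_mat K K"
  by (simp add: block_def)

lemma block_eqI:
  assumes "B \<in> carrier_mat (m * K) (m * K)" "C \<in> carrier_mat (m * K) (m * K)"
    "block_diag m K B" "block_diag m K C" "\<And>k. k < m \<Longrightarrow> block K B k = block K C k"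
  shows "B = C"
proof (rule eq_matI)
  fix i j
  assume "i < dim_row C" "j < dim_col C"
  then have ij: "i < m * K" "j < m * K" using assms by auto
  obtain k a where i: "k < m" "a < K" "i = k * K + a" using block_indexE ij(1) by blast
  obtain l b where j: "l < m" "b < K" "j = l * K + b" using block_indexE ij(2) by blast
  show "B $$ (i, j) = C $$ (i, j)"
  proof (cases "l = k")
    case True
    have "block K B k $$ (a, b) = block K C k $$ (a, b)" using assms(5) i by simp
    then show ?thesis using i j True by (simp add: block_def)
  next
    case False
    then have "i div K \<noteq> j div K" using i j by simp
    then have "B $$ (i, j) = 0" "C $$ (i, j) = 0"
      using assms(3,4) ij unfolding block_diag_def by blast+
    then show ?thesis by simp
  qed
qed (use assms in auto)

lemma block_diag_mult:
  assumes "B \<in> carrier_mat (m * K) (m * K)" "C \<in> carrier_mat (m * K) (m * K)"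
    "block_diag m K B" "block_diag m K C"
  shows "block_diag m K (B * C)"
  unfolding block_diag_def
proof (intro allI impI)
  fix i j
  assume ij: "i < m * K" "j < m * K" "i div K \<noteq> j div K"
  have "(B * C) $$ (i, j) = (\<Sum>c<m * K. B $$ (i, c) * C $$ (c, j))"
    by (rule mult_mat_index[OF assms(1,2) ij(1,2)])
  also have "\<dots> = 0"
  proof (intro sum.neutral ballI)
    fix c
    assume "c \<in> {..<m * K}"
    then have c: "c < m * K" by simp
    show "B $$ (i, c) * C $$ (c, j) = 0"
    proof (cases "i div K = c div K")
      case True
      then have "C $$ (c, j) = 0" using assms(4) ij c unfolding block_diag_def by metis
      then show ?thesis by simp
    next
      case False
      then have "B $$ (i, c) = 0" using assms(3) ij c unfolding block_diag_def by metis
      then show ?thesis by simp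
    qed
  qed
  finally show "(B * C) $$ (i, j) = 0" .
qed

lemma block_mult:
  assumes "B \<in> carrier_mat (m * K) (m * K)" "C \<in> carrier_mat (m * K) (m * K)"
    "block_diag m K B" "k < m"
  shows "block K (B * C) k = block K B k * block K C k"
proof (rule eq_matI)
  fix a b
  assume "a < dim_row (block K B k * block K C k)" "b < dim_col (block K B k * block K C k)"
  then have ab: "a < K" "b < K" by (auto simp: block_def)
  have lt: "k * K + a < m * K" "k * K + b < m * K" using block_index_less assms(4) ab by blast+
  have "block K (B * C) k $$ (a, b) = (\<Sum>c<m * K. B $$ (k * K + a, c) * C $$ (c, k * K + b))"
    using ab mult_mat_index[OF assms(1,2) lt] by (simp add: block_def del: index_mult_mat(1))
  also have "\<dots> = (\<Sum>l<m. \<Sum>c<K. B $$ (k * K + a, l * K + c) * C $$ (l * K + c, k * K + b))"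
    by (rule sum_blocks)
  also have "\<dots> = (\<Sum>l<m. if l = k then \<Sum>c<K. B $$ (k * K + a, k * K + c) * C $$ (k * K + c, k * K + b) else 0)"
  proof (intro sum.cong refl)
    fix l
    assume "l \<in> {..<m}"
    then have l: "l < m" by simp
    have "(\<Sum>c<K. B $$ (k * K + a, l * K + c) * C $$ (l * K + c, k * K + b)) = 0" if "l \<noteq> k"
    proof (intro sum.neutral ballI)
      fix c
      assume "c \<in> {..<K}"
      then have "c < K" by simp
      moreover from this have "l * K + c < m * K" using block_index_less l by blast
      ultimately have "B $$ (k * K + a, l * K + c) = 0"
        using assms(3) lt(1) that ab unfolding block_diag_def by auto
      then show "B $$ (k * K + a, l * K + c) * C $$ (l * K + c, k * K + b) = 0" by simp
    qed
    then show "(\<Sum>c<K. B $$ (k * K + a, l * K + c) * C $$ (l * K + c, k * K + b)) =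
      (if l = k then \<Sum>c<K. B $$ (k * K + a, k * K + c) * C $$ (k * K + c, k * K + b) else 0)" by auto
  qed
  also have "\<dots> = (\<Sum>c<K. B $$ (k * K + a, k * K + c) * C $$ (k * K + c, k * K + b))"
    using assms(4) by simp
  also have "\<dots> = (\<Sum>c<K. block K B k $$ (a, c) * block K C k $$ (c, b))"
    using ab by (intro sum.cong) (auto simp: block_def)
  also have "\<dots> = (block K B k * block K C k) $$ (a, b)"
    using ab by (intro mult_mat_index[symmetric]) auto
  finally show "block K (B * C) k $$ (a, b) = (block K B k * block K C k) $$ (a, b)" .
qed (simp_all add: block_def)

lemma block_add:
  assumes "B \<in> carrier_mat (m * K) (m * K)" "C \<in> carrier_mat (m * K) (m * K)" "k < m"
  shows "block K (B + C) k = block K B k + block K C k"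
  using assms block_index_less[of k m _ K] by (intro eq_matI) (auto simp: block_def)

lemma block_minus:
  assumes "B \<in> carrier_mat (m * K) (m * K)" "C \<in> carrier_mat (m * K) (m * K)" "k < m"
  shows "block K (B - C) k = block K B k - block K C k"
  using assms block_index_less[of k m _ K] by (intro eq_matI) (auto simp: block_def)

lemma block_smult:
  assumes "B \<in> carrier_mat (m * K) (m * K)" "k < m"
  shows "block K (r \<cdot>\<^sub>m B) k = r \<cdot>\<^sub>m block K B k"
  using assms block_index_less[of k m _ K] by (intro eq_matI) (auto simp: block_def)

lemma block_comm:
  assumes "B \<in> carrier_mat (m * K) (m * K)" "C \<in> carrier_mat (m * K) (m * K)"
    "block_diag m K B" "block_diag m K C" "k < m"
  shows "block K (comm B C) k = comm (block K B k) (block K C k)"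
  unfolding comm_def
  using block_minus[of "B * C" m K "C * B" k] block_mult[OF assms(1,2,3,5)] block_mult[OF assms(2,1,4,5)] assms
  by simp

lemma lie_algebra_dsum:
  assumes "lie_algebra K L"
  shows "lie_algebra (m * K) (dsum m K L)"
  unfolding lie_algebra_def
proof (intro conjI ballI allI)
  have L: "0\<^sub>m K K \<in> L" "\<And>x y. x \<in> L \<Longrightarrow> y \<in> L \<Longrightarrow> x + y \<in> L" "\<And>x y. x \<in> L \<Longrightarrow> y \<in> L \<Longrightarrow> comm x y \<in> L"
    "\<And>x r. x \<in> L \<Longrightarrow> complex_of_real r \<cdot>\<^sub>m x \<in> L"
    using assms unfolding lie_algebra_def by blast+
  show "dsum m K L \<subseteq> carrier_mat (m * K) (m * K)" by (auto simp: dsum_iff)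
  have "block K (0\<^sub>m (m * K) (m * K)) k = 0\<^sub>m K K" if "k < m" for k
    using block_index_less[OF that, of _ K] by (intro eq_matI) (auto simp: block_def)
  then show "0\<^sub>m (m * K) (m * K) \<in> dsum m K L" using L(1) by (simp add: dsum_iff block_diag_def)
  fix x
  assume "x \<in> dsum m K L"
  then have x: "x \<in> carrier_mat (m * K) (m * K)" "block_diag m K x" "\<And>k. k < m \<Longrightarrow> block K x k \<in> L"
    by (auto simp: dsum_iff)
  show "complex_of_real r \<cdot>\<^sub>m x \<in> dsum m K L" for r
    unfolding dsum_iff using x L(4) by (auto simp: block_smult[OF x(1)] block_diag_def)
  fix y
  assume "y \<in> dsum m K L"
  then have y: "y \<in> carrier_mat (m * K) (m * K)" "block_diag m K y" "\<And>k. k < m \<Longrightarrow> block K y k \<in> L"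
    by (auto simp: dsum_iff)
  show "x + y \<in> dsum m K L"
    unfolding dsum_iff using x y L(2) by (auto simp: block_add[OF x(1) y(1)] block_diag_def)
  have "block_diag m K (comm x y)"
    using block_diag_mult[OF x(1) y(1) x(2) y(2)] block_diag_mult[OF y(1) x(1) y(2) x(2)] x(1) y(1)
    unfolding block_diag_def comm_def by (simp del: index_mult_mat(1))
  then show "comm x y \<in> dsum m K L"
    unfolding dsum_iff using x y L(3) by (auto simp: block_comm[OF x(1) y(1) x(2) y(2)])
qed

text \<open>The map is built from the model D into the generated algebra, where it has an explicit
  formula, and then inverted. Surjectivity is the induction over the closure, since the image
  contains the generators and is closed under all operations.\<close>

lemma lie_closure_iso:
  assumes D: "lie_algebra K D"
    and add: "\<And>x y. x \<in> D \<Longrightarrow> y \<in> D \<Longrightarrow> g (x + y) = g x + g y"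
    and smult: "\<And>r x. x \<in> D \<Longrightarrow> g (complex_of_real r \<cdot>\<^sub>m x) = complex_of_real r \<cdot>\<^sub>m g x"
    and comm: "\<And>x y. x \<in> D \<Longrightarrow> y \<in> D \<Longrightarrow> g (comm x y) = comm (g x) (g y)"
    and zero: "g (0\<^sub>m K K) = 0\<^sub>m N N"
    and inj: "inj_on g D"
    and gens: "S \<subseteq> g ` D" and im: "g ` D \<subseteq> lie_closure N S"
  shows "lie_closure N S \<cong>\<^sub>L D"
proof -
  have closed: "0\<^sub>m K K \<in> D" "\<And>x y. x \<in> D \<Longrightarrow> y \<in> D \<Longrightarrow> x + y \<in> D" "\<And>x y. x \<in> D \<Longrightarrow> y \<in> D \<Longrightarrow> comm x y \<in> D"
    "\<And>x r. x \<in> D \<Longrightarrow> complex_of_real r \<cdot>\<^sub>m x \<in> D"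
    using D unfolding lie_algebra_def by blast+
  have "y \<in> g ` D" if "y \<in> lie_closure N S" for y
    using that
  proof induction
    case (gen x)
    then show ?case using gens by blast
  next
    case zero
    show ?case by (rule image_eqI[where x = "0\<^sub>m K K"]) (simp_all add: \<open>g (0\<^sub>m K K) = 0\<^sub>m N N\<close> closed(1))
  next
    case (add x y)
    then obtain x' y' where xy: "x = g x'" "y = g y'" "x' \<in> D" "y' \<in> D" by blast
    show ?case
      unfolding xy(1,2) by (rule image_eqI[where f = g, OF assms(2)[symmetric, OF xy(3,4)] closed(2)[OF xy(3,4)]])
  next
    case (smult x r)
    then obtain x' where x: "x = g x'" "x' \<in> D" by blast
    show ?case
      unfolding x(1) by (rule image_eqI[where f = g, OF assms(3)[symmetric, OF x(2)] closed(4)[OF x(2)]])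
  next
    case (bracket x y)
    then obtain x' y' where xy: "x = g x'" "y = g y'" "x' \<in> D" "y' \<in> D" by blast
    show ?case
      unfolding xy(1,2) by (rule image_eqI[where f = g, OF assms(4)[symmetric, OF xy(3,4)] closed(3)[OF xy(3,4)]])
  qed
  with im have eq: "g ` D = lie_closure N S" by blast
  have pre: "\<exists>x'\<in>D. x = g x'" if "x \<in> lie_closure N S" for x
    using that unfolding eq[symmetric] by blast
  let ?f = "inv_into D g"
  have f: "?f (g x) = x" if "x \<in> D" for x using inj that by simp
  show ?thesis
  proof (rule lie_isoI[of ?f])
    have "bij_betw g D (lie_closure N S)" using inj eq by (simp add: bij_betw_def)
    then show "bij_betw ?f (lie_closure N S) D" by (rule bij_betw_inv_into)
    show "?f (x + y) = ?f x + ?f y" if mem: "x \<in> lie_closure N S" "y \<in> lie_closure N S" for x y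
    proof -
      obtain x' y' where xy: "x = g x'" "y = g y'" "x' \<in> D" "y' \<in> D" using pre mem by metis
      have "x + y = g (x' + y')" unfolding xy(1,2) by (rule add[symmetric, OF xy(3,4)])
      then show ?thesis using f[OF closed(2)[OF xy(3,4)]] f[OF xy(3)] f[OF xy(4)] xy(1,2) by simp
    qed
    show "?f (complex_of_real r \<cdot>\<^sub>m x) = complex_of_real r \<cdot>\<^sub>m ?f x" if mem: "x \<in> lie_closure N S" for r x
    proof -
      obtain x' where x: "x = g x'" "x' \<in> D" using pre mem by metis
      have "complex_of_real r \<cdot>\<^sub>m x = g (complex_of_real r \<cdot>\<^sub>m x')"
        unfolding x(1) by (rule smult[symmetric, OF x(2)])
      then show ?thesis using f[OF closed(4)[OF x(2)]] f[OF x(2)] x(1) by simp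
    qed
    show "?f (comm x y) = comm (?f x) (?f y)" if mem: "x \<in> lie_closure N S" "y \<in> lie_closure N S" for x y
    proof -
      obtain x' y' where xy: "x = g x'" "y = g y'" "x' \<in> D" "y' \<in> D" using pre mem by metis
      have "comm x y = g (comm x' y')" unfolding xy(1,2) by (rule comm[symmetric, OF xy(3,4)])
      then show ?thesis using f[OF closed(3)[OF xy(3,4)]] f[OF xy(3)] f[OF xy(4)] xy(1,2) by simp
    qed
  qed
qed

text \<open>\<open>G k\<close> places an element of L into the k-th copy. \<open>G_indep\<close>
  makes the sum of the copies direct; together with commutation of different copies this yields an
  embedding of the direct sum.\<close>

locale commuting_copies =
  fixes m K N :: nat and L :: "complex mat set" and G :: "nat \<Rightarrow> complex mat \<Rightarrow> complex mat" and S :: "complex mat set"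
  assumes L: "lie_algebra K L"
    and G_carrier: "\<And>k A. G k A \<in> carrier_mat N N"
    and G_add: "\<And>k A B. k < m \<Longrightarrow> A \<in> L \<Longrightarrow> B \<in> L \<Longrightarrow> G k (A + B) = G k A + G k B"
    and G_smult: "\<And>k r A. k < m \<Longrightarrow> A \<in> L \<Longrightarrow> G k (complex_of_real r \<cdot>\<^sub>m A) = complex_of_real r \<cdot>\<^sub>m G k A"
    and G_comm: "\<And>k A B. k < m \<Longrightarrow> A \<in> L \<Longrightarrow> B \<in> L \<Longrightarrow> G k (comm A B) = comm (G k A) (G k B)"
    and G_commute: "\<And>k l A B. k < m \<Longrightarrow> l < m \<Longrightarrow> k \<noteq> l \<Longrightarrow> A \<in> L \<Longrightarrow> B \<in> L \<Longrightarrow> G k A * G l B = G l B * G k A"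
    and G_indep: "\<And>A B k. (\<And>k. k < m \<Longrightarrow> A k \<in> L \<and> B k \<in> L) \<Longrightarrow>
        (\<And>a b. a < N \<Longrightarrow> b < N \<Longrightarrow> (\<Sum>k<m. G k (A k) $$ (a, b)) = (\<Sum>k<m. G k (B k) $$ (a, b))) \<Longrightarrow> k < m \<Longrightarrow> A k = B k"
    and G_gens: "\<And>x. x \<in> S \<Longrightarrow> \<exists>k<m. \<exists>A\<in>L. x = G k A"
    and G_im: "\<And>k A. k < m \<Longrightarrow> A \<in> L \<Longrightarrow> G k A \<in> lie_closure N S"
begin

definition total :: "complex mat \<Rightarrow> complex mat" where
  "total B = mat N N (\<lambda>(a, b). \<Sum>k<m. G k (block K B k) $$ (a, b))"

lemma G_zero: "k < m \<Longrightarrow> G k (0\<^sub>m K K) = 0\<^sub>m N N"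
proof -
  assume k: "k < m"
  have "0\<^sub>m K K \<in> L" using L by (simp add: lie_algebra_def)
  then have "G k (complex_of_real 0 \<cdot>\<^sub>m 0\<^sub>m K K) = complex_of_real 0 \<cdot>\<^sub>m G k (0\<^sub>m K K)" using G_smult k by blast
  moreover have "complex_of_real 0 \<cdot>\<^sub>m 0\<^sub>m K K = 0\<^sub>m K K" by (intro eq_matI) auto
  moreover have "complex_of_real 0 \<cdot>\<^sub>m G k (0\<^sub>m K K) = 0\<^sub>m N N" using G_carrier[of k "0\<^sub>m K K"] by (intro eq_matI) auto
  ultimately show ?thesis by simp
qed

lemma total_mult:
  assumes "a < N" "b < N"
  shows "(total B * total C) $$ (a, b) = (\<Sum>k<m. \<Sum>l<m. (G k (block K B k) * G l (block K C l)) $$ (a, b))"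
proof -
  have t: "total D \<in> carrier_mat N N" for D by (simp add: total_def)
  have "(total B * total C) $$ (a, b) = (\<Sum>c<N. (\<Sum>k<m. G k (block K B k) $$ (a, c)) * (\<Sum>l<m. G l (block K C l) $$ (c, b)))"
    unfolding mult_mat_index[OF t t assms] using assms by (intro sum.cong) (auto simp: total_def)
  also have "\<dots> = (\<Sum>c<N. \<Sum>k<m. \<Sum>l<m. G k (block K B k) $$ (a, c) * G l (block K C l) $$ (c, b))"
    by (simp only: sum_product)
  also have "\<dots> = (\<Sum>k<m. \<Sum>c<N. \<Sum>l<m. G k (block K B k) $$ (a, c) * G l (block K C l) $$ (c, b))"
    by (rule sum.swap)
  also have "\<dots> = (\<Sum>k<m. \<Sum>l<m. \<Sum>c<N. G k (block K B k) $$ (a, c) * G l (block K C l) $$ (c, b))"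
    by (intro sum.cong refl sum.swap)
  also have "\<dots> = (\<Sum>k<m. \<Sum>l<m. (G k (block K B k) * G l (block K C l)) $$ (a, b))"
    by (simp only: mult_mat_index[OF G_carrier G_carrier assms])
  finally show ?thesis .
qed

lemma total_comm:
  assumes B: "B \<in> dsum m K L" and C: "C \<in> dsum m K L"
  shows "total (comm B C) = comm (total B) (total C)"
proof (rule eq_matI)
  fix a b
  assume "a < dim_row (comm (total B) (total C))" "b < dim_col (comm (total B) (total C))"
  then have ab: "a < N" "b < N" by (auto simp: comm_def total_def)
  have BC: "B \<in> carrier_mat (m * K) (m * K)" "block_diag m K B" "C \<in> carrier_mat (m * K) (m * K)" "block_diag m K C"
    "\<And>k. k < m \<Longrightarrow> block K B k \<in> L" "\<And>k. k < m \<Longrightarrow> block K C k \<in> L"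
    using B C by (auto simp: dsum_iff)
  let ?P = "\<lambda>k l. (G k (block K B k) * G l (block K C l)) $$ (a, b)"
  let ?Q = "\<lambda>k l. (G l (block K C l) * G k (block K B k)) $$ (a, b)"
  have "comm (total B) (total C) $$ (a, b) = (total B * total C) $$ (a, b) - (total C * total B) $$ (a, b)"
    using ab by (simp add: comm_def total_def del: index_mult_mat(1))
  also have "\<dots> = (\<Sum>k<m. \<Sum>l<m. ?P k l) - (\<Sum>l<m. \<Sum>k<m. ?Q k l)"
    unfolding total_mult[OF ab] ..
  also have "(\<Sum>l<m. \<Sum>k<m. ?Q k l) = (\<Sum>k<m. \<Sum>l<m. ?Q k l)" by (rule sum.swap)
  also have "(\<Sum>k<m. \<Sum>l<m. ?P k l) - (\<Sum>k<m. \<Sum>l<m. ?Q k l) = (\<Sum>k<m. \<Sum>l<m. ?P k l - ?Q k l)"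
    by (simp only: sum_subtractf)
  \<comment> \<open>Images of different copies commute, so all cross terms cancel between the two
    products.\<close>
  also have "\<dots> = (\<Sum>k<m. \<Sum>l<m. if l = k then ?P k k - ?Q k k else 0)"
    using G_commute BC(5,6) by (intro sum.cong refl) (auto simp del: index_mult_mat(1))
  also have "\<dots> = (\<Sum>k<m. ?P k k - ?Q k k)"
    by (intro sum.cong refl) (simp del: index_mult_mat(1))
  also have "\<dots> = (\<Sum>k<m. G k (block K (comm B C) k) $$ (a, b))"
  proof (intro sum.cong refl)
    fix k
    assume "k \<in> {..<m}"
    then have k: "k < m" by simp
    have "G k (block K (comm B C) k) = comm (G k (block K B k)) (G k (block K C k))"
      unfolding block_comm[OF BC(1,3,2,4) k] using G_comm k BC(5,6) by blast
    then show "?P k k - ?Q k k = G k (block K (comm B C) k) $$ (a, b)"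
      using ab G_carrier[of k "block K B k"] G_carrier[of k "block K C k"] by (simp add: comm_def del: index_mult_mat(1))
  qed
  finally show "total (comm B C) $$ (a, b) = comm (total B) (total C) $$ (a, b)"
    using ab by (simp add: total_def)
qed (simp_all add: total_def comm_def)

theorem iso_dsum: "lie_closure N S \<cong>\<^sub>L dsum m K L"
proof (rule lie_closure_iso[OF lie_algebra_dsum[OF L], where g = total])
  fix B C
  assume B: "B \<in> dsum m K L" and C: "C \<in> dsum m K L"
  have BC: "B \<in> carrier_mat (m * K) (m * K)" "C \<in> carrier_mat (m * K) (m * K)"
    "\<And>k. k < m \<Longrightarrow> block K B k \<in> L" "\<And>k. k < m \<Longrightarrow> block K C k \<in> L"
    using B C by (auto simp: dsum_iff)
  show "total (B + C) = total B + total C"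
    using G_carrier BC
    by (intro eq_matI) (simp_all add: total_def block_add[OF BC(1,2)] G_add carrier_matD[OF G_carrier] flip: sum.distrib)
  show "total (comm B C) = comm (total B) (total C)" by (rule total_comm[OF B C])
next
  fix r B
  assume B: "B \<in> dsum m K L"
  then have B': "B \<in> carrier_mat (m * K) (m * K)" "\<And>k. k < m \<Longrightarrow> block K B k \<in> L" by (auto simp: dsum_iff)
  show "total (complex_of_real r \<cdot>\<^sub>m B) = complex_of_real r \<cdot>\<^sub>m total B"
    using B' by (intro eq_matI)
      (simp_all add: total_def block_smult[OF B'(1)] G_smult carrier_matD[OF G_carrier] sum_distrib_left)
next
  have "block K (0\<^sub>m (m * K) (m * K)) k = 0\<^sub>m K K" if "k < m" for k
    using block_index_less[OF that, of _ K] by (intro eq_matI) (auto simp: block_def)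
  then show "total (0\<^sub>m (m * K) (m * K)) = 0\<^sub>m N N"
    by (intro eq_matI) (simp_all add: total_def G_zero)
next
  show "inj_on total (dsum m K L)"
  proof (rule inj_onI)
    fix B C
    assume B: "B \<in> dsum m K L" and C: "C \<in> dsum m K L" and eq: "total B = total C"
    have BC: "\<And>k. k < m \<Longrightarrow> block K B k \<in> L \<and> block K C k \<in> L" using B C by (auto simp: dsum_iff)
    have sums: "(\<Sum>k<m. G k (block K B k) $$ (a, b)) = (\<Sum>k<m. G k (block K C k) $$ (a, b))" if "a < N" "b < N" for a b
    proof -
      have "total B $$ (a, b) = total C $$ (a, b)" using eq by simp
      then show ?thesis using that by (simp add: total_def)
    qed
    have "block K B k = block K C k" if "k < m" for k
      using G_indep[of "block K B" "block K C" k, OF BC sums that] by blast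
    then show "B = C" using B C by (intro block_eqI[of B m K C]) (auto simp: dsum_iff)
  qed
next
  show "S \<subseteq> total ` dsum m K L"
  proof
    fix x
    assume "x \<in> S"
    then obtain k A where k: "k < m" and A: "A \<in> L" and x: "x = G k A" using G_gens by blast
    have c: "A \<in> carrier_mat K K" and z: "0\<^sub>m K K \<in> L" using A L by (auto simp: lie_algebra_def)
    \<comment> \<open>The block matrix with \<open>A\<close> in block \<open>k\<close> and zeros
      elsewhere is the preimage of the generator \<open>G k A\<close>.\<close>
    define B where "B = mat (m * K) (m * K) (\<lambda>(i, j). if i div K = k \<and> j div K = k then A $$ (i mod K, j mod K) else 0)"
    have blocks: "block K B l = (if l = k then A else 0\<^sub>m K K)" if "l < m" for l
      using block_index_less[OF that, of _ K] c by (intro eq_matI) (auto simp: block_def B_def)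
    have "B \<in> dsum m K L" unfolding dsum_iff using blocks A z by (auto simp: B_def block_diag_def)
    moreover have "total B = x"
    proof (rule eq_matI)
      fix a b
      assume "a < dim_row x" "b < dim_col x"
      then have ab: "a < N" "b < N" using G_carrier[of k A] x by auto
      have "G l (block K B l) $$ (a, b) = (if l = k then x $$ (a, b) else 0)" if "l < m" for l
        using blocks[OF that] ab G_zero[OF that] by (simp add: x)
      then have "(\<Sum>l<m. G l (block K B l) $$ (a, b)) = (\<Sum>l<m. if l = k then x $$ (a, b) else 0)"
        by (intro sum.cong) auto
      moreover have "total B $$ (a, b) = (\<Sum>l<m. G l (block K B l) $$ (a, b))"
        using ab by (simp add: total_def)
      ultimately show "total B $$ (a, b) = x $$ (a, b)" using k by simp
    qed (use G_carrier[of k A] x in \<open>auto simp: total_def\<close>)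
    ultimately show "x \<in> total ` dsum m K L" by blast
  qed
next
  show "total ` dsum m K L \<subseteq> lie_closure N S"
  proof
    fix x
    assume "x \<in> total ` dsum m K L"
    then obtain B where B: "B \<in> dsum m K L" "x = total B" by blast
    have "\<And>k. k < m \<Longrightarrow> block K B k \<in> L" using B by (auto simp: dsum_iff)
    then show "x \<in> lie_closure N S"
      unfolding B(2) total_def by (intro lie_closure_sum) (auto simp: G_carrier G_im)
  qed
qed

end

section \<open>Abelian algebras\<close>

definition xstr :: "nat set \<Rightarrow> nat \<Rightarrow> pauli" where
  "xstr K = (\<lambda>j. if j \<in> K then PX else PI)"

lemma xstr_commute: "pstr n (xstr K) * pstr n (xstr K') = pstr n (xstr K') * pstr n (xstr K)"
proof -
  have "\<not> acomm n (xstr K) (xstr K')"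
    unfolding not_acomm_iff by (intro prod.neutral) (auto simp: xstr_def sg_def ac_def)
  then show ?thesis using pstr_commute[of n "xstr K" "xstr K'"] by (auto intro!: eq_matI)
qed

lemma tr_xstr:
  assumes "K \<subseteq> {..<n}" "K' \<subseteq> {..<n}"
  shows "tr (pstr n (xstr K) * pstr n (xstr K')) = (if K = K' then 2 ^ n else 0)"
proof (cases "K = K'")
  case True
  then show ?thesis by (simp add: pstr_square tr_def)
next
  case False
  then obtain j where "j < n" "j \<in> K \<longleftrightarrow> j \<notin> K'" using assms by blast
  then have "xstr K j \<noteq> xstr K' j" by (auto simp: xstr_def)
  then show ?thesis using tr_pstr_mult[OF \<open>j < n\<close>] False by simp
qed

text \<open>Strings of X's commute, so the algebra is the real span of its generators. Distinct
  strings are orthogonal for the trace, which gives independence and hence one copy of u(1) per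
  string.\<close>

lemma abelian_iso:
  assumes F: "F \<subseteq> Pow {..<n}" and card: "card F = m"
  shows "lie_closure (2 ^ n) ((\<lambda>K. \<i> \<cdot>\<^sub>m pstr n (xstr K)) ` F) \<cong>\<^sub>L dsum m 1 u1"
proof -
  have "finite F" using F finite_subset by blast
  then obtain e where e: "bij_betw e {0..<m} F" using card ex_bij_betw_nat_finite by blast
  have eF: "e k \<in> F" "e k \<subseteq> {..<n}" if "k < m" for k
  proof -
    show "e k \<in> F" using bij_betwE[OF e] that by simp
    then show "e k \<subseteq> {..<n}" using F by blast
  qed
  have e_eq: "e k = e l \<longleftrightarrow> k = l" if "k < m" "l < m" for k l
    using e that by (auto simp: bij_betw_def inj_on_def)
  let ?P = "\<lambda>k. pstr n (xstr (e k))"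
  let ?S = "(\<lambda>K. \<i> \<cdot>\<^sub>m pstr n (xstr K)) ` F"
  have u: "A \<in> carrier_mat 1 1" "Re (A $$ (0, 0)) = 0" if "A \<in> u1" for A using that by (auto simp: u1_def)
  interpret commuting_copies m 1 "2 ^ n" u1 "\<lambda>k A. A $$ (0, 0) \<cdot>\<^sub>m ?P k" ?S
  proof
    show "lie_algebra 1 u1" by (rule lie_algebra_u1)
    show "A $$ (0, 0) \<cdot>\<^sub>m ?P k \<in> carrier_mat (2 ^ n) (2 ^ n)" for k A by simp
    show "(A + B) $$ (0, 0) \<cdot>\<^sub>m ?P k = A $$ (0, 0) \<cdot>\<^sub>m ?P k + B $$ (0, 0) \<cdot>\<^sub>m ?P k" if "A \<in> u1" "B \<in> u1" for k A B
      using u(1)[OF that(1)] u(1)[OF that(2)] by (intro eq_matI) (auto simp: distrib_right)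
    show "(complex_of_real r \<cdot>\<^sub>m A) $$ (0, 0) \<cdot>\<^sub>m ?P k = complex_of_real r \<cdot>\<^sub>m (A $$ (0, 0) \<cdot>\<^sub>m ?P k)" if "A \<in> u1" for k r A
      using u(1)[OF that] by (intro eq_matI) auto
    have mult: "(x \<cdot>\<^sub>m ?P k) * (y \<cdot>\<^sub>m ?P l) = (x * y) \<cdot>\<^sub>m (?P k * ?P l)" for x y k l
      unfolding mult_smult_assoc_mat[OF pstr_carrier smult_carrier_mat[OF pstr_carrier]]
        mult_smult_distrib[OF pstr_carrier pstr_carrier]
      by (intro eq_matI) (auto simp: mult.assoc)
    show "comm A B $$ (0, 0) \<cdot>\<^sub>m ?P k = comm (A $$ (0, 0) \<cdot>\<^sub>m ?P k) (B $$ (0, 0) \<cdot>\<^sub>m ?P k)" if "A \<in> u1" "B \<in> u1" for k A B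
    proof -
      have "comm A B $$ (0, 0) = 0"
        using u(1)[OF that(1)] u(1)[OF that(2)] by (auto simp: comm_def scalar_prod_def)
      then show ?thesis unfolding comm_def mult by (intro eq_matI) (auto simp: mult.commute)
    qed
    show "A $$ (0, 0) \<cdot>\<^sub>m ?P k * (B $$ (0, 0) \<cdot>\<^sub>m ?P l) = B $$ (0, 0) \<cdot>\<^sub>m ?P l * (A $$ (0, 0) \<cdot>\<^sub>m ?P k)" for k l A B
      unfolding mult xstr_commute[of n "e k" "e l"] by (simp add: mult.commute)
    show "\<exists>k<m. \<exists>A\<in>u1. x = A $$ (0, 0) \<cdot>\<^sub>m ?P k" if "x \<in> ?S" for x
    proof -
      have "x \<in> (\<lambda>K. \<i> \<cdot>\<^sub>m pstr n (xstr K)) ` e ` {0..<m}"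
        using that bij_betw_imp_surj_on[OF e] by simp
      then obtain k where "k < m" "x = \<i> \<cdot>\<^sub>m ?P k" by auto
      moreover have "mat 1 1 (\<lambda>_. \<i>) \<in> u1" by (simp add: u1_def)
      ultimately show ?thesis by (intro exI[of _ k] conjI bexI[of _ "mat 1 1 (\<lambda>_. \<i>)"]) auto
    qed
    show "A $$ (0, 0) \<cdot>\<^sub>m ?P k \<in> lie_closure (2 ^ n) ?S" if "k < m" "A \<in> u1" for k A
    proof -
      have "A $$ (0, 0) \<cdot>\<^sub>m ?P k = complex_of_real (Im (A $$ (0, 0))) \<cdot>\<^sub>m (\<i> \<cdot>\<^sub>m ?P k)"
        using u(2)[OF that(2)] by (intro eq_matI) (auto simp: complex_eq_iff)
      moreover have "complex_of_real (Im (A $$ (0, 0))) \<cdot>\<^sub>m (\<i> \<cdot>\<^sub>m ?P k) \<in> lie_closure (2 ^ n) ?S"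
        by (intro lie_closure.smult lie_closure.gen imageI eF(1)[OF that(1)])
      ultimately show ?thesis by simp
    qed
    fix A B :: "nat \<Rightarrow> complex mat" and k
    assume AB: "\<And>k. k < m \<Longrightarrow> A k \<in> u1 \<and> B k \<in> u1"
      and eq: "\<And>a b. a < 2 ^ n \<Longrightarrow> b < 2 ^ n \<Longrightarrow>
        (\<Sum>k<m. (A k $$ (0, 0) \<cdot>\<^sub>m ?P k) $$ (a, b)) = (\<Sum>k<m. (B k $$ (0, 0) \<cdot>\<^sub>m ?P k) $$ (a, b))"
      and k: "k < m"
    \<comment> \<open>The double sum is the trace against the k-th string, written out because
      equality is given entrywise; orthogonality isolates the k-th coefficient.\<close>
    have coeff: "(\<Sum>d<2 ^ n. \<Sum>c<2 ^ n. ?P k $$ (d, c) * (\<Sum>l<m. (A l $$ (0, 0) \<cdot>\<^sub>m ?P l) $$ (c, d))) = A k $$ (0, 0) * 2 ^ n"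
      for A :: "nat \<Rightarrow> complex mat"
    proof -
      have "(\<Sum>d<2 ^ n. \<Sum>c<2 ^ n. ?P k $$ (d, c) * (\<Sum>l<m. (A l $$ (0, 0) \<cdot>\<^sub>m ?P l) $$ (c, d)))
          = (\<Sum>d<2 ^ n. \<Sum>c<2 ^ n. \<Sum>l<m. A l $$ (0, 0) * (?P k $$ (d, c) * ?P l $$ (c, d)))"
        unfolding sum_distrib_left by (intro sum.cong refl) simp
      also have "\<dots> = (\<Sum>d<2 ^ n. \<Sum>l<m. \<Sum>c<2 ^ n. A l $$ (0, 0) * (?P k $$ (d, c) * ?P l $$ (c, d)))"
        by (intro sum.cong refl sum.swap)
      also have "\<dots> = (\<Sum>l<m. \<Sum>d<2 ^ n. \<Sum>c<2 ^ n. A l $$ (0, 0) * (?P k $$ (d, c) * ?P l $$ (c, d)))"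
        by (rule sum.swap)
      also have "\<dots> = (\<Sum>l<m. A l $$ (0, 0) * tr (?P k * ?P l))"
      proof (intro sum.cong refl)
        fix l
        have "tr (?P k * ?P l) = (\<Sum>d<2 ^ n. \<Sum>c<2 ^ n. ?P k $$ (d, c) * ?P l $$ (c, d))"
          unfolding tr_def by (intro sum.cong) (simp_all add: mult_mat_index[OF pstr_carrier pstr_carrier] del: index_mult_mat(1))
        then show "(\<Sum>d<2 ^ n. \<Sum>c<2 ^ n. A l $$ (0, 0) * (?P k $$ (d, c) * ?P l $$ (c, d))) = A l $$ (0, 0) * tr (?P k * ?P l)"
          by (simp only: sum_distrib_left)
      qed
      also have "\<dots> = (\<Sum>l<m. if l = k then A k $$ (0, 0) * 2 ^ n else 0)"
        using k by (intro sum.cong refl) (auto simp: tr_xstr eF e_eq)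
      also have "\<dots> = A k $$ (0, 0) * 2 ^ n" using k by simp
      finally show ?thesis .
    qed
    have "A k $$ (0, 0) * 2 ^ n = B k $$ (0, 0) * 2 ^ n"
      unfolding coeff[symmetric] by (intro sum.cong refl arg_cong2[of _ _ _ _ "(*)"] eq) auto
    then have "A k $$ (0, 0) = B k $$ (0, 0)" by simp
    then show "A k = B k" using u(1) AB[OF k] by (intro eq_matI) (auto dest!: u(1))
  qed
  show ?thesis by (rule iso_dsum)
qed

lemma pstr_xstr_pair: "i \<noteq> j \<Longrightarrow> pstr n (two PX PX i j) = pstr n (xstr {i, j})"
  by (intro pstr_cong) (auto simp: two_def xstr_def)

lemma pstr_xstr_single:
  "i \<noteq> j \<Longrightarrow> pstr n (two PX PI i j) = pstr n (xstr {i})"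
  "i \<noteq> j \<Longrightarrow> pstr n (two PI PX i j) = pstr n (xstr {j})"
  by (intro pstr_cong; auto simp: two_def xstr_def)+

definition pairs :: "nat \<Rightarrow> nat set set" where
  "pairs n = {K. K \<subseteq> {..<n} \<and> card K = 2}"

definition singles :: "nat \<Rightarrow> nat set set" where
  "singles n = (\<lambda>i. {i}) ` {..<n}"

lemma pairs_eq: "pairs n = {{i, j} | i j. i < n \<and> j < n \<and> i \<noteq> j}"
  unfolding pairs_def by (auto simp: card_2_iff)

lemma card_pairs: "card (pairs n) = n * (n - 1) div 2"
  unfolding pairs_def using n_subsets[of "{..<n}" 2] by (simp add: choose_two)

lemma card_singles: "card (singles n) = n"
  unfolding singles_def by (subst card_image) (auto simp: inj_on_def)

lemma perm_a0_gens:
  "perm_alg a0 n = lie_closure (2 ^ n) ((\<lambda>K. \<i> \<cdot>\<^sub>m pstr n (xstr K)) ` pairs n)"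
proof -
  have "{ps2 n A B i j |A B i j. (A, B) \<in> a0 \<and> i < n \<and> j < n \<and> i \<noteq> j} = (\<lambda>K. pstr n (xstr K)) ` pairs n"
  proof
    show "{ps2 n A B i j |A B i j. (A, B) \<in> a0 \<and> i < n \<and> j < n \<and> i \<noteq> j} \<subseteq> (\<lambda>K. pstr n (xstr K)) ` pairs n"
      unfolding pairs_eq a0_def using pstr_xstr_pair by (auto simp: ps2_two)
    show "(\<lambda>K. pstr n (xstr K)) ` pairs n \<subseteq> {ps2 n A B i j |A B i j. (A, B) \<in> a0 \<and> i < n \<and> j < n \<and> i \<noteq> j}"
    proof
      fix x
      assume "x \<in> (\<lambda>K. pstr n (xstr K)) ` pairs n"
      then obtain i j where ij: "i < n" "j < n" "i \<noteq> j" "x = pstr n (xstr {i, j})" by (auto simp: pairs_eq)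
      then have "x = ps2 n PX PX i j" using pstr_xstr_pair[of i j n] by (simp add: ps2_two)
      moreover have "(PX, PX) \<in> a0" by (simp add: a0_def)
      ultimately show "x \<in> {ps2 n A B i j |A B i j. (A, B) \<in> a0 \<and> i < n \<and> j < n \<and> i \<noteq> j}"
        using ij by blast
    qed
  qed
  then show ?thesis unfolding perm_alg_def Lie_def by (simp add: image_image)
qed

lemma other_site:
  assumes "n \<ge> 2"
  shows "i < n \<Longrightarrow> \<exists>j<n. (j::nat) \<noteq> i"
  using assms by (intro exI[of _ "if i = 0 then 1 else 0"]) auto

lemma perm_b0_gens:
  assumes "n \<ge> 2"
  shows "perm_alg b0 n = lie_closure (2 ^ n) ((\<lambda>K. \<i> \<cdot>\<^sub>m pstr n (xstr K)) ` singles n)"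
proof -
  have "{ps2 n A B i j |A B i j. (A, B) \<in> b0 \<and> i < n \<and> j < n \<and> i \<noteq> j} = (\<lambda>K. pstr n (xstr K)) ` singles n" (is "?L = ?R")
  proof
    show "?L \<subseteq> ?R" by (auto simp: ps2_two b0_def singles_def pstr_xstr_single)
    show "?R \<subseteq> ?L"
    proof
      fix x
      assume "x \<in> ?R"
      then obtain i where i: "i < n" "x = pstr n (xstr {i})" by (auto simp: singles_def)
      then obtain j where j: "j < n" "j \<noteq> i" using other_site assms by blast
      have "x = ps2 n PX PI i j" using i j pstr_xstr_single(1)[of i j n] by (simp add: ps2_two)
      moreover have "(PX, PI) \<in> b0" by (simp add: b0_def)
      ultimately show "x \<in> ?L" using i j by blast
    qed
  qed
  then show ?thesis unfolding perm_alg_def Lie_def by (simp add: image_image)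
qed

lemma perm_b1_gens:
  assumes "n \<ge> 2"
  shows "perm_alg b1 n = lie_closure (2 ^ n) ((\<lambda>K. \<i> \<cdot>\<^sub>m pstr n (xstr K)) ` (singles n \<union> pairs n))"
proof -
  have "{ps2 n A B i j |A B i j. (A, B) \<in> b1 \<and> i < n \<and> j < n \<and> i \<noteq> j} = (\<lambda>K. pstr n (xstr K)) ` (singles n \<union> pairs n)" (is "?L = ?R")
  proof
    show "?L \<subseteq> ?R"
    proof
      fix x
      assume "x \<in> ?L"
      then obtain A B i j where x: "x = pstr n (two A B i j)" and *: "(A, B) \<in> b1" "i < n" "j < n" "i \<noteq> j"
        by (auto simp: ps2_two)
      have "{i} \<in> singles n" "{j} \<in> singles n" "{i, j} \<in> pairs n" using * by (auto simp: singles_def pairs_eq)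
      moreover have "x = pstr n (xstr {i}) \<or> x = pstr n (xstr {j}) \<or> x = pstr n (xstr {i, j})"
        using * unfolding x b1_def by (auto simp: pstr_xstr_single pstr_xstr_pair)
      ultimately show "x \<in> ?R" by blast
    qed
    have b: "(PX, PI) \<in> b1" "(PX, PX) \<in> b1" by (simp_all add: b1_def)
    show "?R \<subseteq> ?L"
    proof
      fix x
      assume "x \<in> ?R"
      then consider i where "i < n" "x = pstr n (xstr {i})"
        | i j where "i < n" "j < n" "i \<noteq> j" "x = pstr n (xstr {i, j})"
        by (auto simp: singles_def pairs_eq)
      then show "x \<in> ?L"
      proof cases
        case i: 1
        then obtain j where j: "j < n" "j \<noteq> i" using other_site assms by blast
        have "x = ps2 n PX PI i j" using i j pstr_xstr_single(1)[of i j n] by (simp add: ps2_two)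
        then show ?thesis using i j b by blast
      next
        case ij: 2
        have "x = ps2 n PX PX i j" using ij pstr_xstr_pair[of i j n] by (simp add: ps2_two)
        then show ?thesis using ij b by blast
      qed
    qed
  qed
  then show ?thesis unfolding perm_alg_def Lie_def by (simp add: image_image)
qed

theorem perm_a0_iso: "perm_alg a0 n \<cong>\<^sub>L dsum (n * (n - 1) div 2) 1 u1"
  unfolding perm_a0_gens by (rule abelian_iso[OF _ card_pairs]) (auto simp: pairs_def)

theorem perm_b0_iso:
  assumes "n \<ge> 2"
  shows "perm_alg b0 n \<cong>\<^sub>L dsum n 1 u1"
  unfolding perm_b0_gens[OF assms] by (rule abelian_iso[OF _ card_singles]) (auto simp: singles_def)

theorem perm_b1_iso:
  assumes "n \<ge> 2"
  shows "perm_alg b1 n \<cong>\<^sub>L dsum (n * (n + 1) div 2) 1 u1"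
  unfolding perm_b1_gens[OF assms]
proof (rule abelian_iso)
  show "singles n \<union> pairs n \<subseteq> Pow {..<n}" by (auto simp: singles_def pairs_def)
  have "finite (pairs n)" unfolding pairs_def by (rule finite_subset[of _ "Pow {..<n}"]) auto
  then have "card (singles n \<union> pairs n) = card (singles n) + card (pairs n)"
    by (intro card_Un_disjoint) (auto simp: singles_def pairs_def)
  also have "\<dots> = n + n * (n - 1) div 2" by (simp add: card_singles card_pairs)
  also have "\<dots> = (2 * n + n * (n - 1)) div 2" by simp
  also have "2 * n + n * (n - 1) = n * (n + 1)" using assms by (cases n) (auto simp: algebra_simps)
  finally show "card (singles n \<union> pairs n) = n * (n + 1) div 2" .
qed

section \<open>Single-site algebras\<close>

definition pmat :: "pauli \<Rightarrow> complex mat" where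
  "pmat A = mat 2 2 (\<lambda>(a, b). pentry A (a = 1) (b = 1))"

definition emb :: "nat \<Rightarrow> nat \<Rightarrow> complex mat \<Rightarrow> complex mat" where
  "emb n k A = tens n (\<lambda>j a b. if j = k then A $$ (of_bool a, of_bool b) else if a = b then 1 else 0)"

lemma emb_carrier [simp]: "emb n k A \<in> carrier_mat (2 ^ n) (2 ^ n)"
  by (simp add: emb_def)

definition agree_off :: "nat \<Rightarrow> nat \<Rightarrow> nat \<Rightarrow> nat \<Rightarrow> bool" where
  "agree_off n k a b \<longleftrightarrow> (\<forall>j<n. j \<noteq> k \<longrightarrow> qbit a j = qbit b j)"

lemma emb_index:
  assumes "k < n" "a < 2 ^ n" "b < 2 ^ n"
  shows "emb n k A $$ (a, b) =
    (if agree_off n k a b then A $$ (of_bool (qbit a k), of_bool (qbit b k)) else 0)"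
proof -
  have "emb n k A $$ (a, b) = A $$ (of_bool (qbit a k), of_bool (qbit b k)) *
      (\<Prod>j\<in>{..<n} - {k}. if j = k then A $$ (of_bool (qbit a j), of_bool (qbit b j)) else if qbit a j = qbit b j then 1 else 0)"
    using assms by (simp add: emb_def tens_def prod.remove[of _ k])
  also have "(\<Prod>j\<in>{..<n} - {k}. if j = k then A $$ (of_bool (qbit a j), of_bool (qbit b j)) else if qbit a j = qbit b j then 1 else 0)
      = (\<Prod>j\<in>{..<n} - {k}. if qbit a j = qbit b j then 1 else (0::complex))"
    by (intro prod.cong) auto
  also have "\<dots> = (if agree_off n k a b then 1 else 0)"
  proof (cases "agree_off n k a b")
    case True
    then show ?thesis by (simp add: prod.neutral agree_off_def)
  next
    case False
    then obtain j where "j < n" "j \<noteq> k" "qbit a j \<noteq> qbit b j" by (auto simp: agree_off_def)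
    then have "(\<Prod>j\<in>{..<n} - {k}. if qbit a j = qbit b j then 1 else (0::complex)) = 0"
      by (intro prod_zero) (auto intro!: bexI[of _ j])
    then show ?thesis using False by simp
  qed
  finally show ?thesis by simp
qed

text \<open>The site \<open>j\<close> only completes the two-site notation: it receives the
  identity, so any site other than \<open>k\<close> can be chosen.\<close>

lemma emb_pmat: "k < n \<Longrightarrow> emb n k (c \<cdot>\<^sub>m pmat A) = c \<cdot>\<^sub>m pstr n (two A PI k j)" if "k \<noteq> j"
proof -
  assume k: "k < n"
  have "emb n k (c \<cdot>\<^sub>m pmat A) = tens n (\<lambda>j' a b. (if j' = k then c else 1) * pentry (two A PI k j j') a b)"
    unfolding emb_def by (rule tens_cong) (auto simp: pmat_def two_def)
  also have "\<dots> = (\<Prod>j'<n. if j' = k then c else 1) \<cdot>\<^sub>m pstr n (two A PI k j)"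
    unfolding tens_scale pstr_tens ..
  also have "(\<Prod>j'<n. if j' = k then c else 1) = c" using k by simp
  finally show ?thesis .
qed

lemma emb_mult:
  assumes "A \<in> carrier_mat 2 2" "B \<in> carrier_mat 2 2"
  shows "emb n k A * emb n k B = emb n k (A * B)"
proof -
  have "(\<Sum>c\<in>UNIV. A $$ (of_bool a, of_bool c) * B $$ (of_bool c, of_bool b)) = (A * B) $$ (of_bool a, of_bool b)" for a b
    using mult_mat_index[OF assms, of "of_bool a" "of_bool b"]
    by (simp add: UNIV_bool numeral_2_eq_2 del: index_mult_mat(1))
  then show ?thesis
    unfolding emb_def tens_mult by (intro tens_cong) (auto simp: UNIV_bool)
qed

lemma emb_commute:
  assumes "k \<noteq> l"
  shows "emb n k A * emb n l B = emb n l B * emb n k A"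
  unfolding emb_def tens_mult using assms by (intro tens_cong) (auto simp: UNIV_bool)

lemma emb_add:
  assumes "A \<in> carrier_mat 2 2" "B \<in> carrier_mat 2 2" "k < n"
  shows "emb n k (A + B) = emb n k A + emb n k B"
proof (rule eq_matI)
  fix a b
  assume "a < dim_row (emb n k A + emb n k B)" "b < dim_col (emb n k A + emb n k B)"
  then have "a < 2 ^ n" "b < 2 ^ n" by (auto simp: emb_def tens_def)
  moreover from this have "(emb n k A + emb n k B) $$ (a, b) = emb n k A $$ (a, b) + emb n k B $$ (a, b)"
    by (simp add: emb_def tens_def)
  ultimately show "emb n k (A + B) $$ (a, b) = (emb n k A + emb n k B) $$ (a, b)"
    using assms by (simp add: emb_index)
qed (simp_all add: emb_def tens_def)

lemma emb_smult:
  assumes "A \<in> carrier_mat 2 2" "k < n"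
  shows "emb n k (r \<cdot>\<^sub>m A) = r \<cdot>\<^sub>m emb n k A"
proof (rule eq_matI)
  fix a b
  assume "a < dim_row (r \<cdot>\<^sub>m emb n k A)" "b < dim_col (r \<cdot>\<^sub>m emb n k A)"
  then have "a < 2 ^ n" "b < 2 ^ n" by (auto simp: emb_def tens_def)
  moreover from this have "(r \<cdot>\<^sub>m emb n k A) $$ (a, b) = r * emb n k A $$ (a, b)"
    by (simp add: emb_def tens_def)
  ultimately show "emb n k (r \<cdot>\<^sub>m A) $$ (a, b) = (r \<cdot>\<^sub>m emb n k A) $$ (a, b)"
    using assms by (simp add: emb_index)
qed (simp_all add: emb_def tens_def)

lemma emb_comm:
  assumes A: "A \<in> carrier_mat 2 2" and B: "B \<in> carrier_mat 2 2" and k: "k < n"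
  shows "emb n k (comm A B) = comm (emb n k A) (emb n k B)"
proof -
  have c: "A * B \<in> carrier_mat 2 2" "B * A \<in> carrier_mat 2 2" using A B by simp_all
  have eq: "comm A B = A * B + (-1) \<cdot>\<^sub>m (B * A)" unfolding comm_def using c by (intro eq_matI) (simp_all del: index_mult_mat(1))
  have "emb n k (comm A B) = emb n k (A * B) + (-1) \<cdot>\<^sub>m emb n k (B * A)"
    unfolding eq using emb_add[OF c(1) _ k] emb_smult[OF c(2) k] c(2) by simp
  also have "\<dots> = emb n k (A * B) - emb n k (B * A)" by (intro eq_matI) (simp_all add: emb_def tens_def)
  finally show ?thesis by (simp add: comm_def emb_mult A B)
qed

lemma qbit_zero: "\<not> qbit 0 j"
  by (simp add: qbit_def)

lemma qbit_power: "qbit (2 ^ k) j \<longleftrightarrow> j = k"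
  using qbit_add_high[of 0 k j] by (auto simp: qbit_zero)

lemma su2_diag:
  assumes "M \<in> su 2"
  shows "M $$ (1, 1) = - M $$ (0, 0)" "M \<in> carrier_mat 2 2"
proof -
  show c: "M \<in> carrier_mat 2 2" using assms unfolding su_def by blast
  have "tr M = 0" using assms su_iff by blast
  then show "M $$ (1, 1) = - M $$ (0, 0)"
    using c by (simp add: tr_def numeral_2_eq_2 add_eq_0_iff)
qed

text \<open>In a sum of embedded matrices the diagonal reveals each summand only up to a scalar. The
  difference of its two diagonal entries is visible, and tracelessness recovers both from
  it.\<close>

lemma su2_eqI:
  assumes "A \<in> su 2" "B \<in> su 2" "A $$ (0, 1) = B $$ (0, 1)" "A $$ (1, 0) = B $$ (1, 0)"
    "A $$ (0, 0) - A $$ (1, 1) = B $$ (0, 0) - B $$ (1, 1)"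
  shows "A = B"
proof -
  note t = su2_diag
  have "A $$ (0, 0) = B $$ (0, 0)" "A $$ (1, 1) = B $$ (1, 1)"
    using t(1)[OF assms(1)] t(1)[OF assms(2)] assms(5) by simp_all
  then show ?thesis
    using t(2)[OF assms(1)] t(2)[OF assms(2)] assms(3,4)
    by (intro eq_matI) (auto simp: numeral_2_eq_2 less_Suc_eq)
qed

lemma i_pmat_su: "A \<noteq> PI \<Longrightarrow> \<i> \<cdot>\<^sub>m pmat A \<in> su 2"
  unfolding su_iff skew_iff tr_def by (cases A) (auto simp: pmat_def numeral_2_eq_2 less_Suc_eq)

text \<open>In the upper right corner \<i>X has the entry \<i> and \<i>Y the entry 1, which explains
  the imaginary and the real part as coefficients.\<close>

lemma su2_decompose:
  assumes "A \<in> su 2"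
  shows "A = complex_of_real (Im (A $$ (0, 1))) \<cdot>\<^sub>m (\<i> \<cdot>\<^sub>m pmat PX)
    + (complex_of_real (Re (A $$ (0, 1))) \<cdot>\<^sub>m (\<i> \<cdot>\<^sub>m pmat PY) + complex_of_real (Im (A $$ (0, 0))) \<cdot>\<^sub>m (\<i> \<cdot>\<^sub>m pmat PZ))"
proof -
  have c: "A \<in> carrier_mat 2 2" and sk: "\<And>i j. i < 2 \<Longrightarrow> j < 2 \<Longrightarrow> A $$ (i, j) = - cnj (A $$ (j, i))"
    using assms unfolding su_def by blast+
  have "A $$ (1, 0) = - cnj (A $$ (0, 1))" by (rule sk) simp_all
  moreover have "Re (A $$ (0, 0)) = Re (- cnj (A $$ (0, 0)))" by (rule arg_cong[OF sk]) simp_all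
  then have "Re (A $$ (0, 0)) = 0" by simp
  moreover note su2_diag(1)[OF assms]
  ultimately show ?thesis using c
    by (intro eq_matI) (auto simp: pmat_def numeral_2_eq_2 less_Suc_eq complex_eq_iff)
qed

theorem perm_b3_iso:
  assumes n: "n \<ge> 2"
  shows "perm_alg b3 n \<cong>\<^sub>L dsum n 2 (su 2)"
  unfolding perm_alg_def Lie_def
proof -
  let ?S = "(\<cdot>\<^sub>m) \<i> ` {ps2 n A B i j |A B i j. (A, B) \<in> b3 \<and> i < n \<and> j < n \<and> i \<noteq> j}"
  have su2: "A \<in> carrier_mat 2 2" if "A \<in> su 2" for A using that by (simp add: su_def)
  interpret closed: pauli_closed n "strs_of n (perm_alg b3 n)" by (rule pauli_closed_perm)
  have single: "\<i> \<cdot>\<^sub>m pstr n (two A PI k j) \<in> lie_closure (2 ^ n) ?S" if "A \<noteq> PI" "k < n" "j < n" "k \<noteq> j" for A k j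
  proof -
    have XY: "two PX PI k j \<in> strs_of n (perm_alg b3 n)" "two PY PI k j \<in> strs_of n (perm_alg b3 n)"
      by (rule perm_gen; use that in \<open>simp add: b3_def\<close>)+
    then have "two (pm PX PY) PI k j \<in> strs_of n (perm_alg b3 n)"
      by (rule closed.cancel_right) (use that in \<open>auto simp: ac_def\<close>)
    with XY that(1) have "two A PI k j \<in> strs_of n (perm_alg b3 n)" by (cases A) auto
    then show ?thesis by (simp add: strs_of_def perm_alg_def Lie_def)
  qed
  interpret commuting_copies n 2 "2 ^ n" "su 2" "emb n" ?S
  proof
    show "lie_algebra 2 (su 2)" by (rule lie_algebra_su)
    show "emb n k A \<in> carrier_mat (2 ^ n) (2 ^ n)" for k A by simp
    show "emb n k (A + B) = emb n k A + emb n k B" if "k < n" "A \<in> su 2" "B \<in> su 2" for k A B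
      using emb_add su2 that by blast
    show "emb n k (complex_of_real r \<cdot>\<^sub>m A) = complex_of_real r \<cdot>\<^sub>m emb n k A" if "k < n" "A \<in> su 2" for k r A
      using emb_smult su2 that by blast
    show "emb n k (comm A B) = comm (emb n k A) (emb n k B)" if "k < n" "A \<in> su 2" "B \<in> su 2" for k A B
      using emb_comm su2 that by blast
    show "emb n k A * emb n l B = emb n l B * emb n k A" if "k \<noteq> l" for k l A B
      by (rule emb_commute[OF that])
    show "\<exists>k<n. \<exists>A\<in>su 2. x = emb n k A" if "x \<in> ?S" for x
    proof -
      obtain A B i j where x: "x = \<i> \<cdot>\<^sub>m pstr n (two A B i j)" and *: "(A, B) \<in> b3" "i < n" "j < n" "i \<noteq> j"
        using \<open>x \<in> ?S\<close> by (auto simp: ps2_two)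
      have "(A \<noteq> PI \<and> B = PI) \<or> (A = PI \<and> B \<noteq> PI)" using *(1) by (auto simp: b3_def)
      then show ?thesis
      proof
        assume "A \<noteq> PI \<and> B = PI"
        then have "x = emb n i (\<i> \<cdot>\<^sub>m pmat A)" "\<i> \<cdot>\<^sub>m pmat A \<in> su 2"
          using x emb_pmat[OF *(4,2)] i_pmat_su by simp_all
        then show ?thesis using *(2) by blast
      next
        assume AB: "A = PI \<and> B \<noteq> PI"
        then have "pstr n (two A B i j) = pstr n (two B PI j i)" using *(4) by (intro pstr_cong) (auto simp: two_def)
        then have "x = emb n j (\<i> \<cdot>\<^sub>m pmat B)" "\<i> \<cdot>\<^sub>m pmat B \<in> su 2"
          using x AB emb_pmat[OF *(4)[symmetric] *(3)] i_pmat_su by simp_all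
        then show ?thesis using *(3) by blast
      qed
    qed
    show "emb n k A \<in> lie_closure (2 ^ n) ?S" if k: "k < n" and A: "A \<in> su 2" for k A
    proof -
      obtain j where j: "j < n" "j \<noteq> k" using other_site[OF n k] by blast
      have c: "r \<cdot>\<^sub>m (\<i> \<cdot>\<^sub>m pmat P) \<in> carrier_mat 2 2" for r P by (simp add: pmat_def)
      have g: "emb n k (complex_of_real r \<cdot>\<^sub>m (\<i> \<cdot>\<^sub>m pmat P)) \<in> lie_closure (2 ^ n) ?S" if "P \<noteq> PI" for r P
      proof -
        have "emb n k (complex_of_real r \<cdot>\<^sub>m (\<i> \<cdot>\<^sub>m pmat P)) = complex_of_real r \<cdot>\<^sub>m (\<i> \<cdot>\<^sub>m pstr n (two P PI k j))"
          using emb_smult[of "\<i> \<cdot>\<^sub>m pmat P" k n] emb_pmat[OF j(2)[symmetric] k] k by (simp add: pmat_def)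
        then show ?thesis using single[OF that k j(1) j(2)[symmetric]] by (simp add: lie_closure.smult)
      qed
      show ?thesis
        by (subst su2_decompose[OF A], subst emb_add[OF c add_carrier_mat[OF c] k], subst emb_add[OF c c k])
          (intro lie_closure.add g; simp)
    qed
    fix A B :: "nat \<Rightarrow> complex mat" and k
    assume AB: "\<And>k. k < n \<Longrightarrow> A k \<in> su 2 \<and> B k \<in> su 2"
      and eq: "\<And>a b. a < 2 ^ n \<Longrightarrow> b < 2 ^ n \<Longrightarrow> (\<Sum>k<n. emb n k (A k) $$ (a, b)) = (\<Sum>k<n. emb n k (B k) $$ (a, b))"
      and k: "k < n"
    have lt: "(0::nat) < 2 ^ n" "(2::nat) ^ k < 2 ^ n" using k by simp_all
    \<comment> \<open>The basis states 0 and 2^k differ exactly at qubit k, so the off-diagonal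
      entries between them receive a contribution from site k alone.\<close>
    have off: "(\<Sum>l<n. emb n l (A l) $$ (0, 2 ^ k)) = A k $$ (0, 1)" "(\<Sum>l<n. emb n l (A l) $$ (2 ^ k, 0)) = A k $$ (1, 0)" for A
    proof -
      have "(\<Sum>l<n. emb n l (A l) $$ (0, 2 ^ k)) = (\<Sum>l<n. if l = k then A k $$ (0, 1) else 0)"
        using lt k by (intro sum.cong refl) (auto simp: emb_index agree_off_def qbit_zero qbit_power)
      then show "(\<Sum>l<n. emb n l (A l) $$ (0, 2 ^ k)) = A k $$ (0, 1)" using k by simp
      have "(\<Sum>l<n. emb n l (A l) $$ (2 ^ k, 0)) = (\<Sum>l<n. if l = k then A k $$ (1, 0) else 0)"
        using lt k by (intro sum.cong refl) (auto simp: emb_index agree_off_def qbit_zero qbit_power)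
      then show "(\<Sum>l<n. emb n l (A l) $$ (2 ^ k, 0)) = A k $$ (1, 0)" using k by simp
    qed
    \<comment> \<open>On the diagonal all sites contribute, but sites other than k contribute
      equally at 0 and at 2^k and cancel in the difference.\<close>
    have diag: "(\<Sum>l<n. emb n l (A l) $$ (0, 0)) - (\<Sum>l<n. emb n l (A l) $$ (2 ^ k, 2 ^ k)) = A k $$ (0, 0) - A k $$ (1, 1)" for A
    proof -
      have "(\<Sum>l<n. emb n l (A l) $$ (0, 0)) - (\<Sum>l<n. emb n l (A l) $$ (2 ^ k, 2 ^ k)) =
          (\<Sum>l<n. if l = k then A k $$ (0, 0) - A k $$ (1, 1) else 0)"
        unfolding sum_subtractf[symmetric] using lt k
        by (intro sum.cong refl) (auto simp: emb_index agree_off_def qbit_zero qbit_power)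
      then show ?thesis using k by simp
    qed
    show "A k = B k"
    proof (rule su2_eqI)
      show "A k $$ (0, 1) = B k $$ (0, 1)" using eq[OF lt] by (simp only: off)
      show "A k $$ (1, 0) = B k $$ (1, 0)" using eq[OF lt(2,1)] by (simp only: off)
      show "A k $$ (0, 0) - A k $$ (1, 1) = B k $$ (0, 0) - B k $$ (1, 1)"
        using diag[of A] diag[of B] eq[OF lt(1,1)] eq[OF lt(2,2)] by simp
    qed (use AB[OF k] in auto)
  qed
  show "lie_closure (2 ^ n) ?S \<cong>\<^sub>L dsum n 2 (su 2)" by (rule iso_dsum)
qed

section \<open>Relabelling the Pauli matrices\<close>

text \<open>The cycle from X to Z to Y and back to X, in the direction realised by the conjugation
  below.\<close>

fun rot :: "pauli \<Rightarrow> pauli" where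
  "rot PI = PI" | "rot PX = PZ" | "rot PY = PX" | "rot PZ = PY"

text \<open>The matrix (1 + i(X + Y + Z))/2, a rotation by 120 degrees about the axis (1, 1, 1).\<close>

definition clifford :: "bool \<Rightarrow> bool \<Rightarrow> complex" where
  "clifford a b = (if a then (if b then 1 - \<i> else \<i> - 1) else 1 + \<i>) / 2"

lemma clifford_unitary: "(\<Sum>c\<in>UNIV. clifford a c * cnj (clifford b c)) = (if a = b then 1 else 0)"
  by (cases a; cases b) (auto simp: UNIV_bool clifford_def complex_eq_iff)

lemma clifford_pentry:
  "(\<Sum>c\<in>UNIV. clifford a c * pentry A c b) = (\<Sum>c\<in>UNIV. pentry (rot A) a c * clifford c b)"
  by (cases A; cases a; cases b) (auto simp: UNIV_bool clifford_def complex_eq_iff)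

text \<open>The n-fold tensor power of the rotation acts letter by letter and without signs, so it
  maps generators onto generators and the generated algebra onto the generated algebra.\<close>

theorem perm_rot_iso: "perm_alg G n \<cong>\<^sub>L perm_alg (map_prod rot rot ` G) n"
proof -
  let ?V = "tens n (\<lambda>_. clifford)" and ?W = "tens n (\<lambda>_ a b. cnj (clifford b a))"
  let ?S = "\<lambda>G. (\<cdot>\<^sub>m) \<i> ` {ps2 n A B i j |A B i j. (A, B) \<in> G \<and> i < n \<and> j < n \<and> i \<noteq> j}"
  interpret conjugation "2 ^ n" ?V ?W
    by standard (simp_all add: tens_mult clifford_unitary tens_one)
  have VP: "?V * pstr n s = pstr n (\<lambda>j. rot (s j)) * ?V" for s
    unfolding pstr_tens tens_mult by (simp only: clifford_pentry)
  have conj: "?V * (\<i> \<cdot>\<^sub>m pstr n s) * ?W = \<i> \<cdot>\<^sub>m pstr n (\<lambda>j. rot (s j))" for s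
  proof -
    have "?V * pstr n s * ?W = pstr n (\<lambda>j. rot (s j)) * (?V * ?W)"
      unfolding VP by (rule assoc_mult_mat[OF pstr_carrier V W])
    also have "\<dots> = pstr n (\<lambda>j. rot (s j))"
      unfolding VW by (rule right_mult_one_mat[OF pstr_carrier])
    finally show ?thesis using conj_smult[OF pstr_carrier[of n s]] by simp
  qed
  have rot_two: "(\<lambda>k. rot (two A B i j k)) = two (rot A) (rot B) i j" for A B i j
    by (auto simp: two_def)
  have gen: "\<i> \<cdot>\<^sub>m pstr n (two A B i j) \<in> ?S G" if "(A, B) \<in> G" "i < n" "j < n" "i \<noteq> j" for A B i j G
  proof (rule image_eqI)
    show "\<i> \<cdot>\<^sub>m pstr n (two A B i j) = \<i> \<cdot>\<^sub>m ps2 n A B i j" by (simp add: ps2_two)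
    show "ps2 n A B i j \<in> {ps2 n A B i j |A B i j. (A, B) \<in> G \<and> i < n \<and> j < n \<and> i \<noteq> j}" using that by blast
  qed
  have im: "(\<lambda>M. ?V * M * ?W) ` ?S G = ?S (map_prod rot rot ` G)"
  proof
    show "(\<lambda>M. ?V * M * ?W) ` ?S G \<subseteq> ?S (map_prod rot rot ` G)"
    proof
      fix y
      assume "y \<in> (\<lambda>M. ?V * M * ?W) ` ?S G"
      then obtain A B i j where y: "y = ?V * (\<i> \<cdot>\<^sub>m pstr n (two A B i j)) * ?W" and *: "(A, B) \<in> G" "i < n" "j < n" "i \<noteq> j"
        by (auto simp: ps2_two)
      have "(rot A, rot B) \<in> map_prod rot rot ` G" using *(1) by force
      then show "y \<in> ?S (map_prod rot rot ` G)"
        unfolding y conj rot_two using *(2-4) by (rule gen)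
    qed
    show "?S (map_prod rot rot ` G) \<subseteq> (\<lambda>M. ?V * M * ?W) ` ?S G"
    proof
      fix y
      assume "y \<in> ?S (map_prod rot rot ` G)"
      then obtain A B i j where y: "y = \<i> \<cdot>\<^sub>m pstr n (two (rot A) (rot B) i j)" and *: "(A, B) \<in> G" "i < n" "j < n" "i \<noteq> j"
        by (auto simp: ps2_two)
      have "y = ?V * (\<i> \<cdot>\<^sub>m pstr n (two A B i j)) * ?W" unfolding y conj rot_two ..
      then show "y \<in> (\<lambda>M. ?V * M * ?W) ` ?S G" using gen[OF *] by (rule image_eqI)
    qed
  qed
  have car: "?S G \<subseteq> carrier_mat (2 ^ n) (2 ^ n)" by (auto simp: ps2_two)
  show ?thesis
    unfolding perm_alg_def Lie_def im[symmetric]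
    by (rule conj_iso[OF image_lie_closure(2)[OF car] image_lie_closure(1)[OF car]])
qed

text \<open>The rotation sends {XX, YY, ZZ, ZY} to {ZZ, XX, YY, YX}. Up to the order of sites this
  is {XX, YY, XY} enlarged by ZZ, which the commutant description already places in the smaller
  algebra.\<close>

theorem chain_a20_iso:
  assumes n: "n \<ge> 3"
  shows "chain_alg a20 n \<cong>\<^sub>L perm_alg a14 n"
proof -
  let ?G = "map_prod rot rot ` a20"
  have G: "?G = {(PZ, PZ), (PX, PX), (PY, PY), (PY, PX)}" by (auto simp: a20_def)
  interpret g: pauli_closed n "strs_of n (perm_alg ?G n)" by (rule pauli_closed_perm)
  interpret a: pauli_closed n "strs_of n (perm_alg a14 n)" by (rule pauli_closed_perm)
  have "perm_alg ?G n \<subseteq> perm_alg a14 n"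
  proof (rule perm_alg_subset_perm)
    fix A B i j
    assume *: "(A, B) \<in> ?G" "i < n" "j < n" "i \<noteq> j"
    consider "(A, B) \<in> a14" | "(B, A) \<in> a14" | "A = PZ" "B = PZ" using *(1) unfolding G a14_def by auto
    then show "two A B i j \<in> strs_of n (perm_alg a14 n)"
    proof cases
      case 1
      then show ?thesis using * by (intro perm_gen)
    next
      case 2
      then show ?thesis using perm_gen[of B A a14 j n i] a.two_swap[of j i B A] * by simp
    next
      case 3
      obtain k where k: "k < n" "k \<noteq> i" "k \<noteq> j" using third_site n by blast
      have "\<i> \<cdot>\<^sub>m pstr n (two PZ PZ i j) \<in> commutant n {\<lambda>_. PI, \<lambda>_. PZ}"
      proof (rule pstr_in_commutant)
        fix q :: "nat \<Rightarrow> pauli"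
        assume q: "q \<in> {\<lambda>_. PI, \<lambda>_. PZ}"
        then show "\<not> acomm n (two PZ PZ i j) q" using * by (auto simp: acomm_const_two)
        have "two PZ PZ i j i \<noteq> PI" "two PZ PZ i j k \<noteq> PZ" using k by (auto simp: two_def)
        then show "\<exists>m<n. two PZ PZ i j m \<noteq> q m" using q k(1) *(2) by auto
      qed
      then show ?thesis using 3 perm_a14_commutant[OF n] by (simp add: strs_of_def)
    qed
  qed
  moreover have "perm_alg a14 n \<subseteq> perm_alg ?G n"
  proof (rule perm_alg_subset_perm)
    fix A B i j
    assume *: "(A, B) \<in> a14" "i < n" "j < n" "i \<noteq> j"
    have "(A, B) \<in> ?G \<or> (B, A) \<in> ?G" using *(1) unfolding G a14_def by auto
    then show "two A B i j \<in> strs_of n (perm_alg ?G n)"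
      using perm_gen[of A B ?G i n j] perm_gen[of B A ?G j n i] g.two_swap[of j i B A] * by auto
  qed
  ultimately have "perm_alg ?G n = perm_alg a14 n" by blast
  then show ?thesis using perm_rot_iso[of a20 n] perm_a20[of n] n by simp
qed

theorem theorem3:
  fixes n :: nat
  assumes "n \<ge> 3"
  shows "(perm_alg a7 n = chain_alg a7 n) \<and>
    (perm_alg a16 n = chain_alg a16 n) \<and>
    (perm_alg a20 n = chain_alg a20 n) \<and>
    (perm_alg a22 n = chain_alg a22 n) \<and>
    (perm_alg a0 n \<cong>\<^sub>L dsum (n * (n - 1) div 2) 1 u1) \<and>
    (perm_alg a2 n = {g \<in> so (2 ^ n). g * pstr n (\<lambda>_. PZ) = pstr n (\<lambda>_. PZ) * g}) \<and>
    (perm_alg a2 n \<cong>\<^sub>L dsum 2 (2 ^ (n - 1)) (so (2 ^ (n - 1)))) \<and>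
    (perm_alg a4 n = chain_alg a7 n) \<and>
    (odd n \<longrightarrow> chain_alg a7 n \<cong>\<^sub>L su (2 ^ (n - 1))) \<and>
    (even n \<and> n \<ge> 4 \<longrightarrow> chain_alg a7 n \<cong>\<^sub>L dsum 4 (2 ^ (n - 2)) (su (2 ^ (n - 2)))) \<and>
    (perm_alg a6 n = chain_alg a20 n) \<and>
    (chain_alg a20 n \<cong>\<^sub>L perm_alg a14 n) \<and>
    (perm_alg a14 n \<cong>\<^sub>L dsum 2 (2 ^ (n - 1)) (su (2 ^ (n - 1)))) \<and>
    (perm_alg b0 n = chain_alg b0 n) \<and>
    (chain_alg b0 n \<cong>\<^sub>L dsum n 1 u1) \<and>
    (perm_alg b1 n \<cong>\<^sub>L dsum (n * (n + 1) div 2) 1 u1) \<and>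
    (perm_alg b3 n = chain_alg b3 n) \<and>
    (chain_alg b3 n \<cong>\<^sub>L dsum n 2 (su 2))"
proof -
  define m where "m = n - 1"
  have n: "n = Suc m" and n2: "n \<ge> 2" and m: "n - 1 = m" using assms by (simp_all add: m_def)
  have a14: "perm_alg a14 n \<cong>\<^sub>L dsum 2 (2 ^ (n - 1)) (su (2 ^ (n - 1)))"
    unfolding m perm_a14_commutant[OF assms] by (rule commutant_Z_iso[of m, folded n])
  have a2: "perm_alg a2 n \<cong>\<^sub>L dsum 2 (2 ^ (n - 1)) (so (2 ^ (n - 1)))"
    unfolding m perm_a2_eq by (rule so_Z_iso[of m, folded n])
  have a7_odd: "chain_alg a7 n \<cong>\<^sub>L su (2 ^ (n - 1))" if "odd n"
  proof -
    have "even m" using that n by simp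
    then show ?thesis
      unfolding m chain_a7_commutant[OF assms]
      by (rule commutant_all_odd_iso[of m, folded n, unfolded all_consts_def])
  qed
  have a7_even: "chain_alg a7 n \<cong>\<^sub>L dsum 4 (2 ^ (n - 2)) (su (2 ^ (n - 2)))" if "even n"
  proof -
    define l where "l = n - 2"
    have l: "n = l + 2" and l': "n - 2 = l" and "even l" using n2 that by (simp_all add: l_def)
    then show ?thesis
      unfolding l' chain_a7_commutant[OF assms]
      by (intro commutant_all_even_iso[of l, folded l, unfolded all_consts_def])
  qed
  show ?thesis
    by (intro conjI impI perm_a7 perm_a16 perm_a20[OF n2] perm_a22[OF assms] perm_a0_iso perm_a2_eq a2
        perm_a4[OF assms] perm_a6[OF assms] chain_a20_iso[OF assms] a14 perm_b0 perm_b1_iso[OF n2] perm_b3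
        perm_b0_iso[OF n2, unfolded perm_b0] perm_b3_iso[OF n2, unfolded perm_b3] a7_odd a7_even)
      simp_all
qed

end
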